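(* There exists a numerical constant $C>0$ such that $\min_{\tilde{\mathcal A}_\delta}\tilde E_h\le Ch^{5/3}$ for all $h\in(0,1/2]$ and all $\delta\in[0,1/2]$.
   Context: Let $B_1=\{x\in\mathbb R^2:|x|<1\}$ and $\hat x^\perp=(-x_2,x_1)/|x|$. For $h>0$ define $\tilde E_h:W^{1,2}(B_1;\mathbb R^2)\times W^{2,2}(B_1)\to\mathbb R$ by \[ \tilde E_h(U,W)=\int_{B_1}\big|DU+DU^T+DW\otimes DW+\hat x^\perp\otimes\hat x^\perp\big|^2+h^2|D^2W|^2\,dx . \] For $\delta$ let $\tilde{\mathcal A}_\delta=\{(U,W)\in W^{1,2}(B_1;\mathbb R^2)\times W^{2,2}(B_1): W(0)=0,\ |W|\le 1-\delta \text{ on }\partial B_1\}$. *)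

theory Defs
  imports "HOL-Analysis.Analysis"
begin

definition partial :: "(real^2 \<Rightarrow> real) \<Rightarrow> 2 \<Rightarrow> real^2 \<Rightarrow> real" where
  "partial \<phi> i x = frechet_derivative \<phi> (at x) (axis i 1)"

coinductive smooth_fun :: "(real^2 \<Rightarrow> real) \<Rightarrow> bool" where
  "\<phi> differentiable_on UNIV \<Longrightarrow> continuous_on UNIV \<phi> \<Longrightarrow>
   (\<forall>i. smooth_fun (partial \<phi> i)) \<Longrightarrow> smooth_fun \<phi>"

definition test_fun :: "(real^2) set \<Rightarrow> (real^2 \<Rightarrow> real) \<Rightarrow> bool" where
  "test_fun \<Omega> \<phi> \<longleftrightarrow> smooth_fun \<phi> \<and> compact (closure {x. \<phi> x \<noteq> 0})
      \<and> closure {x. \<phi> x \<noteq> 0} \<subseteq> \<Omega>"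

definition weak_partial :: "(real^2) set \<Rightarrow> (real^2 \<Rightarrow> real) \<Rightarrow> 2 \<Rightarrow> (real^2 \<Rightarrow> real) \<Rightarrow> bool" where
  "weak_partial \<Omega> f i g \<longleftrightarrow>
     (\<forall>\<phi>. test_fun \<Omega> \<phi> \<longrightarrow>
        integrable (lebesgue_on \<Omega>) (\<lambda>x. f x * partial \<phi> i x) \<and>
        integrable (lebesgue_on \<Omega>) (\<lambda>x. g x * \<phi> x) \<and>
        (\<integral>x. f x * partial \<phi> i x \<partial>lebesgue_on \<Omega>) = - (\<integral>x. g x * \<phi> x \<partial>lebesgue_on \<Omega>))"

definition L2_on :: "(real^2) set \<Rightarrow> (real^2 \<Rightarrow> real) \<Rightarrow> bool" where
  "L2_on \<Omega> f \<longleftrightarrow> f \<in> borel_measurable (lebesgue_on \<Omega>) \<and>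
     integrable (lebesgue_on \<Omega>) (\<lambda>x. (f x)\<^sup>2)"

definition W12 :: "(real^2) set \<Rightarrow> (real^2 \<Rightarrow> real) \<Rightarrow> (2 \<Rightarrow> real^2 \<Rightarrow> real) \<Rightarrow> bool" where
  "W12 \<Omega> f Df \<longleftrightarrow> L2_on \<Omega> f \<and> (\<forall>i. L2_on \<Omega> (Df i) \<and> weak_partial \<Omega> f i (Df i))"

definition W22 :: "(real^2) set \<Rightarrow> (real^2 \<Rightarrow> real) \<Rightarrow> (2 \<Rightarrow> real^2 \<Rightarrow> real)
                  \<Rightarrow> (2 \<Rightarrow> 2 \<Rightarrow> real^2 \<Rightarrow> real) \<Rightarrow> bool" where
  "W22 \<Omega> f Df D2f \<longleftrightarrow> W12 \<Omega> f Df \<and> (\<forall>i. W12 \<Omega> (Df i) (D2f i))"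

definition W12_vec :: "(real^2) set \<Rightarrow> (real^2 \<Rightarrow> real^2) \<Rightarrow> (2 \<Rightarrow> 2 \<Rightarrow> real^2 \<Rightarrow> real) \<Rightarrow> bool" where
  "W12_vec \<Omega> U DU \<longleftrightarrow> (\<forall>k. W12 \<Omega> (\<lambda>x. U x $ k) (DU k))"

text \<open>Unit vector xhat-perp = (-x_2, x_1)/|x| (the value at x = 0 is irrelevant).\<close>
definition xperp :: "real^2 \<Rightarrow> 2 \<Rightarrow> real" where
  "xperp x = (\<lambda>i. (vector [- (x$2), x$1] :: real^2) $ i / norm x)"

definition energy :: "real \<Rightarrow> (2 \<Rightarrow> 2 \<Rightarrow> real^2 \<Rightarrow> real) \<Rightarrow> (2 \<Rightarrow> real^2 \<Rightarrow> real)
                      \<Rightarrow> (2 \<Rightarrow> 2 \<Rightarrow> real^2 \<Rightarrow> real) \<Rightarrow> ennreal" where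
  "energy h DU DW D2W =
     (\<integral>\<^sup>+ x. ennreal
        ((\<Sum>i\<in>UNIV. \<Sum>j\<in>UNIV. (DU i j x + DU j i x + DW i x * DW j x + xperp x i * xperp x j)\<^sup>2)
         + h\<^sup>2 * (\<Sum>i\<in>UNIV. \<Sum>j\<in>UNIV. (D2W i j x)\<^sup>2))
      \<partial>lebesgue_on (ball 0 1))"

text \<open>Admissible class tilde A_delta. W \<in> W^{2,2}(B_1) is represented by its continuous
  representative on the closed disc (W^{2,2} embeds into C(closed B_1) in 2D), so
  the point value W(0) and the boundary values are meaningful.\<close>
definition admissible :: "real \<Rightarrow> (real^2 \<Rightarrow> real^2) \<Rightarrow> (real^2 \<Rightarrow> real)
     \<Rightarrow> (2 \<Rightarrow> 2 \<Rightarrow> real^2 \<Rightarrow> real) \<Rightarrow> (2 \<Rightarrow> real^2 \<Rightarrow> real) \<Rightarrow> (2 \<Rightarrow> 2 \<Rightarrow> real^2 \<Rightarrow> real) \<Rightarrow> bool" where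
  "admissible \<delta> U W DU DW D2W \<longleftrightarrow>
     W12_vec (ball 0 1) U DU \<and> W22 (ball 0 1) W DW D2W \<and>
     continuous_on (cball 0 1) W \<and> W 0 = 0 \<and>
     (\<forall>x. norm x = 1 \<longrightarrow> \<bar>W x\<bar> \<le> 1 - \<delta>)"

end

theory Submission
  imports Defs
begin

text \<open>
  The pyramid \<open>\<beta> (\<bar>x\<^sub>1\<bar> + \<bar>x\<^sub>2\<bar>)\<close> with \<open>\<beta>\<^sup>2 = \<pi>/4\<close> carries the same curvature at its apex as
  the cone \<open>\<bar>x\<bar>\<close>, so it has zero membrane energy for a suitable Lipschitz displacement. Reflecting its
  outer part in a horizontal plane does not change \<open>DW \<otimes> DW\<close>; this gives a piecewise linear height
  \<open>\<beta>/2 - \<beta> \<bar>\<bar>x\<^sub>1\<bar> + \<bar>x\<^sub>2\<bar> - 1/2\<bar>\<close>, small on the unit circle, whose folds are straight: the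
  coordinate axes and the square \<open>\<bar>x\<^sub>1\<bar> + \<bar>x\<^sub>2\<bar> = 1/2\<close>.

  Let \<open>\<eta>\<close> be a small multiple of \<open>h\<close>. A fold with linear coordinates \<open>p\<close> (along) and \<open>q\<close> (across) is
  smoothed to \<open>\<sigma>(p) \<phi>(q/\<sigma>(p))\<close>, where \<open>\<sigma>\<^sup>3\<close> is about \<open>\<eta> d\<^sup>2\<close> at distance \<open>d\<close> from the vertices. The
  displacement \<open>\<sigma> \<psi> dq + \<sigma> \<sigma>' \<xi> dp\<close> cancels every strain component except the \<open>dp \<otimes> dp\<close> one, which is
  of order \<open>\<sigma>'\<^sup>2 + \<bar>\<sigma> \<sigma>''\<bar>\<close>, hence of order \<open>\<eta>/\<sigma>\<close>, just like \<open>\<eta> \<bar>D\<^sup>2W\<bar>\<close>. The energy density is thus of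
  order \<open>\<eta>\<^sup>2/\<sigma>\<^sup>2\<close> on strips of width \<open>2\<sigma>\<close>, and integrating gives \<open>\<eta>\<^sup>2 \<integral> 1/\<sigma>\<close>, of order \<open>\<eta>\<close> to the power
  \<open>5/3\<close>. Two strips meet only near a vertex, where \<open>\<sigma>\<close> is comparable to \<open>\<eta>\<close> and a uniform bound on
  the density suffices.
\<close>

section \<open>Weak derivatives of planar functions\<close>

text \<open>Reflecting the round cone would lower the boundary too, but its fold is a circle:
  smoothed at width \<epsilon>, the displacement across the fold is of order \<epsilon> and causes a
  hoop strain of the same order, so the cost \<epsilon>^3 + h^2/\<epsilon> is at best of order
  h^(3/2), more than h^(5/3). Across a straight fold of constant width this displacement stretches
  nothing along the fold; hence a polyhedral surface.

  The value of \<beta> matches areas: the curvature of a convex cone at its apex is the area of the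
  convex hull of its gradients, which is 4 \<beta>^2 for the four slopes of the pyramid and \<pi>
  for the unit disc.

  The obstacle is that smoothings of different folds are incompatible where the folds meet. Nothing
  is matched there: the corrections are only kept bounded. As the widths shrink to order \<eta> at
  the vertices, the overlaps have area of order \<eta>^2, cheaper than \<eta>^(5/3); a constant
  width would make either the overlaps or the folds too expensive. One competitor serves all
  \<delta> at once, its boundary values being at most 1/2 in modulus.\<close>

definition pt :: "real \<Rightarrow> real \<Rightarrow> real^2" where
  "pt a b = (\<chi> i. if i = 1 then a else b)"

lemma pt_nth [simp]: "pt a b $ 1 = a" "pt a b $ 2 = b"
  by (simp_all add: pt_def)

lemma continuous_pt: "continuous_on UNIV (\<lambda>p. pt (fst p) (snd p))"
proof -
  have "continuous_on UNIV (\<lambda>p::real\<times>real. (if i = 1 then fst p else snd p))" for i :: 2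
    by (cases "i = 1") (auto intro: continuous_intros)
  then show ?thesis unfolding pt_def by (intro continuous_on_vec_lambda) auto
qed

lemma pt_measurable [measurable (raw)]:
  assumes [measurable]: "f \<in> borel_measurable M" "g \<in> borel_measurable M"
  shows "(\<lambda>x. pt (f x) (g x)) \<in> borel_measurable M"
  using measurable_compose[OF _ borel_measurable_continuous_onI[OF continuous_pt],
      of "\<lambda>x. (f x, g x)" M] by (simp add: borel_prod[symmetric])

lemma pt_measurable_borel [measurable]: "(\<lambda>p. pt (fst p) (snd p)) \<in> borel_measurable borel"
  by (intro borel_measurable_continuous_onI continuous_pt)

lemma Basis_real2: "(Basis :: (real^2) set) = {axis 1 1, axis 2 1}"
  by (auto simp: Basis_vec_def UNIV_2)

lemma norm_real2: "norm (x::real^2) = sqrt ((x$1)\<^sup>2 + (x$2)\<^sup>2)"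
  by (simp add: norm_vec_def L2_set_def UNIV_2)

text \<open>Moves Lebesgue measure from pairs to \<open>real^2\<close>, so that planar integrals can
  be computed as iterated ones in either order.\<close>

lemma lborel_real2: "distr lborel borel (\<lambda>p. pt (fst p) (snd p)) = lborel"
proof (rule lborel_eqI[symmetric])
  fix l u :: "real^2"
  assume lu: "\<And>b. b \<in> Basis \<Longrightarrow> l \<bullet> b \<le> u \<bullet> b"
  have l1: "l $ 1 \<le> u $ 1" and l2: "l $ 2 \<le> u $ 2"
    using lu[of "axis 1 1"] lu[of "axis 2 1"] by (auto simp: Basis_real2 inner_axis)
  have "(\<lambda>p. pt (fst p) (snd p)) -` box l u = box (l$1, l$2) (u$1, u$2)"
    by (auto simp: box_def Basis_real2 inner_axis Basis_prod_def)
  then have "emeasure (distr lborel borel (\<lambda>p. pt (fst p) (snd p))) (box l u)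
      = emeasure lborel (box (l$1, l$2) (u$1, u$2))"
    by (subst emeasure_distr) auto
  also have "\<dots> = ennreal ((u$1 - l$1) * (u$2 - l$2))"
    using l1 l2
    by (subst emeasure_lborel_box) (auto simp: Basis_prod_def)
  also have "\<dots> = (\<Prod>b\<in>Basis. (u - l) \<bullet> b)"
    by (simp add: Basis_real2 inner_axis axis_eq_axis)
  finally show "emeasure (distr lborel borel (\<lambda>p. pt (fst p) (snd p))) (box l u)
      = (\<Prod>b\<in>Basis. (u - l) \<bullet> b)" .
qed simp

lemma nn_integral_real2:
  assumes [measurable]: "f \<in> borel_measurable borel"
  shows "(\<integral>\<^sup>+x. f x \<partial>lborel) = (\<integral>\<^sup>+a. \<integral>\<^sup>+b. f (pt a b) \<partial>lborel \<partial>lborel)"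
    and "(\<integral>\<^sup>+x. f x \<partial>lborel) = (\<integral>\<^sup>+b. \<integral>\<^sup>+a. f (pt a b) \<partial>lborel \<partial>lborel)"
proof -
  have *: "(\<integral>\<^sup>+x. f x \<partial>lborel) = (\<integral>\<^sup>+p. f (pt (fst p) (snd p)) \<partial>(lborel \<Otimes>\<^sub>M lborel))"
    by (subst lborel_real2[symmetric], subst nn_integral_distr) (auto simp: lborel_prod)
  have m: "(\<lambda>p. f (pt (fst p) (snd p))) \<in> borel_measurable (lborel \<Otimes>\<^sub>M lborel)"
    by measurable
  show "(\<integral>\<^sup>+x. f x \<partial>lborel) = (\<integral>\<^sup>+a. \<integral>\<^sup>+b. f (pt a b) \<partial>lborel \<partial>lborel)"
    unfolding * by (subst lborel.nn_integral_fst[OF m, symmetric]) simp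
  show "(\<integral>\<^sup>+x. f x \<partial>lborel) = (\<integral>\<^sup>+b. \<integral>\<^sup>+a. f (pt a b) \<partial>lborel \<partial>lborel)"
    unfolding * by (subst lborel_pair.nn_integral_snd[symmetric]) (use m in \<open>auto simp: case_prod_beta\<close>)
qed

section \<open>Integration by parts along coordinate lines\<close>

lemma has_integral_zero_line:
  fixes g h :: "real \<Rightarrow> real"
  assumes "continuous_on UNIV g"
    and "\<And>t. t \<noteq> 0 \<Longrightarrow> (g has_real_derivative h t) (at t)"
    and "\<And>t. \<bar>t\<bar> \<ge> 1 \<Longrightarrow> g t = 0" "\<And>t. \<bar>t\<bar> \<ge> 1 \<Longrightarrow> h t = 0"
  shows "(h has_integral 0) UNIV"
proof -
  have "(h has_integral (g 1 - g (-1))) {-1..1}"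
    using assms(1,2)
    by (intro fundamental_theorem_of_calculus_interior_strong[of "{0}"])
      (auto simp: has_real_derivative_iff_has_vector_derivative[symmetric] intro: continuous_on_subset)
  then have "(h has_integral 0) {-1..1}" using assms(3) by simp
  moreover have "h x = 0" if "x \<notin> {-1..1}" for x using assms(4)[of x] that by auto
  ultimately show ?thesis by (auto intro: has_integral_on_superset)
qed

text \<open>Each line parallel to axis \<open>i\<close> meets the set \<open>x $ i = 0\<close>
  exactly once, so a continuous \<open>G\<close> may have a kink there: the fundamental theorem of
  calculus still makes the integral over almost every line vanish, and Fubini concludes. The
  exceptional set is dictated by the displacement of the pyramid, which has kinks across the
  axes.\<close>

lemma integral_axis_derivative_zero:
  fixes G h :: "real^2 \<Rightarrow> real"
  assumes cont: "continuous_on UNIV G" and int: "integrable lborel h"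
    and der: "\<And>x. x $ i \<noteq> 0 \<Longrightarrow> ((\<lambda>t. G (x + t *\<^sub>R axis i 1)) has_real_derivative h x) (at 0)"
    and supp: "\<And>x. norm x \<ge> 1 \<Longrightarrow> G x = 0" "\<And>x. norm x \<ge> 1 \<Longrightarrow> h x = 0"
  shows "(\<integral>x. h x \<partial>lborel) = 0"
proof -
  have [measurable]: "h \<in> borel_measurable borel" using int by auto
  have m: "(\<lambda>p. h (pt (fst p) (snd p))) \<in> borel_measurable (lborel \<Otimes>\<^sub>M lborel)" by measurable
  have int': "integrable (lborel \<Otimes>\<^sub>M lborel) (\<lambda>p. h (pt (fst p) (snd p)))"
    using int by (subst (asm) lborel_real2[symmetric], subst (asm) integrable_distr_eq)
      (auto simp: lborel_prod)
  have eq: "(\<integral>x. h x \<partial>lborel) = (\<integral>p. h (pt (fst p) (snd p)) \<partial>(lborel \<Otimes>\<^sub>M lborel))"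
    by (subst lborel_real2[symmetric], subst integral_distr) (auto simp: lborel_prod)
  have n: "norm (pt a b) \<ge> 1" if "\<bar>a\<bar> \<ge> 1 \<or> \<bar>b\<bar> \<ge> 1" for a b
    using component_le_norm_cart[of "pt a b" 1] component_le_norm_cart[of "pt a b" 2] that by auto
  have slice: "(\<integral>t. g t \<partial>lborel) = 0" if "integrable lborel g" "(g has_integral 0) UNIV" for g :: "real \<Rightarrow> real"
    using has_integral_integral_lborel[OF that(1)] that(2) has_integral_unique by blast
  have i: "i = 1 \<or> i = 2" by (rule exhaust_2)
  then show ?thesis
  proof
    assume i: "i = 1"
    have "((\<lambda>a. h (pt a b)) has_integral 0) UNIV" for b
    proof (rule has_integral_zero_line[where g = "\<lambda>a. G (pt a b)"])
      have "continuous_on UNIV ((\<lambda>p. pt (fst p) (snd p)) \<circ> (\<lambda>a. (a, b)))"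
        by (intro continuous_on_compose continuous_intros continuous_on_subset[OF continuous_pt]) auto
      then show "continuous_on UNIV (\<lambda>a. G (pt a b))"
        by (intro continuous_on_compose2[OF cont]) (auto simp: o_def)
      show "((\<lambda>a. G (pt a b)) has_real_derivative h (pt t b)) (at t)" if "t \<noteq> 0" for t
      proof -
        have e: "pt t b + s *\<^sub>R axis i 1 = pt (s + t) b" for s
          by (auto simp: vec_eq_iff forall_2 i axis_def)
        show ?thesis using der[of "pt t b"] that unfolding e
          using DERIV_shift[of "\<lambda>a. G (pt a b)" "h (pt t b)" 0 t] by (simp add: i)
      qed
    qed (use supp n in auto)
    then have z: "(\<integral>a. h (pt a b) \<partial>lborel) = 0" if "integrable lborel (\<lambda>a. h (pt a b))" for b
      using slice[of "\<lambda>a. h (pt a b)"] that by simp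
    have "(\<integral>p. h (pt (fst p) (snd p)) \<partial>(lborel \<Otimes>\<^sub>M lborel)) = (\<integral>b. \<integral>a. h (pt a b) \<partial>lborel \<partial>lborel)"
      using lborel_pair.integral_snd[of "\<lambda>a b. h (pt a b)"] int' by (simp add: case_prod_beta')
    also have "\<dots> = (\<integral>b. 0 \<partial>(lborel::real measure))"
      using lborel_pair.AE_integrable_snd[of "\<lambda>a b. h (pt a b)"] int' z
      by (intro integral_cong_AE) (auto simp: case_prod_beta' elim!: eventually_mono)
    finally show ?thesis unfolding eq by simp
  next
    assume i: "i = 2"
    have "((\<lambda>b. h (pt a b)) has_integral 0) UNIV" for a
    proof (rule has_integral_zero_line[where g = "\<lambda>b. G (pt a b)"])
      have "continuous_on UNIV ((\<lambda>p. pt (fst p) (snd p)) \<circ> (\<lambda>b. (a, b)))"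
        by (intro continuous_on_compose continuous_intros continuous_on_subset[OF continuous_pt]) auto
      then show "continuous_on UNIV (\<lambda>b. G (pt a b))"
        by (intro continuous_on_compose2[OF cont]) (auto simp: o_def)
      show "((\<lambda>b. G (pt a b)) has_real_derivative h (pt a t)) (at t)" if "t \<noteq> 0" for t
      proof -
        have e: "pt a t + s *\<^sub>R axis i 1 = pt a (s + t)" for s
          by (auto simp: vec_eq_iff forall_2 i axis_def)
        show ?thesis using der[of "pt a t"] that unfolding e
          using DERIV_shift[of "\<lambda>b. G (pt a b)" "h (pt a t)" 0 t] by (simp add: i)
      qed
    qed (use supp n in auto)
    then have z: "(\<integral>b. h (pt a b) \<partial>lborel) = 0" if "integrable lborel (\<lambda>b. h (pt a b))" for a
      using slice[of "\<lambda>b. h (pt a b)"] that by simp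
    have "(\<integral>p. h (pt (fst p) (snd p)) \<partial>(lborel \<Otimes>\<^sub>M lborel)) = (\<integral>a. \<integral>b. h (pt a b) \<partial>lborel \<partial>lborel)"
      using lborel_pair.integral_fst[of "\<lambda>a b. h (pt a b)"] int' by (simp add: case_prod_beta')
    also have "\<dots> = (\<integral>a. 0 \<partial>(lborel::real measure))"
      using lborel_pair.AE_integrable_fst[of "\<lambda>a b. h (pt a b)"] int' z
      by (intro integral_cong_AE) (auto simp: case_prod_beta' elim!: eventually_mono)
    finally show ?thesis unfolding eq by simp
  qed
qed

lemma smooth_funD:
  assumes "smooth_fun \<phi>"
  shows "\<phi> differentiable at x" "continuous_on UNIV \<phi>" "continuous_on UNIV (partial \<phi> i)"
  using assms
  by (auto elim!: smooth_fun.cases simp: differentiable_on_def dest: spec[of _ i])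

lemma partial_eq_0:
  assumes "x \<notin> closure {x. \<phi> x \<noteq> 0}"
  shows "partial \<phi> i x = 0"
proof -
  have "(\<phi> has_derivative (\<lambda>_. 0)) (at x)"
  proof (rule has_derivative_transform_within_open)
    show "((\<lambda>_. 0) has_derivative (\<lambda>_. 0)) (at x)" by simp
    show "open (- closure {x. \<phi> x \<noteq> 0})" by auto
    show "\<And>y. y \<in> - closure {x. \<phi> x \<noteq> 0} \<Longrightarrow> 0 = \<phi> y"
      using closure_subset[of "{x. \<phi> x \<noteq> 0}"] by auto
  qed (use assms in auto)
  then show ?thesis by (simp add: partial_def frechet_derivative_at[symmetric])
qed

lemma partial_axis_derivative:
  assumes "\<phi> differentiable at x"
  shows "((\<lambda>t. \<phi> (x + t *\<^sub>R axis i 1)) has_real_derivative partial \<phi> i x) (at 0)"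
proof -
  have d: "(\<phi> has_derivative frechet_derivative \<phi> (at x)) (at x)"
    using assms frechet_derivative_works by blast
  have "((\<lambda>t. \<phi> (x + t *\<^sub>R axis i 1)) has_derivative (\<lambda>t. frechet_derivative \<phi> (at x) (t *\<^sub>R axis i 1))) (at 0)"
    by (rule has_derivative_compose[where f = "\<lambda>t. x + t *\<^sub>R axis i 1", simplified]) (auto intro!: derivative_eq_intros d)
  then show ?thesis
    unfolding has_field_derivative_def partial_def
    by (rule has_derivative_eq_rhs)
      (simp add: fun_eq_iff linear_cmul[OF has_derivative_linear[OF d]] mult.commute)
qed

lemma integrable_lebesgue_on_ball_bounded:
  fixes f :: "real^2 \<Rightarrow> real"
  assumes [measurable]: "f \<in> borel_measurable borel"
    and b: "\<And>x. x \<in> ball 0 1 \<Longrightarrow> \<bar>f x\<bar> \<le> M"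
  shows "integrable (lebesgue_on (ball 0 1)) f"
proof -
  have "integrable (lebesgue_on (ball (0::real^2) 1)) (\<lambda>x. \<bar>M\<bar>)"
    by (intro finite_measure.integrable_const finite_measureI)
      (use emeasure_lborel_ball_finite[of "0::real^2" 1] in \<open>auto simp: emeasure_restrict_space\<close>)
  moreover have "f \<in> borel_measurable (lebesgue_on (ball 0 1))"
    by (intro measurable_restrict_space1 measurable_completion) simp
  ultimately show ?thesis
    by (rule Bochner_Integration.integrable_bound) (use b in \<open>force intro!: AE_I2\<close>)
qed

lemma L2_on_ball_bounded:
  assumes [measurable]: "f \<in> borel_measurable borel"
    and b: "\<And>x. x \<in> ball 0 1 \<Longrightarrow> \<bar>f x\<bar> \<le> M"
  shows "L2_on (ball 0 1) f"
  unfolding L2_on_def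
proof
  show "f \<in> borel_measurable (lebesgue_on (ball 0 1))"
    by (intro measurable_restrict_space1 measurable_completion) simp
  have "\<bar>(f x)\<^sup>2\<bar> \<le> M\<^sup>2" if "x \<in> ball 0 1" for x
    using power_mono[OF b[OF that], of 2] by simp
  then show "integrable (lebesgue_on (ball 0 1)) (\<lambda>x. (f x)\<^sup>2)"
    by (intro integrable_lebesgue_on_ball_bounded) auto
qed

lemma integral_lebesgue_on_ball:
  fixes f :: "real^2 \<Rightarrow> real"
  assumes [measurable]: "f \<in> borel_measurable borel"
    and z: "\<And>x. norm x \<ge> 1 \<Longrightarrow> f x = 0"
  shows "(\<integral>x. f x \<partial>lebesgue_on (ball 0 1)) = (\<integral>x. f x \<partial>lborel)"
    and "integrable (lebesgue_on (ball 0 1)) f \<longleftrightarrow> integrable lborel f"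
proof -
  have e: "(\<lambda>x. indicator (ball 0 1) x *\<^sub>R f x) = f"
    using z by (auto simp: indicator_def fun_eq_iff not_less)
  show "(\<integral>x. f x \<partial>lebesgue_on (ball 0 1)) = (\<integral>x. f x \<partial>lborel)"
    by (subst integral_restrict_space) (simp_all only: e, auto simp: integral_completion)
  show "integrable (lebesgue_on (ball 0 1)) f \<longleftrightarrow> integrable lborel f"
    by (subst integrable_restrict_space) (simp_all only: e, auto simp: integrable_completion)
qed

text \<open>The product of \<open>f\<close> with a test function is continuous, vanishes outside the
  ball and is differentiable along axis \<open>i\<close> off \<open>x $ i = 0\<close>; its
  derivative has integral 0, which is the integration by parts formula.\<close>

lemma weak_partial_ballI:
  fixes f g :: "real^2 \<Rightarrow> real"
  assumes cont: "continuous_on UNIV f" and [measurable]: "g \<in> borel_measurable borel"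
    and bound: "\<And>x. x \<in> ball 0 1 \<Longrightarrow> \<bar>g x\<bar> \<le> M"
    and der: "\<And>x. x $ i \<noteq> 0 \<Longrightarrow> ((\<lambda>t. f (x + t *\<^sub>R axis i 1)) has_real_derivative g x) (at 0)"
  shows "weak_partial (ball 0 1) f i g"
  unfolding weak_partial_def
proof (intro allI impI)
  fix \<phi> assume t: "test_fun (ball 0 1) \<phi>"
  then have sm: "smooth_fun \<phi>" and K: "closure {x. \<phi> x \<noteq> 0} \<subseteq> ball 0 1"
    by (auto simp: test_fun_def)
  note S = smooth_funD[OF sm]
  have z: "\<phi> x = 0" "partial \<phi> i x = 0" if "norm x \<ge> 1" for x
  proof -
    have n: "x \<notin> closure {x. \<phi> x \<noteq> 0}" using K that by auto
    then show "\<phi> x = 0" "partial \<phi> i x = 0"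
      using closure_subset[of "{x. \<phi> x \<noteq> 0}"] partial_eq_0 by auto
  qed
  have bd: "\<exists>M. \<forall>x\<in>cball 0 1. \<bar>u x\<bar> \<le> M" if "continuous_on UNIV u" for u :: "real^2 \<Rightarrow> real"
  proof -
    have "compact (u ` cball 0 1)"
      using that by (intro compact_continuous_image) (auto intro: continuous_on_subset)
    then show ?thesis by (auto dest!: compact_imp_bounded simp: bounded_iff)
  qed
  have [measurable]: "f \<in> borel_measurable borel" "\<phi> \<in> borel_measurable borel" "partial \<phi> i \<in> borel_measurable borel"
    using cont S by (auto intro: borel_measurable_continuous_onI)
  have "continuous_on UNIV (\<lambda>x. f x * partial \<phi> i x)" using cont S by (intro continuous_intros)
  then obtain M1 where M1: "\<forall>x\<in>cball 0 1. \<bar>f x * partial \<phi> i x\<bar> \<le> M1" using bd by blast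
  obtain M2 where M2: "\<forall>x\<in>cball 0 1. \<bar>\<phi> x\<bar> \<le> M2" using bd S by blast
  have I1: "integrable (lebesgue_on (ball 0 1)) (\<lambda>x. f x * partial \<phi> i x)"
    using M1 by (intro integrable_lebesgue_on_ball_bounded[of _ M1]) auto
  have I2: "integrable (lebesgue_on (ball 0 1)) (\<lambda>x. g x * \<phi> x)"
  proof (rule integrable_lebesgue_on_ball_bounded[of _ "M * M2"])
    show "\<bar>g x * \<phi> x\<bar> \<le> M * M2" if "x \<in> ball 0 1" for x
    proof -
      have "0 \<le> M" using bound[OF that] by linarith
      then show ?thesis using bound[OF that] M2 that by (auto simp: abs_mult intro!: mult_mono)
    qed
  qed simp
  have J: "integrable lborel (\<lambda>x. f x * partial \<phi> i x)" "integrable lborel (\<lambda>x. g x * \<phi> x)"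
    using I1 I2 z by (auto simp: integral_lebesgue_on_ball(2))
  have "(\<integral>x. g x * \<phi> x + f x * partial \<phi> i x \<partial>lborel) = 0"
  proof (rule integral_axis_derivative_zero[where G = "\<lambda>x. f x * \<phi> x" and i = i])
    show "continuous_on UNIV (\<lambda>x. f x * \<phi> x)" using cont S by (intro continuous_intros)
    show "((\<lambda>t. f (x + t *\<^sub>R axis i 1) * \<phi> (x + t *\<^sub>R axis i 1)) has_real_derivative
         g x * \<phi> x + f x * partial \<phi> i x) (at 0)" if "x $ i \<noteq> 0" for x
      using DERIV_mult[OF der[OF that] partial_axis_derivative[OF S(1)[of x], of i]]
      by (simp add: mult.commute add.commute)
  qed (use J z in auto)
  then have "(\<integral>x. g x * \<phi> x \<partial>lborel) + (\<integral>x. f x * partial \<phi> i x \<partial>lborel) = 0"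
    using J by simp
  then show "integrable (lebesgue_on (ball 0 1)) (\<lambda>x. f x * partial \<phi> i x) \<and>
        integrable (lebesgue_on (ball 0 1)) (\<lambda>x. g x * \<phi> x) \<and>
        (\<integral>x. f x * partial \<phi> i x \<partial>lebesgue_on (ball 0 1)) = - (\<integral>x. g x * \<phi> x \<partial>lebesgue_on (ball 0 1))"
    using I1 I2 z by (simp add: integral_lebesgue_on_ball(1))
qed

section \<open>The fold profile\<close>

text \<open>\<open>\<phi>\<close> replaces \<open>\<bar>t\<bar>\<close> across a fold; \<open>\<psi>\<close> and \<open>\<xi>\<close> are the profiles of the displacements across and
  along the fold that cancel the induced strain, and both must vanish outside the fold.\<close>

locale fold_profile =
  fixes \<phi> v v' \<psi> \<xi> :: "real \<Rightarrow> real" and K :: real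
  assumes \<phi>_der: "(\<phi> has_real_derivative v t) (at t)"
    and v_der: "(v has_real_derivative v' t) (at t)"
    and \<psi>_der: "(\<psi> has_real_derivative (1 - (v t)\<^sup>2) / 2) (at t)"
    and \<xi>_der: "(\<xi> has_real_derivative
          (- (\<psi> t - t * ((1 - (v t)\<^sup>2) / 2) + (\<phi> t - t * v t) * v t))) (at t)"
    and v'_cont: "continuous_on UNIV v'"
    and far: "1 \<le> \<bar>t\<bar> \<Longrightarrow> \<phi> t = \<bar>t\<bar>" "1 \<le> \<bar>t\<bar> \<Longrightarrow> v t = sgn t" "1 \<le> \<bar>t\<bar> \<Longrightarrow> v' t = 0"
      "1 \<le> \<bar>t\<bar> \<Longrightarrow> \<psi> t = 0" "1 \<le> \<bar>t\<bar> \<Longrightarrow> \<xi> t = 0"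
    and K_ge_1: "1 \<le> K"
    and bounds: "\<bar>\<phi> t - \<bar>t\<bar>\<bar> \<le> K" "\<bar>v t\<bar> \<le> K" "\<bar>v' t\<bar> \<le> K" "\<bar>\<psi> t\<bar> \<le> K" "\<bar>\<xi> t\<bar> \<le> K"

section \<open>Antiderivatives with compact support\<close>

lemma antiderivative_exists:
  fixes g :: "real \<Rightarrow> real"
  assumes "continuous_on UNIV g"
  shows "\<exists>G. \<forall>t. (G has_real_derivative g t) (at t)"
  using einterval_antiderivative[of "-\<infinity>" \<infinity> g] assms
  by (auto simp: continuous_on_eq_continuous_at has_real_derivative_iff_has_vector_derivative)

lemma antiderivative_diff:
  fixes G g :: "real \<Rightarrow> real"
  assumes "\<And>t. (G has_real_derivative g t) (at t)" "a \<le> b"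
  shows "(g has_integral G b - G a) {a..b}"
  using assms by (intro fundamental_theorem_of_calculus)
    (auto simp: has_real_derivative_iff_has_vector_derivative[symmetric] intro: has_field_derivative_at_within)

lemma compactly_supported_antiderivative:
  fixes g :: "real \<Rightarrow> real"
  assumes cont: "continuous_on UNIV g" and far: "\<And>t. 1 \<le> \<bar>t\<bar> \<Longrightarrow> g t = 0"
    and int: "(g has_integral 0) {-1..1}"
  obtains G where "\<And>t. (G has_real_derivative g t) (at t)" "\<And>t. 1 \<le> \<bar>t\<bar> \<Longrightarrow> G t = 0"
proof -
  obtain F where F: "\<And>t. (F has_real_derivative g t) (at t)" using antiderivative_exists[OF cont] by blast
  have 0: "F (-1) = F 1"
    using has_integral_unique[OF int antiderivative_diff[OF F, of "-1" 1]] by simp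
  have c: "F b = F a" if "a \<le> b" "1 \<le> a \<or> b \<le> -1" for a b
  proof -
    have "(g has_integral 0) {a..b}"
      using that by (intro has_integral_is_0) (auto intro!: far)
    from has_integral_unique[OF this antiderivative_diff[OF F that(1)]] show ?thesis by simp
  qed
  have "F t - F 1 = 0" if "1 \<le> \<bar>t\<bar>" for t
    using c[of 1 t] c[of t "-1"] 0 that by (cases "t \<ge> 0") auto
  moreover have "((\<lambda>t. F t - F 1) has_real_derivative g t) (at t)" for t
    using F by (auto intro!: derivative_eq_intros)
  ultimately show ?thesis using that by blast
qed

lemma odd_has_integral_0:
  fixes g :: "real \<Rightarrow> real"
  assumes "continuous_on UNIV g" "\<And>t. g (- t) = - g t"
  shows "(g has_integral 0) {-1..1}"
proof -
  have "g integrable_on {-1..1}"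
    using assms(1) by (intro integrable_continuous_real) (auto intro: continuous_on_subset)
  then have I: "(g has_integral integral {-1..1} g) {-1..1}" by blast
  then have "((\<lambda>t. g (- t)) has_integral integral {-1..1} g) {-1..1}"
    using has_integral_reflect_real[where f = g and a = "-1" and b = 1 and i = "integral {-1..1} g"] by simp
  moreover have "((\<lambda>t. g (- t)) has_integral (- integral {-1..1} g)) {-1..1}"
    using has_integral_neg[OF I] by (simp add: assms(2))
  ultimately have "integral {-1..1} g = - integral {-1..1} g" by (rule has_integral_unique)
  then have "integral {-1..1} g = 0" by simp
  then show ?thesis using I by simp
qed

text \<open>The odd quadratic C^1 spline from -1 to 1, written as the second difference of t|t|/2 so
  that one formula holds for all t. Its derivative is the hat function of height 2 supported in
  [-1,1].\<close>

definition step :: "real \<Rightarrow> real" where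
  "step t = ((t + 1) * \<bar>t + 1\<bar> - 2 * (t * \<bar>t\<bar>) + (t - 1) * \<bar>t - 1\<bar>) / 2"

definition step' :: "real \<Rightarrow> real" where
  "step' t = \<bar>t + 1\<bar> - 2 * \<bar>t\<bar> + \<bar>t - 1\<bar>"

lemma DERIV_mult_abs: "((\<lambda>t. t * \<bar>t\<bar>) has_real_derivative 2 * \<bar>t\<bar>) (at (t::real))"
proof (cases "t = 0")
  case True
  have "((\<lambda>h. \<bar>h\<bar>) \<longlongrightarrow> 0) (at (0::real))" by (intro tendsto_eq_intros) auto
  then have "((\<lambda>h. h * \<bar>h\<bar> / h) \<longlongrightarrow> 0) (at (0::real))"
    by (rule Lim_transform_eventually) (auto simp: eventually_at_filter)
  then show ?thesis using True by (simp add: has_field_derivative_iff)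
next
  case False
  then consider "t > 0" | "t < 0" by linarith
  then show ?thesis
  proof cases
    case 1
    have "((\<lambda>t. t\<^sup>2) has_real_derivative 2 * \<bar>t\<bar>) (at t)"
      using 1 by (auto intro!: derivative_eq_intros)
    then show ?thesis
      by (rule has_field_derivative_transform_within_open[where S = "{0<..}"])
        (use 1 in \<open>auto simp: power2_eq_square\<close>)
  next
    case 2
    have "((\<lambda>t. - t\<^sup>2) has_real_derivative 2 * \<bar>t\<bar>) (at t)"
      using 2 by (auto intro!: derivative_eq_intros)
    then show ?thesis
      by (rule has_field_derivative_transform_within_open[where S = "{..<0}"])
        (use 2 in \<open>auto simp: power2_eq_square\<close>)
  qed
qed

lemma DERIV_step: "(step has_real_derivative step' t) (at t)"
proof -
  have *: "((\<lambda>t. (t + c) * \<bar>t + c\<bar>) has_real_derivative 2 * \<bar>t + c\<bar>) (at t)" for c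
    using DERIV_mult_abs[of "t + c"] DERIV_shift[of "\<lambda>t. t * \<bar>t\<bar>" "2 * \<bar>t + c\<bar>" t c] by simp
  have "((\<lambda>t. ((t + 1) * \<bar>t + 1\<bar> - 2 * (t * \<bar>t\<bar>) + (t + - 1) * \<bar>t + - 1\<bar>) / 2)
      has_real_derivative (2 * \<bar>t + 1\<bar> - 2 * (2 * \<bar>t\<bar>) + 2 * \<bar>t + - 1\<bar>) / 2) (at t)"
    by (intro DERIV_cdivide DERIV_add DERIV_diff DERIV_cmult DERIV_mult_abs *)
  moreover have "(2 * \<bar>t + 1\<bar> - 2 * (2 * \<bar>t\<bar>) + 2 * \<bar>t + - 1\<bar>) / 2 = step' t"
    by (simp add: step'_def)
  ultimately show ?thesis
    unfolding step_def[abs_def] by (simp only: diff_conv_add_uminus)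
qed

lemma step_far: "1 \<le> \<bar>t\<bar> \<Longrightarrow> step t = sgn t" "1 \<le> \<bar>t\<bar> \<Longrightarrow> step' t = 0"
proof -
  assume "1 \<le> \<bar>t\<bar>"
  then consider "t \<ge> 1" | "t \<le> -1" by linarith
  then have "step t = sgn t \<and> step' t = 0"
  proof cases
    case 1
    then show ?thesis by (simp add: step_def step'_def algebra_simps)
  next
    case 2
    then have "\<bar>t + 1\<bar> = - t - 1" "\<bar>t - 1\<bar> = 1 - t" "\<bar>t\<bar> = - t" by auto
    then show ?thesis using 2 by (simp add: step_def step'_def algebra_simps)
  qed
  then show "step t = sgn t" "step' t = 0" by auto
qed

lemma step_near: "0 \<le> t \<Longrightarrow> t \<le> 1 \<Longrightarrow> step t = 2 * t - t\<^sup>2"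
  by (auto simp: step_def abs_if field_simps power2_eq_square split: if_splits)

lemma step_odd: "step (- t) = - step t"
proof -
  have "\<bar>- t + 1\<bar> = \<bar>t - 1\<bar>" "\<bar>- t - 1\<bar> = \<bar>t + 1\<bar>" by auto
  then show ?thesis by (simp add: step_def) (simp add: field_simps)
qed

text \<open>Exact compensation of the transverse strain forces the mean of \<open>v\<^sup>2\<close> over a fold to
  be 1, so \<open>v\<close> has to overshoot; \<open>\<alpha>\<close> is the root of the resulting quadratic.\<close>

lemma fold_profile_exists: "\<exists>\<phi> v v' \<psi> \<xi> K. fold_profile \<phi> v v' \<psi> \<xi> K"
proof -
  define \<alpha> :: real where "\<alpha> = (33 - sqrt 1649) / 10"
  have \<alpha>: "5 * \<alpha>\<^sup>2 - 33 * \<alpha> - 28 = 0"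
    by (simp add: \<alpha>_def power2_eq_square field_simps)
  define v where "v t = \<alpha> * step t + (1 - \<alpha>) * step (2 * t)" for t
  define v' where "v' t = \<alpha> * step' t + (1 - \<alpha>) * (2 * step' (2 * t))" for t
  have v_der: "(v has_real_derivative v' t) (at t)" for t
  proof -
    have "((\<lambda>t. step (2 * t)) has_real_derivative step' (2 * t) * 2) (at t)"
      by (rule DERIV_chain2[OF DERIV_step]) (auto intro!: derivative_eq_intros)
    then show ?thesis
      unfolding v_def[abs_def] v'_def by (auto intro!: derivative_eq_intros DERIV_step)
  qed
  have v'_cont: "continuous_on UNIV v'"
    unfolding v'_def[abs_def] step'_def by (intro continuous_intros)
  have v_cont: "continuous_on UNIV v"
    using v_der by (meson DERIV_isCont continuous_at_imp_continuous_on)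
  have v_odd: "v (- t) = - v t" for t by (simp add: v_def step_odd[of t] step_odd[of "2 * t", simplified])
  have v_far: "v t = sgn t" "v' t = 0" if "1 \<le> \<bar>t\<bar>" for t
    using that step_far[of t] step_far[of "2 * t"]
    by (auto simp: v_def v'_def sgn_if algebra_simps)

  obtain F where F: "\<And>t. (F has_real_derivative v t) (at t)" using antiderivative_exists[OF v_cont] by blast
  define \<phi> where "\<phi> t = F t - F 1 + 1" for t
  have \<phi>_der: "(\<phi> has_real_derivative v t) (at t)" for t
    unfolding \<phi>_def[abs_def] using F by (auto intro!: derivative_eq_intros)
  have F1: "F (-1) = F 1"
    using has_integral_unique[OF odd_has_integral_0[OF v_cont v_odd] antiderivative_diff[OF F, of "-1" 1]] by simp
  have \<phi>_far: "\<phi> t = \<bar>t\<bar>" if "1 \<le> \<bar>t\<bar>" for t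
  proof (cases "t \<ge> 0")
    case True
    then have "1 \<le> t" using that by simp
    have "((\<lambda>_. 1) has_integral (t - 1)) {1..t}" 
      using antiderivative_diff[of "\<lambda>t. t" "\<lambda>_. 1" 1 t] \<open>1 \<le> t\<close> by simp
    then have "(v has_integral (t - 1)) {1..t}"
      by (rule has_integral_eq[rotated]) (auto simp: v_far)
    from has_integral_unique[OF this antiderivative_diff[OF F \<open>1 \<le> t\<close>]] show ?thesis using True by (simp add: \<phi>_def)
  next
    case False
    then have "t \<le> -1" using that by simp
    have "((\<lambda>_. -1) has_integral (- (-1 - t))) {t..-1}" 
      using antiderivative_diff[OF DERIV_minus[OF DERIV_ident] \<open>t \<le> -1\<close>] by (simp add: add.commute)
    then have "(v has_integral (- (-1 - t))) {t..-1}"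
      by (rule has_integral_eq[rotated]) (auto simp: v_far)
    from has_integral_unique[OF this antiderivative_diff[OF F \<open>t \<le> -1\<close>]] show ?thesis using False F1 by (simp add: \<phi>_def)
  qed

  define g where "g t = (1 - (v t)\<^sup>2) / 2" for t
  have g_cont: "continuous_on UNIV g" unfolding g_def[abs_def] by (intro continuous_intros v_cont) auto
  have g_far: "g t = 0" if "1 \<le> \<bar>t\<bar>" for t
    using v_far(1)[OF that] that by (auto simp: g_def sgn_if)
  have g_even: "g (- t) = g t" for t by (simp add: g_def v_odd)
  \<comment> \<open>\<open>step (2 * t)\<close> is quadratic up to 1/2 and equal to 1 beyond, so the
    integral over [0,1] is split at 1/2.\<close>
  have I1: "(g has_integral (1/4 - 2/15 + 23 * \<alpha> / 240 - 17 * \<alpha>\<^sup>2 / 960)) {0..1/2}"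
  proof -
    define G where "G t = (t - (16 * t^3/3 - 8 * t^4 + 16 * t^5/5) - \<alpha> * (- 16 * t^3 / 3 + 10 * t^4 - 24 * t^5/5)
       - \<alpha>\<^sup>2 * (4 * t^3 / 3 - 3 * t^4 + 9 * t^5 / 5)) / 2" for t :: real
    have "((\<lambda>t. (1 - (\<alpha> * (2 * t - t\<^sup>2) + (1 - \<alpha>) * (2 * (2 * t) - (2 * t)\<^sup>2))\<^sup>2) / 2) has_integral G (1/2) - G 0) {0..1/2}"
      unfolding G_def[abs_def]
      by (rule antiderivative_diff)
        (auto intro!: derivative_eq_intros, simp add: field_simps eval_nat_numeral)
    then have "(g has_integral G (1/2) - G 0) {0..1/2}"
      by (rule has_integral_eq[rotated]) (auto simp: g_def v_def step_near)
    moreover have "G (1/2) - G 0 = 1/4 - 2/15 + 23 * \<alpha> / 240 - 17 * \<alpha>\<^sup>2 / 960"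
      by (simp add: G_def field_simps eval_nat_numeral)
    ultimately show ?thesis by simp
  qed
  have I2: "(g has_integral (\<alpha> / 24 - \<alpha>\<^sup>2 / 320)) {1/2..1}"
  proof -
    define G where "G t = (t - (t + 2 * \<alpha> * (1 - t)^3 / 3 - \<alpha>\<^sup>2 * (1 - t)^5 / 5)) / 2" for t :: real
    have "((\<lambda>t. (1 - (1 - \<alpha> * (1 - t)\<^sup>2)\<^sup>2) / 2) has_integral G 1 - G (1/2)) {1/2..1}"
      unfolding G_def[abs_def]
      by (rule antiderivative_diff)
        (auto intro!: derivative_eq_intros, simp add: field_simps eval_nat_numeral)
    then have "(g has_integral G 1 - G (1/2)) {1/2..1}"
      by (rule has_integral_eq[rotated])
        (auto simp: g_def v_def step_near step_far power2_eq_square algebra_simps)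
    moreover have "G 1 - G (1/2) = \<alpha> / 24 - \<alpha>\<^sup>2 / 320"
      by (simp add: G_def field_simps eval_nat_numeral)
    ultimately show ?thesis by simp
  qed
  have "(g has_integral 0) {0..1}"
  proof -
    have "(g has_integral (1/4 - 2/15 + 23 * \<alpha> / 240 - 17 * \<alpha>\<^sup>2 / 960) + (\<alpha> / 24 - \<alpha>\<^sup>2 / 320)) {0..1}"
      using has_integral_combine[OF _ _ I1 I2] by simp
    \<comment> \<open>Multiplied by -240, the left side is the quadratic polynomial of which
      \<open>\<alpha>\<close> is a root.\<close>
    moreover have "(1/4 - 2/15 + 23 * \<alpha> / 240 - 17 * \<alpha>\<^sup>2 / 960) + (\<alpha> / 24 - \<alpha>\<^sup>2 / 320) = 0"
      using \<alpha> by (simp add: field_simps)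
    ultimately show ?thesis by (simp only:)
  qed
  moreover from this have "(g has_integral 0) {-1..0}"
    using has_integral_reflect_real[where f = g and a = 0 and b = 1 and i = 0] g_even by simp
  ultimately have "(g has_integral 0) {-1..1}"
    using has_integral_combine[of "-1" 0 1 g 0 0] by simp
  then obtain \<psi> where \<psi>_der: "\<And>t. (\<psi> has_real_derivative g t) (at t)" and \<psi>_far: "\<And>t. 1 \<le> \<bar>t\<bar> \<Longrightarrow> \<psi> t = 0"
    using compactly_supported_antiderivative[OF g_cont g_far] by blast
  have \<psi>_cont: "continuous_on UNIV \<psi>"
    using \<psi>_der by (meson DERIV_isCont continuous_at_imp_continuous_on)
  have \<phi>_cont: "continuous_on UNIV \<phi>"
    using \<phi>_der by (meson DERIV_isCont continuous_at_imp_continuous_on)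
  have \<phi>_even: "\<phi> (- t) = \<phi> t" for t
  proof -
    have "((\<lambda>t. \<phi> (- t) - \<phi> t) has_real_derivative 0) (at t)" for t
      by (rule derivative_eq_intros DERIV_chain2[OF \<phi>_der] \<phi>_der refl)+ (simp add: v_odd)
    then have "\<phi> (- t) - \<phi> t = \<phi> (- 1) - \<phi> 1"
      using DERIV_isconst_all[of "\<lambda>t. \<phi> (- t) - \<phi> t" t 1] by auto
    then show ?thesis by (simp add: \<phi>_far)
  qed
  have \<psi>_odd: "\<psi> (- t) = - \<psi> t" for t
  proof -
    have "((\<lambda>t. \<psi> (- t) + \<psi> t) has_real_derivative 0) (at t)" for t
      by (rule derivative_eq_intros DERIV_chain2[OF \<psi>_der] \<psi>_der refl)+ (simp add: g_even)
    then have "\<psi> (- t) + \<psi> t = \<psi> (- 1) + \<psi> 1"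
      using DERIV_isconst_all[of "\<lambda>t. \<psi> (- t) + \<psi> t" t 1] by auto
    then show ?thesis by (simp add: \<psi>_far)
  qed
  \<comment> \<open>Parity supplies the second mean-zero condition: \<open>\<psi>\<close> and
    \<open>v\<close> are odd and \<open>\<phi>\<close> is even, so \<open>k\<close> is odd and its
    antiderivative can vanish on both sides of the fold. Only \<open>\<psi>\<close> costs a
    condition on \<open>\<alpha>\<close>.\<close>
  define k where "k t = - (\<psi> t - t * g t + (\<phi> t - t * v t) * v t)" for t
  have k_cont: "continuous_on UNIV k"
    unfolding k_def[abs_def] by (intro continuous_intros \<psi>_cont \<phi>_cont v_cont g_cont)
  have k_far: "k t = 0" if "1 \<le> \<bar>t\<bar>" for t
    using that by (simp add: k_def \<psi>_far g_far \<phi>_far v_far abs_sgn)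
  have k_odd: "k (- t) = - k t" for t
    by (simp add: k_def \<psi>_odd g_even \<phi>_even v_odd)
  obtain \<xi> where \<xi>_der: "\<And>t. (\<xi> has_real_derivative k t) (at t)" and \<xi>_far: "\<And>t. 1 \<le> \<bar>t\<bar> \<Longrightarrow> \<xi> t = 0"
    using compactly_supported_antiderivative[OF k_cont k_far odd_has_integral_0[OF k_cont k_odd]] by blast
  have \<xi>_cont: "continuous_on UNIV \<xi>"
    using \<xi>_der by (meson DERIV_isCont continuous_at_imp_continuous_on)
  have bd: "\<exists>M. \<forall>t. \<bar>f t\<bar> \<le> M" if "continuous_on UNIV f" "\<And>t. 1 \<le> \<bar>t\<bar> \<Longrightarrow> \<bar>f t\<bar> \<le> 1" for f :: "real \<Rightarrow> real"
  proof -
    have "compact (f ` {-1..1})"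
      using that(1) by (intro compact_continuous_image) (auto intro: continuous_on_subset)
    then obtain M where M: "\<forall>t\<in>{-1..1}. \<bar>f t\<bar> \<le> M" by (auto dest!: compact_imp_bounded simp: bounded_iff)
    have "\<bar>f t\<bar> \<le> max M 1" for t
    proof (cases "1 \<le> \<bar>t\<bar>")
      case False
      then have "t \<in> {-1..1}" by auto
      then have "\<bar>f t\<bar> \<le> M" using M by blast
      then show ?thesis by simp
    qed (use that(2)[of t] in simp)
    then show ?thesis by blast
  qed
  \<comment> \<open>\<open>\<phi>\<close> grows linearly; what stays bounded is its distance from
    |t|.\<close>
  have "continuous_on UNIV (\<lambda>t. \<phi> t - \<bar>t\<bar>)" by (intro continuous_intros \<phi>_cont)
  from bd[OF this] obtain K1 where K1: "\<And>t. \<bar>\<phi> t - \<bar>t\<bar>\<bar> \<le> K1" by (auto simp: \<phi>_far)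
  from bd[OF v_cont] obtain K2 where K2: "\<And>t. \<bar>v t\<bar> \<le> K2" by (fastforce simp: v_far abs_sgn_eq)
  from bd[OF v'_cont] obtain K3 where K3: "\<And>t. \<bar>v' t\<bar> \<le> K3" by (auto simp: v_far)
  from bd[OF \<psi>_cont] obtain K4 where K4: "\<And>t. \<bar>\<psi> t\<bar> \<le> K4" by (auto simp: \<psi>_far)
  from bd[OF \<xi>_cont] obtain K5 where K5: "\<And>t. \<bar>\<xi> t\<bar> \<le> K5" by (auto simp: \<xi>_far)
  define K where "K = Max {1, K1, K2, K3, K4, K5}"
  have Kge: "1 \<le> K" "K1 \<le> K" "K2 \<le> K" "K3 \<le> K" "K4 \<le> K" "K5 \<le> K" by (auto simp: K_def)
  have "fold_profile \<phi> v v' \<psi> \<xi> K"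
  proof
    show "(\<psi> has_real_derivative (1 - (v t)\<^sup>2) / 2) (at t)" for t using \<psi>_der by (simp add: g_def)
    show "(\<xi> has_real_derivative (- (\<psi> t - t * ((1 - (v t)\<^sup>2) / 2) + (\<phi> t - t * v t) * v t))) (at t)" for t
      using \<xi>_der[of t] by (simp add: k_def g_def)
  qed (fact \<phi>_der v_der v'_cont \<phi>_far v_far \<psi>_far \<xi>_far Kge
      order_trans[OF K1 Kge(2)] order_trans[OF K2 Kge(3)] order_trans[OF K3 Kge(4)]
      order_trans[OF K4 Kge(5)] order_trans[OF K5 Kge(6)])+
  then show ?thesis by blast
qed

section \<open>The fold width\<close>

text \<open>The folds have their vertices at parameters \<open>0\<close> and \<open>\<plusminus>1/2\<close>, the zeros of \<open>vdist\<close>; the term \<open>\<eta>\<^sup>2\<close> keeps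
  the width of order \<open>\<eta>\<close> there.\<close>

definition vdist :: "real \<Rightarrow> real" where "vdist t = t^3 - t / 4"

definition width :: "real \<Rightarrow> real \<Rightarrow> real" where
  "width \<eta> t = (\<eta> * (\<eta>\<^sup>2 + (vdist t)\<^sup>2)) powr (1/3)"

definition width' :: "real \<Rightarrow> real \<Rightarrow> real" where
  "width' \<eta> t = \<eta> * (2 * vdist t * (3 * t\<^sup>2 - 1/4)) / (3 * (width \<eta> t)\<^sup>2)"

text \<open>Obtained by differentiating \<sigma>^3 = \<eta> (\<eta>^2 + vdist^2) twice and solving
  for the second derivative. In this form the numerator is of order \<eta> once \<sigma> \<sigma>'^2
  is.\<close>

definition width'' :: "real \<Rightarrow> real \<Rightarrow> real" where
  "width'' \<eta> t = (\<eta> * (2 * ((3 * t\<^sup>2 - 1/4)\<^sup>2 + vdist t * (6 * t))) - 6 * width \<eta> t * (width' \<eta> t)\<^sup>2)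
      / (3 * (width \<eta> t)\<^sup>2)"

context
  fixes \<eta> :: real
  assumes \<eta>: "0 < \<eta>"
begin

lemma width_pos: "0 < width \<eta> t"
proof -
  have "0 < \<eta>\<^sup>2 + (vdist t)\<^sup>2" using \<eta> by (simp add: add_pos_nonneg)
  then show ?thesis using \<eta> by (simp add: width_def)
qed

lemma width_cubed: "(width \<eta> t)^3 = \<eta> * (\<eta>\<^sup>2 + (vdist t)\<^sup>2)"
proof -
  have "0 < \<eta> * (\<eta>\<^sup>2 + (vdist t)\<^sup>2)" using \<eta> by (simp add: add_pos_nonneg)
  then show ?thesis unfolding width_def by (subst powr_power) auto
qed

lemma width_ge: "\<eta> \<le> width \<eta> t"
proof (rule power_le_imp_le_base)
  show "\<eta> ^ Suc 2 \<le> width \<eta> t ^ Suc 2"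
    using width_cubed[of t] \<eta> by (simp add: eval_nat_numeral algebra_simps)
qed (use width_pos[of t] in simp)

lemma width_der: "(width \<eta> has_real_derivative width' \<eta> t) (at t)"
proof -
  have p: "0 < \<eta> * (\<eta>\<^sup>2 + (vdist t)\<^sup>2)" using \<eta> by (simp add: add_pos_nonneg)
  have v: "(vdist has_real_derivative 3 * t\<^sup>2 - 1/4) (at t)"
    unfolding vdist_def[abs_def] by (auto intro!: derivative_eq_intros)
  have "((\<lambda>t. (\<eta> * (\<eta>\<^sup>2 + (vdist t)\<^sup>2)) powr (1/3)) has_real_derivative
      (1/3) * (\<eta> * (\<eta>\<^sup>2 + (vdist t)\<^sup>2)) powr (1/3 - 1) * (\<eta> * (2 * vdist t * (3 * t\<^sup>2 - 1/4)))) (at t)"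
    using p by (auto intro!: derivative_eq_intros v simp: algebra_simps)
  moreover have "(\<eta> * (\<eta>\<^sup>2 + (vdist t)\<^sup>2)) powr (1/3 - 1) = 1 / (width \<eta> t)\<^sup>2"
  proof -
    have "(width \<eta> t)\<^sup>2 = (\<eta> * (\<eta>\<^sup>2 + (vdist t)\<^sup>2)) powr (2/3)"
      unfolding width_def using p by (subst powr_power) auto
    then show ?thesis by (simp add: powr_minus_divide[symmetric])
  qed
  ultimately have "((\<lambda>t. (\<eta> * (\<eta>\<^sup>2 + (vdist t)\<^sup>2)) powr (1/3)) has_real_derivative width' \<eta> t) (at t)"
    by (simp add: width'_def mult_ac)
  then show ?thesis by (simp add: width_def[abs_def])
qed

lemma width'_der: "(width' \<eta> has_real_derivative width'' \<eta> t) (at t)"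
proof -
  have v: "(vdist has_real_derivative 3 * t\<^sup>2 - 1/4) (at t)"
    unfolding vdist_def[abs_def] by (auto intro!: derivative_eq_intros)
  have "((\<lambda>t. \<eta> * (2 * vdist t * (3 * t\<^sup>2 - 1/4)) / (3 * (width \<eta> t)\<^sup>2)) has_real_derivative
     ((\<eta> * (2 * ((3 * t\<^sup>2 - 1/4)\<^sup>2 + vdist t * (6 * t)))) * (3 * (width \<eta> t)\<^sup>2) -
       \<eta> * (2 * vdist t * (3 * t\<^sup>2 - 1/4)) * (6 * width \<eta> t * width' \<eta> t))
      / ((3 * (width \<eta> t)\<^sup>2) * (3 * (width \<eta> t)\<^sup>2))) (at t)"
    using width_pos[of t]
    by (intro DERIV_divide) (auto intro!: derivative_eq_intros v width_der simp: field_simps power2_eq_square)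
  moreover have "\<eta> * (2 * vdist t * (3 * t\<^sup>2 - 1/4)) = width' \<eta> t * (3 * (width \<eta> t)\<^sup>2)"
    using width_pos[of t] by (simp add: width'_def)
  ultimately have "((\<lambda>t. \<eta> * (2 * vdist t * (3 * t\<^sup>2 - 1/4)) / (3 * (width \<eta> t)\<^sup>2)) has_real_derivative
     ((\<eta> * (2 * ((3 * t\<^sup>2 - 1/4)\<^sup>2 + vdist t * (6 * t)))) * (3 * (width \<eta> t)\<^sup>2) -
       width' \<eta> t * (3 * (width \<eta> t)\<^sup>2) * (6 * width \<eta> t * width' \<eta> t))
      / ((3 * (width \<eta> t)\<^sup>2) * (3 * (width \<eta> t)\<^sup>2))) (at t)" by (simp only:)
  moreover have "((\<eta> * (2 * ((3 * t\<^sup>2 - 1/4)\<^sup>2 + vdist t * (6 * t)))) * (3 * (width \<eta> t)\<^sup>2) -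
       width' \<eta> t * (3 * (width \<eta> t)\<^sup>2) * (6 * width \<eta> t * width' \<eta> t))
      / ((3 * (width \<eta> t)\<^sup>2) * (3 * (width \<eta> t)\<^sup>2)) = width'' \<eta> t"
  proof -
    have "(A * X - w * X * (6 * s * w)) / (X * X) = (A - 6 * s * w\<^sup>2) / X" if "X \<noteq> 0" for A X w s :: real
      using that by (simp add: field_simps power2_eq_square)
    from this[of "3 * (width \<eta> t)\<^sup>2"] show ?thesis using width_pos[of t] by (simp add: width''_def)
  qed
  ultimately show ?thesis unfolding width'_def[abs_def, symmetric] by (simp add: width'_def[abs_def])
qed

lemma width_cont: "continuous_on UNIV (width \<eta>)"
  using width_der by (meson DERIV_isCont continuous_at_imp_continuous_on)

lemma width'_cont: "continuous_on UNIV (width' \<eta>)"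
  using width'_der by (meson DERIV_isCont continuous_at_imp_continuous_on)

lemma width''_cont: "continuous_on UNIV (width'' \<eta>)"
proof -
  have "width \<eta> t \<noteq> 0" for t using width_pos[of t] by simp
  then show ?thesis
    unfolding width''_def[abs_def] vdist_def
    by (intro continuous_intros width_cont width'_cont) auto
qed

text \<open>\<open>vdist t\<close> factors as t (|t| - 1/2) (|t| + 1/2). The first two bounds
  compare it with the distance to the vertex 0 and to the vertices 1/2 and -1/2; each kind of
  overlap of folds uses one of them.\<close>

lemma vdist_bounds:
  assumes "\<bar>t\<bar> \<le> 1"
  shows "\<bar>vdist t\<bar> \<le> \<bar>t\<bar>" "\<bar>vdist t\<bar> \<le> 2 * \<bar>\<bar>t\<bar> - 1/2\<bar>" "(3 * t\<^sup>2 - 1/4)\<^sup>2 \<le> 9"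
proof -
  have t2: "t\<^sup>2 \<le> 1" using assms by (simp add: abs_square_le_1)
  have e: "vdist t = t * (t\<^sup>2 - 1/4)" by (simp add: vdist_def eval_nat_numeral algebra_simps)
  have "\<bar>t\<^sup>2 - 1/4\<bar> \<le> 1" using t2 zero_le_power2[of t] by linarith
  then have "\<bar>t\<bar> * \<bar>t\<^sup>2 - 1/4\<bar> \<le> \<bar>t\<bar> * 1" by (intro mult_left_mono) auto
  then show "\<bar>vdist t\<bar> \<le> \<bar>t\<bar>" by (simp add: e abs_mult)
  have "t\<^sup>2 - 1/4 = (\<bar>t\<bar> - 1/2) * (\<bar>t\<bar> + 1/2)" by (simp add: algebra_simps power2_eq_square)
  then have "\<bar>vdist t\<bar> = (\<bar>t\<bar> * (\<bar>t\<bar> + 1/2)) * \<bar>\<bar>t\<bar> - 1/2\<bar>" by (simp add: e abs_mult)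
  also have "\<dots> \<le> 2 * \<bar>\<bar>t\<bar> - 1/2\<bar>"
    using mult_mono[of "\<bar>t\<bar>" 1 "\<bar>t\<bar> + 1/2" 2] assms by (intro mult_right_mono) auto
  finally show "\<bar>vdist t\<bar> \<le> 2 * \<bar>\<bar>t\<bar> - 1/2\<bar>" .
  have "\<bar>3 * t\<^sup>2 - 1/4\<bar> \<le> 3" using t2 zero_le_power2[of t] by linarith
  from power_mono[OF this, of 2] show "(3 * t\<^sup>2 - 1/4)\<^sup>2 \<le> 9" by simp
qed

lemma width_cubed_le:
  assumes "\<bar>t\<bar> \<le> 1"
  shows "(width \<eta> t)^3 \<le> \<eta> * (\<eta>\<^sup>2 + t\<^sup>2)" "(width \<eta> t)^3 \<le> \<eta> * (\<eta>\<^sup>2 + 4 * (\<bar>t\<bar> - 1/2)\<^sup>2)"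
proof -
  have "(vdist t)\<^sup>2 \<le> t\<^sup>2" using vdist_bounds(1)[OF assms] by (simp add: abs_le_square_iff[symmetric])
  then show "(width \<eta> t)^3 \<le> \<eta> * (\<eta>\<^sup>2 + t\<^sup>2)" using \<eta> by (simp add: width_cubed)
  have "(vdist t)\<^sup>2 \<le> (2 * (\<bar>t\<bar> - 1/2))\<^sup>2"
    using power_mono[OF vdist_bounds(2)[OF assms], of 2] by (simp only: power_mult_distrib power2_abs abs_ge_zero)
  then show "(width \<eta> t)^3 \<le> \<eta> * (\<eta>\<^sup>2 + 4 * (\<bar>t\<bar> - 1/2)\<^sup>2)"
    using \<eta> unfolding width_cubed by (intro mult_left_mono add_mono) (simp_all only: power_mult_distrib, simp_all)
qed

text \<open>\<sigma>'^2 \<sigma> is \<eta>^2 vdist^2 / \<sigma>^3 up to a bounded factor, and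
  \<sigma>^3 contains the summand \<eta> vdist^2. The power 1/3 in \<open>width\<close> is the one
  for which this stretching balances the bending \<eta>/\<sigma>.\<close>

lemma width'_sq:
  assumes "\<bar>t\<bar> \<le> 1"
  shows "(width' \<eta> t)\<^sup>2 \<le> 4 * \<eta> / width \<eta> t"
proof -
  let ?s = "width \<eta> t" and ?D = "vdist t" and ?d = "3 * t\<^sup>2 - 1/4"
  have s: "0 < ?s" by (rule width_pos)
  have "(width' \<eta> t)\<^sup>2 * (9 * ?s^3) * ?s = \<eta>\<^sup>2 * (4 * ?D\<^sup>2 * ?d\<^sup>2)"
    using s by (simp add: width'_def power_divide power_mult_distrib eval_nat_numeral)
  also have "\<dots> \<le> \<eta>\<^sup>2 * (4 * ?D\<^sup>2 * 9)"
    using vdist_bounds(3)[OF assms] \<eta> by (intro mult_left_mono) auto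
  also have "\<dots> = (4 * \<eta>) * (9 * (\<eta> * ?D\<^sup>2))" by (simp add: power2_eq_square)
  also have "\<dots> \<le> (4 * \<eta>) * (9 * ?s^3)"
    using \<eta> by (intro mult_left_mono) (auto simp: width_cubed)
  finally have "((width' \<eta> t)\<^sup>2 * ?s) * (9 * ?s^3) \<le> (4 * \<eta>) * (9 * ?s^3)" by (simp add: mult_ac)
  then have "(width' \<eta> t)\<^sup>2 * ?s \<le> 4 * \<eta>"
    by (rule mult_right_le_imp_le) (use s in simp)
  then show ?thesis using s by (simp add: pos_le_divide_eq)
qed

lemma width_width'':
  assumes "\<bar>t\<bar> \<le> 1"
  shows "\<bar>width \<eta> t * width'' \<eta> t\<bar> \<le> 20 * \<eta> / width \<eta> t"
proof -
  let ?s = "width \<eta> t" and ?D = "vdist t" and ?d = "3 * t\<^sup>2 - 1/4"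
  have s: "0 < ?s" by (rule width_pos)
  have D: "\<bar>?D\<bar> \<le> 1" using vdist_bounds(1)[OF assms] assms by simp
  have "\<bar>?d\<^sup>2 + ?D * (6 * t)\<bar> \<le> ?d\<^sup>2 + \<bar>?D\<bar> * (6 * \<bar>t\<bar>)"
    by (rule order_trans[OF abs_triangle_ineq]) (simp add: abs_mult)
  also have "\<dots> \<le> 9 + 1 * (6 * 1)"
    using vdist_bounds(3)[OF assms] D assms
    by (intro add_mono mult_mono) auto
  finally have A: "\<bar>?d\<^sup>2 + ?D * (6 * t)\<bar> \<le> 15" by simp
  have "?s * (width' \<eta> t)\<^sup>2 \<le> 4 * \<eta>"
    using width'_sq[OF assms] s by (simp add: pos_le_divide_eq mult.commute)
  then have B: "\<bar>6 * ?s * (width' \<eta> t)\<^sup>2\<bar> \<le> 24 * \<eta>" using s by (simp add: abs_mult)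
  have "\<bar>\<eta> * (2 * (?d\<^sup>2 + ?D * (6 * t)))\<bar> \<le> \<eta> * 30"
    using A \<eta> by (simp add: abs_mult)
  then have "\<bar>\<eta> * (2 * (?d\<^sup>2 + ?D * (6 * t))) - 6 * ?s * (width' \<eta> t)\<^sup>2\<bar> \<le> 60 * \<eta>"
    using B \<eta> by linarith
  then have "\<bar>width'' \<eta> t\<bar> \<le> 60 * \<eta> / (3 * ?s\<^sup>2)"
    unfolding width''_def abs_divide using s by (simp only: abs_mult abs_power2 abs_numeral) (intro divide_right_mono, auto)
  then have "?s * \<bar>width'' \<eta> t\<bar> \<le> ?s * (60 * \<eta> / (3 * ?s\<^sup>2))"
    using s by (intro mult_left_mono) auto
  also have "\<dots> = 20 * \<eta> / ?s" using s by (simp add: field_simps power2_eq_square)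
  finally show ?thesis using s by (simp add: abs_mult)
qed

text \<open>\<open>M\<close> will be the fold width at a point where two folds overlap. Such a point
  lies within a multiple of \<open>M\<close> of a vertex, and there the cube of the width is at most
  \<eta> (\<eta>^2 + c M^2). Were \<open>M\<close> much larger than \<eta>, the right side would be
  smaller than M^3.\<close>

lemma cubic_bootstrap:
  fixes M :: real
  assumes "0 \<le> M" "M^3 \<le> \<eta> * (\<eta>\<^sup>2 + c * M\<^sup>2)" "1 \<le> c"
  shows "M \<le> 2 * c * \<eta>"
proof (rule ccontr)
  assume "\<not> ?thesis"
  then have *: "2 * c * \<eta> < M" by simp
  have "1 * \<eta> \<le> (2 * c) * \<eta>" using assms(3) \<eta> by (intro mult_right_mono) auto
  then have "\<eta> \<le> M" using * by simp
  then have "\<eta>\<^sup>2 \<le> M\<^sup>2" using \<eta> by (intro power_mono) auto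
  moreover have "0 < M" using \<open>\<eta> \<le> M\<close> \<eta> by simp
  moreover have "1 * M\<^sup>2 \<le> c * M\<^sup>2" using assms(3) by (intro mult_right_mono) auto
  ultimately have "\<eta> * (\<eta>\<^sup>2 + c * M\<^sup>2) \<le> \<eta> * (c * M\<^sup>2 + c * M\<^sup>2)"
    using \<eta> by (intro mult_left_mono) linarith+
  also have "\<dots> = (2 * c * \<eta>) * M\<^sup>2" by simp
  also have "\<dots> < M * M\<^sup>2" using * \<open>0 < M\<close> by (intro mult_strict_right_mono) auto
  finally show False using assms(2) by (simp add: eval_nat_numeral)
qed

end

section \<open>Integrability of the reciprocal width\<close>

lemma nn_integral_abs_powr:
  "(\<integral>\<^sup>+t. ennreal (\<bar>t - a\<bar> powr (-2/3)) * indicator {a-2..a+2} t \<partial>lborel)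
     \<le> ennreal (6 * 2 powr (1/3))"
proof -
  have [measurable]: "(\<lambda>t::real. t powr (-2/3)) \<in> borel_measurable borel" by measurable
  let ?J = "\<integral>\<^sup>+t. ennreal (t powr (-2/3)) * indicator {0..2} t \<partial>lborel"
  have "((\<lambda>t. t powr (-2/3)) has_integral 2 powr (1/3) / (1/3)) {0..2::real}"
    using has_integral_powr_from_0[of "-2/3" 2] by simp
  then have "((\<lambda>t. t powr (-2/3)) has_integral 3 * 2 powr (1/3)) {0..2::real}" by (simp add: mult.commute)
  then have "((\<lambda>t. if t \<in> {0..2} then t powr (-2/3) else 0) has_integral 3 * 2 powr (1/3)) (UNIV::real set)"
    by (subst has_integral_restrict_UNIV)
  then have "((\<lambda>t. t powr (-2/3) * indicator {0..2} t) has_integral 3 * 2 powr (1/3)) (UNIV::real set)"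
    by (rule has_integral_eq[rotated]) (simp add: indicator_def)
  then have "(\<integral>\<^sup>+t. ennreal (t powr (-2/3) * indicator {0..2} t) \<partial>lborel) = ennreal (3 * 2 powr (1/3))"
    by (intro nn_integral_has_integral_lborel) auto
  moreover have "(\<lambda>t. ennreal (t powr (-2/3) * indicator {0..2} t)) = (\<lambda>t. ennreal (t powr (-2/3)) * indicator {0..2} t)"
    by (auto simp: indicator_def)
  ultimately have J: "?J = ennreal (3 * 2 powr (1/3))" by simp
  have J': "(\<integral>\<^sup>+t. ennreal ((- t) powr (-2/3)) * indicator {0..2} (- t) \<partial>lborel) = ?J"
    using nn_integral_real_affine[of "\<lambda>t. ennreal (t powr (-2/3)) * indicator {0..2} t" "-1" 0] by simp
  have "(\<integral>\<^sup>+t. ennreal (\<bar>t - a\<bar> powr (-2/3)) * indicator {a-2..a+2} t \<partial>lborel)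
      = (\<integral>\<^sup>+t. ennreal (\<bar>t\<bar> powr (-2/3)) * indicator {-2..2} t \<partial>lborel)"
    using nn_integral_real_affine[of "\<lambda>t. ennreal (\<bar>t - a\<bar> powr (-2/3)) * indicator {a-2..a+2} t" 1 a]
    by (simp add: indicator_def)
  also have "\<dots> \<le> (\<integral>\<^sup>+t. ennreal (t powr (-2/3)) * indicator {0..2} t
        + ennreal ((- t) powr (-2/3)) * indicator {0..2} (- t) \<partial>lborel)"
    by (intro nn_integral_mono) (auto simp: indicator_def)
  also have "\<dots> = ?J + ?J"
    by (subst nn_integral_add) (measurable, simp only: J')
  also have "\<dots> = ennreal (6 * 2 powr (1/3))"
    unfolding J by (subst ennreal_plus[symmetric]) auto
  finally show ?thesis .
qed

text \<open>The zeros of \<open>vdist\<close> are at least 1/2 apart, so at most one of its three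
  factors is below 1/4 and the other two multiply to at least 1/16. Hence one of the three singular
  terms always dominates; the factor 16 bounds 16^(2/3).\<close>

lemma inv_width_le:
  assumes \<eta>: "0 < \<eta>" and t: "t \<noteq> 0" "t \<noteq> 1/2" "t \<noteq> -1/2"
  shows "1 / width \<eta> t \<le> 16 * \<eta> powr (-1/3) *
     (\<bar>t\<bar> powr (-2/3) + \<bar>t - 1/2\<bar> powr (-2/3) + \<bar>t - (-1/2)\<bar> powr (-2/3))"
proof -
  have D: "\<bar>vdist t\<bar> = \<bar>t\<bar> * \<bar>t - 1/2\<bar> * \<bar>t - (-1/2)\<bar>"
    by (simp add: vdist_def abs_mult[symmetric] algebra_simps eval_nat_numeral)
  then have D0: "0 < \<bar>vdist t\<bar>" using t by simp
  have "(\<eta> * (vdist t)\<^sup>2) powr (1/3) \<le> width \<eta> t"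
    unfolding width_def using \<eta> by (intro powr_mono2) auto
  moreover have "(\<eta> * (vdist t)\<^sup>2) powr (1/3) = \<eta> powr (1/3) * \<bar>vdist t\<bar> powr (2/3)"
  proof -
    have "(vdist t)\<^sup>2 = \<bar>vdist t\<bar> powr 2" using D0 by (simp add: powr_numeral)
    then have "((vdist t)\<^sup>2) powr (1/3) = \<bar>vdist t\<bar> powr (2/3)" by (simp only: powr_powr) simp
    then show ?thesis using \<eta> by (subst powr_mult) auto
  qed
  ultimately have "1 / width \<eta> t \<le> 1 / (\<eta> powr (1/3) * \<bar>vdist t\<bar> powr (2/3))"
    using \<eta> D0 width_pos[OF \<eta>, of t] by (intro divide_left_mono) auto
  also have "\<dots> = \<eta> powr (-1/3) * \<bar>vdist t\<bar> powr (-2/3)"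
    by (simp add: powr_minus_divide)
  finally have 1: "1 / width \<eta> t \<le> \<eta> powr (-1/3) * \<bar>vdist t\<bar> powr (-2/3)" .
  have key: "\<bar>vdist t\<bar> powr (-2/3) \<le> 16 * x powr (-2/3)" if "0 < x" "x / 16 \<le> \<bar>vdist t\<bar>" for x
  proof -
    have "\<bar>vdist t\<bar> powr (-2/3) \<le> (x / 16) powr (-2/3)"
      using that by (intro powr_mono2') auto
    also have "\<dots> = x powr (-2/3) * (1/16) powr (-2/3)"
      using that powr_mult[of x "1/16" "-2/3"] by simp
    also have "(1/16) powr (-2/3::real) \<le> 16"
      using powr_mono[of "2/3" 1 "16::real"] by (simp add: powr_divide powr_minus_divide)
    finally show ?thesis using that by (simp add: mult_left_mono mult.commute)
  qed
  have prod: "x / 16 \<le> x * y * z" if "1/4 \<le> y" "1/4 \<le> z" "0 \<le> x" for x y z :: real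
    using mult_left_mono[OF mult_mono[OF that(1,2)] that(3)] that by simp
  consider "1/4 \<le> \<bar>t - 1/2\<bar>" "1/4 \<le> \<bar>t - (-1/2)\<bar>" | "1/4 \<le> \<bar>t\<bar>" "1/4 \<le> \<bar>t - (-1/2)\<bar>"
    | "1/4 \<le> \<bar>t\<bar>" "1/4 \<le> \<bar>t - 1/2\<bar>" by linarith
  then have "\<bar>vdist t\<bar> powr (-2/3) \<le>
     16 * (\<bar>t\<bar> powr (-2/3) + \<bar>t - 1/2\<bar> powr (-2/3) + \<bar>t - (-1/2)\<bar> powr (-2/3))"
  proof cases
    case 1
    then have "\<bar>vdist t\<bar> powr (-2/3) \<le> 16 * \<bar>t\<bar> powr (-2/3)"
      using t prod[of "\<bar>t - 1/2\<bar>" "\<bar>t - (-1/2)\<bar>" "\<bar>t\<bar>"] unfolding D[symmetric] by (intro key) auto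
    then show ?thesis by (smt (verit) powr_ge_zero)
  next
    case 2
    then have "\<bar>vdist t\<bar> powr (-2/3) \<le> 16 * \<bar>t - 1/2\<bar> powr (-2/3)"
      using t prod[of "\<bar>t\<bar>" "\<bar>t - (-1/2)\<bar>" "\<bar>t - 1/2\<bar>"] D by (intro key) (auto simp: mult_ac)
    then show ?thesis by (smt (verit) powr_ge_zero)
  next
    case 3
    then have "\<bar>vdist t\<bar> powr (-2/3) \<le> 16 * \<bar>t - (-1/2)\<bar> powr (-2/3)"
      using t prod[of "\<bar>t\<bar>" "\<bar>t - 1/2\<bar>" "\<bar>t - (-1/2)\<bar>"] D by (intro key) (auto simp: mult_ac)
    then show ?thesis by (smt (verit) powr_ge_zero)
  qed
  then have "\<eta> powr (-1/3) * \<bar>vdist t\<bar> powr (-2/3) \<le> \<eta> powr (-1/3) *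
     (16 * (\<bar>t\<bar> powr (-2/3) + \<bar>t - 1/2\<bar> powr (-2/3) + \<bar>t - (-1/2)\<bar> powr (-2/3)))"
    by (intro mult_left_mono) auto
  also have "\<dots> = 16 * \<eta> powr (-1/3) *
     (\<bar>t\<bar> powr (-2/3) + \<bar>t - 1/2\<bar> powr (-2/3) + \<bar>t - (-1/2)\<bar> powr (-2/3))"
    by (simp only: mult_ac)
  finally show ?thesis using 1 by linarith
qed

lemma nn_integral_inv_width:
  assumes \<eta>: "0 < \<eta>"
  shows "(\<integral>\<^sup>+t. ennreal (1 / width \<eta> t) * indicator {-1..1} t \<partial>lborel)
      \<le> ennreal (288 * 2 powr (1/3) * \<eta> powr (-1/3))"
proof -
  \<comment> \<open>The windows of radius 2 around 0, 1/2 and -1/2 all contain [-1,1].\<close>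
  let ?f = "\<lambda>a t::real. ennreal (\<bar>t - a\<bar> powr (-2/3)) * indicator {a-2..a+2} t"
  have "(\<integral>\<^sup>+t. ennreal (1 / width \<eta> t) * indicator {-1..1} t \<partial>lborel) \<le>
    (\<integral>\<^sup>+t. ennreal (16 * \<eta> powr (-1/3)) * (?f 0 t + ?f (1/2) t + ?f (-1/2) t) \<partial>lborel)"
  proof (rule nn_integral_mono_AE)
    have "AE t in lborel. t \<noteq> 0 \<and> t \<noteq> 1/2 \<and> t \<noteq> (-1/2::real)"
      by (intro AE_conjI AE_lborel_singleton)
    then show "AE t in lborel. ennreal (1 / width \<eta> t) * indicator {-1..1} t
       \<le> ennreal (16 * \<eta> powr (-1/3)) * (?f 0 t + ?f (1/2) t + ?f (-1/2) t)"
    proof (eventually_elim)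
      case (elim t)
      show ?case
      proof (cases "t \<in> {-1..1}")
        case True
        have "?f 0 t + ?f (1/2) t + ?f (-1/2) t =
          ennreal (\<bar>t\<bar> powr (-2/3) + \<bar>t - 1/2\<bar> powr (-2/3) + \<bar>t - (-1/2)\<bar> powr (-2/3))"
          using True by simp
        then have "ennreal (16 * \<eta> powr (-1/3)) * (?f 0 t + ?f (1/2) t + ?f (-1/2) t) =
          ennreal (16 * \<eta> powr (-1/3) *
            (\<bar>t\<bar> powr (-2/3) + \<bar>t - 1/2\<bar> powr (-2/3) + \<bar>t - (-1/2)\<bar> powr (-2/3)))"
          by (simp only: ennreal_mult''[symmetric] add_nonneg_nonneg powr_ge_zero)
        moreover have "1 / width \<eta> t \<le> 16 * \<eta> powr (-1/3) *
            (\<bar>t\<bar> powr (-2/3) + \<bar>t - 1/2\<bar> powr (-2/3) + \<bar>t - (-1/2)\<bar> powr (-2/3))"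
          using inv_width_le[OF \<eta>, of t] elim by blast
        ultimately show ?thesis using True by (simp only: ennreal_leI) (simp add: ennreal_leI)
      qed simp
    qed
  qed
  also have "\<dots> = ennreal (16 * \<eta> powr (-1/3)) *
     ((\<integral>\<^sup>+t. ?f 0 t \<partial>lborel) + (\<integral>\<^sup>+t. ?f (1/2) t \<partial>lborel) + (\<integral>\<^sup>+t. ?f (-1/2) t \<partial>lborel))"
    by (subst nn_integral_cmult, measurable) (subst nn_integral_add, measurable)+
  also have "\<dots> \<le> ennreal (16 * \<eta> powr (-1/3)) *
     (ennreal (6 * 2 powr (1/3)) + ennreal (6 * 2 powr (1/3)) + ennreal (6 * 2 powr (1/3)))"
    by (intro mult_left_mono add_mono nn_integral_abs_powr) auto
  also have "\<dots> = ennreal (288 * 2 powr (1/3) * \<eta> powr (-1/3))"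
    by (simp add: ennreal_plus[symmetric] ennreal_mult'[symmetric] mult_ac del: ennreal_plus)
  finally show ?thesis .
qed

section \<open>The folded pyramid\<close>

lemma DERIV_ratio_comp:
  fixes f q s :: "real \<Rightarrow> real"
  assumes "(f has_real_derivative f') (at (q x / s x))" "(q has_real_derivative q') (at x)"
    "(s has_real_derivative s') (at x)" "s x \<noteq> 0"
  shows "((\<lambda>x. f (q x / s x)) has_real_derivative f' * ((q' - q x / s x * s') / s x)) (at x)"
proof -
  have "((\<lambda>x. q x / s x) has_real_derivative (q' * s x - q x * s') / (s x * s x)) (at x)"
    using assms by (intro DERIV_divide)
  also have "(q' * s x - q x * s') / (s x * s x) = (q' - q x / s x * s') / s x"
    using assms(4) by (simp add: field_simps)
  finally show ?thesis by (rule DERIV_chain2[where f = f and g = "\<lambda>x. q x / s x", OF assms(1)])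
qed

text \<open>In this form the derivative of the width multiplies only f(t) - t f'(t) at t = q/s. For
  the profile \<open>\<phi>\<close> this combination is \<open>\<zeta>\<close>, which vanishes
  outside the fold, so the varying width is invisible there.\<close>

lemma DERIV_scaled:
  fixes f q s :: "real \<Rightarrow> real"
  assumes "(f has_real_derivative f') (at (q x / s x))" "(q has_real_derivative q') (at x)"
    "(s has_real_derivative s') (at x)" "s x \<noteq> 0"
  shows "((\<lambda>x. s x * f (q x / s x)) has_real_derivative
     s' * (f (q x / s x) - q x / s x * f') + q' * f') (at x)"
  by (rule DERIV_cong[OF DERIV_mult[OF assms(3) DERIV_ratio_comp[OF assms]]])
    (use assms(4) in \<open>simp add: field_simps\<close>)

locale folded_cone = fold_profile +
  fixes \<eta> :: real
  assumes \<eta>_pos: "0 < \<eta>" and \<eta>_le: "\<eta> \<le> 1"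
begin

definition "\<beta> = sqrt pi / 2"

abbreviation "\<sigma> \<equiv> width \<eta>"
abbreviation "\<sigma>' \<equiv> width' \<eta>"
abbreviation "\<sigma>'' \<equiv> width'' \<eta>"

definition "\<zeta> t = \<phi> t - t * v t"
definition "\<psi>' t = (1 - (v t)\<^sup>2) / 2"
definition "\<xi>' t = - (\<psi> t - t * \<psi>' t + \<zeta> t * v t)"

lemmas \<sigma>_pos [simp] = width_pos[OF \<eta>_pos]
lemma \<sigma>_nz [simp]: "\<sigma> t \<noteq> 0" using \<sigma>_pos[of t] by linarith

lemmas \<sigma>_der = width_der[OF \<eta>_pos]
lemmas \<sigma>'_der = width'_der[OF \<eta>_pos]

lemma \<psi>_der': "(\<psi> has_real_derivative \<psi>' t) (at t)"
  using \<psi>_der by (simp add: \<psi>'_def)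

lemma \<xi>_der': "(\<xi> has_real_derivative \<xi>' t) (at t)"
  using \<xi>_der[of t] by (simp add: \<xi>'_def \<psi>'_def \<zeta>_def)

lemma \<zeta>_der: "(\<zeta> has_real_derivative - t * v' t) (at t)"
  unfolding \<zeta>_def[abs_def] by (auto intro!: derivative_eq_intros \<phi>_der v_der)

text \<open>\<open>E a b\<close> is \<open>\<bar>a\<bar>\<close> smoothed at the scale \<open>\<sigma> b\<close>.\<close>

definition "E a b = \<sigma> b * \<phi> (a / \<sigma> b)"
definition "E1 a b = v (a / \<sigma> b)"
definition "E2 a b = \<sigma>' b * \<zeta> (a / \<sigma> b)"
definition "E11 a b = v' (a / \<sigma> b) / \<sigma> b"
definition "E12 a b = - \<sigma>' b * (a / \<sigma> b * v' (a / \<sigma> b)) / \<sigma> b"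
definition "E22 a b = \<sigma>'' b * \<zeta> (a / \<sigma> b) + (\<sigma>' b)\<^sup>2 * ((a / \<sigma> b)\<^sup>2 * v' (a / \<sigma> b)) / \<sigma> b"

lemma E_der:
  "((\<lambda>a. E a b) has_real_derivative E1 a b) (at a)"
  "((\<lambda>b. E a b) has_real_derivative E2 a b) (at b)"
  "((\<lambda>a. E1 a b) has_real_derivative E11 a b) (at a)"
  "((\<lambda>b. E1 a b) has_real_derivative E12 a b) (at b)"
  "((\<lambda>a. E2 a b) has_real_derivative E12 a b) (at a)"
  "((\<lambda>b. E2 a b) has_real_derivative E22 a b) (at b)"
proof -
  note c = DERIV_const DERIV_ident
  show "((\<lambda>a. E a b) has_real_derivative E1 a b) (at a)"
    unfolding E_def using DERIV_scaled[where q = "\<lambda>x. x" and s = "\<lambda>_. \<sigma> b" and x = a, OF \<phi>_der c(2) c(1) \<sigma>_nz] by (simp add: E1_def)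
  show "((\<lambda>b. E a b) has_real_derivative E2 a b) (at b)"
    unfolding E_def using DERIV_scaled[where q = "\<lambda>_. a" and s = "\<sigma>" and x = b, OF \<phi>_der c(1) \<sigma>_der \<sigma>_nz] by (simp add: E2_def \<zeta>_def)
  show "((\<lambda>a. E1 a b) has_real_derivative E11 a b) (at a)"
    unfolding E1_def using DERIV_ratio_comp[where q = "\<lambda>x. x" and s = "\<lambda>_. \<sigma> b" and x = a, OF v_der c(2) c(1) \<sigma>_nz] by (simp add: E11_def)
  show "((\<lambda>b. E1 a b) has_real_derivative E12 a b) (at b)"
    unfolding E1_def using DERIV_ratio_comp[where q = "\<lambda>_. a" and s = "\<sigma>" and x = b, OF v_der c(1) \<sigma>_der \<sigma>_nz] by (simp add: E12_def mult_ac)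
  show "((\<lambda>a. E2 a b) has_real_derivative E12 a b) (at a)"
    unfolding E2_def using DERIV_cmult[OF DERIV_ratio_comp[where q = "\<lambda>x. x" and s = "\<lambda>_. \<sigma> b" and x = a, OF \<zeta>_der c(2) c(1) \<sigma>_nz], of "\<sigma>' b"]
    by (simp add: E12_def mult_ac)
  show "((\<lambda>b. E2 a b) has_real_derivative E22 a b) (at b)"
    unfolding E2_def using DERIV_mult[OF \<sigma>'_der DERIV_ratio_comp[where q = "\<lambda>_. a" and s = "\<sigma>" and x = b, OF \<zeta>_der c(1) \<sigma>_der \<sigma>_nz]]
    by (simp add: E22_def mult_ac power2_eq_square)
qed

text \<open>The smoothed |a| + |b|. It is symmetric in \<open>a\<close> and \<open>b\<close>, so its
  derivative in the second argument is \<open>s1 b a\<close> and the functions for the first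
  argument suffice.\<close>

definition "s a b = E a b + E b a"
definition "s1 a b = E1 a b + E2 b a"
definition "s11 a b = E11 a b + E22 b a"
definition "s12 a b = E12 a b + E12 b a"

lemma s_der:
  "((\<lambda>a. s a b) has_real_derivative s1 a b) (at a)"
  "((\<lambda>b. s a b) has_real_derivative s1 b a) (at b)"
  "((\<lambda>a. s1 a b) has_real_derivative s11 a b) (at a)"
  "((\<lambda>b. s1 a b) has_real_derivative s12 a b) (at b)"
  unfolding s_def s1_def s11_def s12_def by (auto intro!: derivative_eq_intros E_der)

text \<open>The coordinate across the square fold in units of the fold width. Since it is built from
  \<open>s\<close> instead of |a| + |b|, the pyramid that gets folded is already smooth at the axes,
  and \<open>w\<close> inherits no kink from them.\<close>

definition "T a b = \<beta> * (s a b - 1/2) / \<sigma> a"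
definition "T1 a b = (\<beta> * s1 a b - T a b * \<sigma>' a) / \<sigma> a"
definition "T2 a b = \<beta> * s1 b a / \<sigma> a"

lemma q_der:
  "((\<lambda>a. \<beta> * (s a b - 1/2)) has_real_derivative \<beta> * s1 a b) (at a)"
  "((\<lambda>b. \<beta> * (s a b - 1/2)) has_real_derivative \<beta> * s1 b a) (at b)"
  by (auto intro!: derivative_eq_intros s_der)

lemma T_comp_der:
  assumes "\<And>t. (f has_real_derivative f' t) (at t)"
  shows "((\<lambda>a. f (T a b)) has_real_derivative f' (T a b) * T1 a b) (at a)"
    "((\<lambda>b. f (T a b)) has_real_derivative f' (T a b) * T2 a b) (at b)"
  unfolding T_def T1_def T2_def
  using DERIV_ratio_comp[where q = "\<lambda>a. \<beta> * (s a b - 1/2)" and s = "\<sigma>" and x = a, OF assms q_der(1) \<sigma>_der \<sigma>_nz]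
    DERIV_ratio_comp[where q = "\<lambda>b. \<beta> * (s a b - 1/2)" and s = "\<lambda>_. \<sigma> a" and x = b, OF assms q_der(2) DERIV_const \<sigma>_nz]
  by simp_all

definition "w a b = \<beta> / 2 - \<sigma> a * \<phi> (T a b)"
definition "w1 a b = - (v (T a b) * \<beta> * s1 a b + \<sigma>' a * \<zeta> (T a b))"
definition "w2 a b = - (v (T a b) * \<beta> * s1 b a)"
definition "w11 a b = - (v' (T a b) * T1 a b * \<beta> * s1 a b + v (T a b) * \<beta> * s11 a b
   + \<sigma>'' a * \<zeta> (T a b) - \<sigma>' a * (T a b * v' (T a b) * T1 a b))"
definition "w12 a b = - (v' (T a b) * T2 a b * \<beta> * s1 a b + v (T a b) * \<beta> * s12 a b
   - \<sigma>' a * (T a b * v' (T a b) * T2 a b))"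
definition "w21 a b = - (v' (T a b) * T1 a b * \<beta> * s1 b a + v (T a b) * \<beta> * s12 b a)"
definition "w22 a b = - (v' (T a b) * T2 a b * \<beta> * s1 b a + v (T a b) * \<beta> * s11 b a)"

lemma w_der:
  "((\<lambda>a. w a b) has_real_derivative w1 a b) (at a)"
  "((\<lambda>b. w a b) has_real_derivative w2 a b) (at b)"
proof -
  show "((\<lambda>a. w a b) has_real_derivative w1 a b) (at a)"
    unfolding w_def T_def
    using DERIV_diff[OF DERIV_const DERIV_scaled[where q = "\<lambda>a. \<beta> * (s a b - 1/2)" and s = "\<sigma>" and x = a, OF \<phi>_der q_der(1) \<sigma>_der \<sigma>_nz]]
    by (rule DERIV_cong) (simp_all add: w1_def \<zeta>_def T_def)
  show "((\<lambda>b. w a b) has_real_derivative w2 a b) (at b)"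
    unfolding w_def T_def
    using DERIV_diff[OF DERIV_const DERIV_scaled[where q = "\<lambda>b. \<beta> * (s a b - 1/2)" and s = "\<lambda>_. \<sigma> a" and x = b, OF \<phi>_der q_der(2) DERIV_const \<sigma>_nz]]
    by (rule DERIV_cong) (simp_all add: w2_def T_def)
qed

lemma w_der2:
  "((\<lambda>a. w1 a b) has_real_derivative w11 a b) (at a)"
  "((\<lambda>b. w1 a b) has_real_derivative w12 a b) (at b)"
  "((\<lambda>a. w2 a b) has_real_derivative w21 a b) (at a)"
  "((\<lambda>b. w2 a b) has_real_derivative w22 a b) (at b)"
  unfolding w1_def w2_def w11_def w12_def w21_def w22_def
  by (auto intro!: derivative_eq_intros T_comp_der[OF v_der] T_comp_der[OF \<zeta>_der] s_der \<sigma>'_der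
      simp: algebra_simps)

text \<open>\<open>(V a b, V b a)\<close> is the displacement of the unsmoothed pyramid. On \<open>b = 0\<close> the junk value
  \<open>a / 0 = 0\<close> yields the continuous extension, but there is a kink in the direction of \<open>b\<close>.\<close>

definition "V a b = - (pi / 8) * a - b * arctan (a / b) / 2"
definition "V1 a b = - (pi / 8) - b\<^sup>2 / (a\<^sup>2 + b\<^sup>2) / 2"
definition "V2 a b = - arctan (a / b) / 2 + a * b / (a\<^sup>2 + b\<^sup>2) / 2"

lemma V_der:
  "((\<lambda>a. V a b) has_real_derivative V1 a b) (at a)"
  "b \<noteq> 0 \<Longrightarrow> ((\<lambda>b. V a b) has_real_derivative V2 a b) (at b)"
proof -
  show "((\<lambda>a. V a b) has_real_derivative V1 a b) (at a)"
  proof (cases "b = 0")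
    case False
    then have "0 < a\<^sup>2 + b\<^sup>2" by (simp add: add_nonneg_pos)
    then have e: "b * inverse (1 + (a / b)\<^sup>2) * (1 / b) = b\<^sup>2 / (a\<^sup>2 + b\<^sup>2)"
      using False by (simp add: field_simps power2_eq_square)
    have "((\<lambda>a. V a b) has_real_derivative - (pi / 8) - (b * (inverse (1 + (a / b)\<^sup>2) * (1 / b))) / 2) (at a)"
      unfolding V_def[abs_def] using False
      by (intro DERIV_diff DERIV_cdivide DERIV_cmult DERIV_chain2[OF DERIV_arctan] DERIV_ident)
       (auto intro!: derivative_eq_intros)
    then show ?thesis using e by (simp add: V1_def mult.assoc)
  qed (auto simp: V_def V1_def intro!: derivative_eq_intros)
  show "((\<lambda>b. V a b) has_real_derivative V2 a b) (at b)" if "b \<noteq> 0"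
  proof -
    have "0 < a\<^sup>2 + b\<^sup>2" using that by (simp add: add_nonneg_pos)
    then have e: "b * (inverse (1 + (a / b)\<^sup>2) * (- a / b\<^sup>2)) = - a * b / (a\<^sup>2 + b\<^sup>2)"
      using that by (simp add: field_simps power2_eq_square)
    have "((\<lambda>b. V a b) has_real_derivative 0 -
       (1 * arctan (a / b) + (inverse (1 + (a / b)\<^sup>2) * (- a / b\<^sup>2)) * b) / 2) (at b)"
      unfolding V_def[abs_def] using that
      by (intro DERIV_diff DERIV_cdivide DERIV_mult DERIV_chain2[OF DERIV_arctan] DERIV_ident)
       (auto intro!: derivative_eq_intros simp: power2_eq_square)
    then show ?thesis
    proof (rule DERIV_cong)
      have "inverse (1 + (a / b)\<^sup>2) * (- a / b\<^sup>2) * b = - a * b / (a\<^sup>2 + b\<^sup>2)"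
        using e by (simp only: mult.commute)
      then show "0 - (1 * arctan (a / b) + (inverse (1 + (a / b)\<^sup>2) * (- a / b\<^sup>2)) * b) / 2 = V2 a b"
        by (simp only: V2_def) (simp add: diff_divide_distrib)
    qed
  qed
qed

text \<open>A smooth sign function: the slope of the pyramid along an axis fold changes sign at the apex.\<close>

definition "\<kappa> a = v (a / \<eta>)"
definition "\<kappa>' a = v' (a / \<eta>) / \<eta>"

lemma \<kappa>_der: "(\<kappa> has_real_derivative \<kappa>' a) (at a)"
  unfolding \<kappa>_def[abs_def] \<kappa>'_def
  using DERIV_ratio_comp[where q = "\<lambda>x. x" and s = "\<lambda>_. \<eta>" and x = a, OF v_der DERIV_ident DERIV_const] \<eta>_pos by simp

definition "H a b = \<sigma> a * \<sigma>' a * \<xi> (b / \<sigma> a)"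
definition "H1 a b = ((\<sigma>' a)\<^sup>2 + \<sigma> a * \<sigma>'' a) * \<xi> (b / \<sigma> a) - (\<sigma>' a)\<^sup>2 * (b / \<sigma> a * \<xi>' (b / \<sigma> a))"
definition "H2 a b = \<sigma>' a * \<xi>' (b / \<sigma> a)"
definition "P a b = \<sigma> a * \<psi> (b / \<sigma> a)"
definition "P1 a b = \<sigma>' a * (\<psi> (b / \<sigma> a) - b / \<sigma> a * \<psi>' (b / \<sigma> a))"
definition "P2 a b = \<psi>' (b / \<sigma> a)"

lemma H_der:
  "((\<lambda>a. H a b) has_real_derivative H1 a b) (at a)"
  "((\<lambda>b. H a b) has_real_derivative H2 a b) (at b)"
proof -
  show "((\<lambda>a. H a b) has_real_derivative H1 a b) (at a)"
    unfolding H_def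
    using DERIV_mult[OF DERIV_mult[OF \<sigma>_der \<sigma>'_der] DERIV_ratio_comp[where q = "\<lambda>_. b" and s = "\<sigma>" and x = a, OF \<xi>_der' DERIV_const \<sigma>_der \<sigma>_nz]]
    by (rule DERIV_cong) (simp_all add: H1_def field_simps power2_eq_square)
  show "((\<lambda>b. H a b) has_real_derivative H2 a b) (at b)"
    unfolding H_def
    using DERIV_cmult[OF DERIV_ratio_comp[where q = "\<lambda>x. x" and s = "\<lambda>_. \<sigma> a" and x = b, OF \<xi>_der' DERIV_ident DERIV_const \<sigma>_nz], of "\<sigma> a * \<sigma>' a"]
    by (rule DERIV_cong) (simp_all add: H2_def)
qed

lemma P_der:
  "((\<lambda>a. P a b) has_real_derivative P1 a b) (at a)"
  "((\<lambda>b. P a b) has_real_derivative P2 a b) (at b)"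
  unfolding P_def P1_def P2_def
  using DERIV_scaled[where q = "\<lambda>_. b" and s = "\<sigma>" and x = a, OF \<psi>_der' DERIV_const \<sigma>_der \<sigma>_nz]
    DERIV_scaled[where q = "\<lambda>x. x" and s = "\<lambda>_. \<sigma> a" and x = b, OF \<psi>_der' DERIV_ident DERIV_const \<sigma>_nz] by simp_all

text \<open>\<open>(Y a b, Y b a)\<close> includes the corrections on the two axis folds, \<open>(R a b, Q a b)\<close> the one on the
  square, where \<open>a\<close> serves as the coordinate along the fold and \<open>(\<kappa> a, v (b / \<sigma> a))\<close> approximates
  \<open>(sgn a, sgn b)\<close>.\<close>

definition "Y a b = V a b - \<beta>\<^sup>2 * (\<kappa> a * (E b a - \<bar>b\<bar>)) + \<beta>\<^sup>2 * (H a b + P b a)"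
definition "Y1 a b = V1 a b - \<beta>\<^sup>2 * (\<kappa>' a * (E b a - \<bar>b\<bar>) + \<kappa> a * E2 b a) + \<beta>\<^sup>2 * (H1 a b + P2 b a)"
definition "Y2 a b = V2 a b - \<beta>\<^sup>2 * (\<kappa> a * (E1 b a - sgn b)) + \<beta>\<^sup>2 * (H2 a b + P1 b a)"

lemma DERIV_abs_sgn: "b \<noteq> 0 \<Longrightarrow> ((\<lambda>b::real. \<bar>b\<bar>) has_real_derivative sgn b) (at b)"
  by (rule has_field_derivative_transform_within_open[where S = "if b > 0 then {0<..} else {..<0}"
       and f = "\<lambda>x. sgn b * x"]) (auto intro!: derivative_eq_intros split: if_splits)

lemma Y_der:
  "((\<lambda>a. Y a b) has_real_derivative Y1 a b) (at a)"
  "b \<noteq> 0 \<Longrightarrow> ((\<lambda>b. Y a b) has_real_derivative Y2 a b) (at b)"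
proof -
  show "((\<lambda>a. Y a b) has_real_derivative Y1 a b) (at a)"
    unfolding Y_def Y1_def
    by (rule derivative_eq_intros V_der \<kappa>_der E_der H_der P_der refl)+ (simp add: algebra_simps)
  show "((\<lambda>b. Y a b) has_real_derivative Y2 a b) (at b)" if "b \<noteq> 0"
    unfolding Y_def Y2_def
    by (intro DERIV_add DERIV_diff DERIV_cmult V_der that E_der H_der P_der DERIV_abs_sgn)
qed

definition "R a b = \<beta> * (\<sigma> a * \<psi> (T a b) * \<kappa> a) + \<sigma> a * \<sigma>' a * \<xi> (T a b)"
definition "R1 a b = \<beta> * (\<sigma>' a * \<psi> (T a b) * \<kappa> a + \<sigma> a * (\<psi>' (T a b) * T1 a b) * \<kappa> a + \<sigma> a * \<psi> (T a b) * \<kappa>' a)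
   + ((\<sigma>' a)\<^sup>2 + \<sigma> a * \<sigma>'' a) * \<xi> (T a b) + \<sigma> a * \<sigma>' a * (\<xi>' (T a b) * T1 a b)"
definition "R2 a b = \<beta> * (\<sigma> a * (\<psi>' (T a b) * T2 a b) * \<kappa> a) + \<sigma> a * \<sigma>' a * (\<xi>' (T a b) * T2 a b)"
definition "Q a b = \<beta> * (\<sigma> a * \<psi> (T a b) * v (b / \<sigma> a))"
definition "Q1 a b = \<beta> * (\<sigma>' a * \<psi> (T a b) * v (b / \<sigma> a) + \<sigma> a * (\<psi>' (T a b) * T1 a b) * v (b / \<sigma> a)
   - \<psi> (T a b) * \<sigma>' a * (b / \<sigma> a * v' (b / \<sigma> a)))"
definition "Q2 a b = \<beta> * (\<sigma> a * (\<psi>' (T a b) * T2 a b) * v (b / \<sigma> a) + \<psi> (T a b) * v' (b / \<sigma> a))"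

lemma R_der:
  "((\<lambda>a. R a b) has_real_derivative R1 a b) (at a)"
  "((\<lambda>b. R a b) has_real_derivative R2 a b) (at b)"
  unfolding R_def R1_def R2_def
  by (rule derivative_eq_intros T_comp_der[OF \<psi>_der'] T_comp_der[OF \<xi>_der'] \<kappa>_der \<sigma>_der \<sigma>'_der refl
      | simp add: algebra_simps power2_eq_square)+

lemma Q_der:
  "((\<lambda>a. Q a b) has_real_derivative Q1 a b) (at a)"
  "((\<lambda>b. Q a b) has_real_derivative Q2 a b) (at b)"
proof -
  show "((\<lambda>a. Q a b) has_real_derivative Q1 a b) (at a)"
    unfolding Q_def
    using DERIV_cmult[OF DERIV_mult[OF DERIV_mult[OF \<sigma>_der T_comp_der(1)[OF \<psi>_der']]
       DERIV_ratio_comp[where q = "\<lambda>_. b" and s = "\<sigma>" and x = a, OF v_der DERIV_const \<sigma>_der \<sigma>_nz]], of \<beta>]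
    by (rule DERIV_cong) (simp_all add: Q1_def field_simps)
  show "((\<lambda>b. Q a b) has_real_derivative Q2 a b) (at b)"
    unfolding Q_def
    using DERIV_cmult[OF DERIV_mult[OF DERIV_cmult[OF T_comp_der(2)[OF \<psi>_der']]
       DERIV_ratio_comp[where q = "\<lambda>x. x" and s = "\<lambda>_. \<sigma> a" and x = b, OF v_der DERIV_ident DERIV_const \<sigma>_nz]], of \<beta>]
    by (rule DERIV_cong) (simp_all add: Q2_def field_simps)
qed

section \<open>Continuity and measurability of the competitor\<close>

lemma isCont_mult_arctan:
  "isCont (\<lambda>p. snd p * arctan (fst p / snd p)) (p :: real \<times> real)"
proof (cases "snd p = 0")
  case False
  then show ?thesis by (intro continuous_intros) auto
next
  case True
  have "((\<lambda>p. snd p * arctan (fst p / snd p)) \<longlongrightarrow> 0) (at p)"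
  proof (rule Lim_null_comparison)
    \<comment> \<open>Boundedness of the arctangent is enough on the axis, however its argument
      behaves there.\<close>
    have "\<bar>snd q * arctan (fst q / snd q)\<bar> \<le> \<bar>snd q\<bar> * 2" for q :: "real \<times> real"
      unfolding abs_mult using arctan_bounded[of "fst q / snd q"] pi_less_4
      by (intro mult_left_mono) auto
    then show "\<forall>\<^sub>F q in at p. norm (snd q * arctan (fst q / snd q)) \<le> \<bar>snd q\<bar> * 2"
      by (intro always_eventually) auto
    have "((\<lambda>q. \<bar>snd q\<bar> * 2) \<longlongrightarrow> \<bar>snd p\<bar> * 2) (at p)" by (intro tendsto_intros)
    then show "((\<lambda>q. \<bar>snd q\<bar> * 2) \<longlongrightarrow> 0) (at p)" using True by simp
  qed
  then show ?thesis using True by (simp add: isCont_def)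
qed

lemma continuous_on_V:
  assumes "continuous_on S f" "continuous_on S g"
  shows "continuous_on S (\<lambda>x. V (f x) (g x))"
proof -
  have "continuous_on UNIV (\<lambda>p :: real \<times> real. snd p * arctan (fst p / snd p))"
    by (intro continuous_at_imp_continuous_on ballI isCont_mult_arctan)
  from continuous_on_compose2[OF this continuous_on_Pair[OF assms]]
  have "continuous_on S (\<lambda>x. g x * arctan (f x / g x))" by simp
  from continuous_on_diff[OF continuous_on_mult[OF continuous_on_const assms(1), of "- (pi / 8)"]
      continuous_on_divide[OF this continuous_on_const, of 2]]
  show ?thesis unfolding V_def by simp
qed

lemma continuous_basic:
  "continuous_on UNIV \<phi>" "continuous_on UNIV v" "continuous_on UNIV v'" "continuous_on UNIV \<psi>"
  "continuous_on UNIV \<xi>" "continuous_on UNIV \<sigma>" "continuous_on UNIV \<sigma>'" "continuous_on UNIV \<sigma>''"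
  using v'_cont width_cont[OF \<eta>_pos] width'_cont[OF \<eta>_pos] width''_cont[OF \<eta>_pos]
  by (auto intro!: continuous_at_imp_continuous_on DERIV_isCont[OF \<phi>_der] DERIV_isCont[OF v_der]
      DERIV_isCont[OF \<psi>_der] DERIV_isCont[OF \<xi>_der])

lemmas continuous_comp = continuous_basic[THEN continuous_on_compose2, OF _ subset_UNIV]

lemma continuous_on_E:
  assumes "continuous_on S f" "continuous_on S g"
  shows "continuous_on S (\<lambda>x. E (f x) (g x))"
  unfolding E_def by (intro continuous_intros continuous_comp assms) auto

lemma continuous_on_T:
  assumes "continuous_on S f" "continuous_on S g"
  shows "continuous_on S (\<lambda>x. T (f x) (g x))"
  unfolding T_def s_def by (intro continuous_intros continuous_comp continuous_on_E assms) auto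

lemma continuous_on_w:
  assumes "continuous_on S f" "continuous_on S g"
  shows "continuous_on S (\<lambda>x. w (f x) (g x))"
  unfolding w_def by (intro continuous_intros continuous_comp continuous_on_T assms) auto

lemma continuous_on_wi:
  assumes "continuous_on S f" "continuous_on S g"
  shows "continuous_on S (\<lambda>x. w1 (f x) (g x))" "continuous_on S (\<lambda>x. w2 (f x) (g x))"
  unfolding w1_def w2_def s1_def E1_def E2_def \<zeta>_def
  by (intro continuous_intros continuous_comp continuous_on_T assms; simp)+

lemma continuous_on_u:
  assumes "continuous_on S f" "continuous_on S g"
  shows "continuous_on S (\<lambda>x. Y (f x) (g x) + R (f x) (g x))"
    "continuous_on S (\<lambda>x. Y (g x) (f x) + Q (f x) (g x))"
  unfolding Y_def R_def Q_def H_def P_def \<kappa>_def using \<eta>_pos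
  by (intro continuous_intros continuous_comp continuous_on_T continuous_on_E continuous_on_V assms; simp)+

lemmas measurable_basic [measurable] = continuous_basic[THEN borel_measurable_continuous_onI]

lemma measurable_aux [measurable]:
  "\<zeta> \<in> borel_measurable borel" "\<psi>' \<in> borel_measurable borel" "\<xi>' \<in> borel_measurable borel"
  "\<kappa> \<in> borel_measurable borel" "\<kappa>' \<in> borel_measurable borel"
proof -
  show 1 [measurable]: "\<zeta> \<in> borel_measurable borel" unfolding \<zeta>_def[abs_def] by measurable
  show 2 [measurable]: "\<psi>' \<in> borel_measurable borel" unfolding \<psi>'_def[abs_def] by measurable
  show "\<xi>' \<in> borel_measurable borel" unfolding \<xi>'_def[abs_def] by measurable
  show "\<kappa> \<in> borel_measurable borel" unfolding \<kappa>_def[abs_def] by measurable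
  show "\<kappa>' \<in> borel_measurable borel" unfolding \<kappa>'_def[abs_def] by measurable
qed

context
  fixes f g :: "'b \<Rightarrow> real" and M :: "'b measure"
  assumes fg [measurable]: "f \<in> borel_measurable M" "g \<in> borel_measurable M"
begin

lemma measurable_E [measurable (raw)]:
  "(\<lambda>x. E (f x) (g x)) \<in> borel_measurable M"
  "(\<lambda>x. E1 (f x) (g x)) \<in> borel_measurable M"
  "(\<lambda>x. E2 (f x) (g x)) \<in> borel_measurable M"
  "(\<lambda>x. E11 (f x) (g x)) \<in> borel_measurable M"
  "(\<lambda>x. E12 (f x) (g x)) \<in> borel_measurable M"
  "(\<lambda>x. E22 (f x) (g x)) \<in> borel_measurable M"
  unfolding E_def E1_def E2_def E11_def E12_def E22_def by measurable

lemma measurable_VHP [measurable (raw)]: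
  "(\<lambda>x. V1 (f x) (g x)) \<in> borel_measurable M"
  "(\<lambda>x. V2 (f x) (g x)) \<in> borel_measurable M"
  "(\<lambda>x. H1 (f x) (g x)) \<in> borel_measurable M"
  "(\<lambda>x. H2 (f x) (g x)) \<in> borel_measurable M"
  "(\<lambda>x. P1 (f x) (g x)) \<in> borel_measurable M"
  "(\<lambda>x. P2 (f x) (g x)) \<in> borel_measurable M"
  unfolding V1_def V2_def H1_def H2_def P1_def P2_def by measurable

end

context
  fixes f g :: "'b \<Rightarrow> real" and M :: "'b measure"
  assumes fg [measurable]: "f \<in> borel_measurable M" "g \<in> borel_measurable M"
begin

lemma measurable_s [measurable (raw)]:
  "(\<lambda>x. s (f x) (g x)) \<in> borel_measurable M"
  "(\<lambda>x. s1 (f x) (g x)) \<in> borel_measurable M"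
  "(\<lambda>x. s11 (f x) (g x)) \<in> borel_measurable M"
  "(\<lambda>x. s12 (f x) (g x)) \<in> borel_measurable M"
  "(\<lambda>x. Y1 (f x) (g x)) \<in> borel_measurable M"
  "(\<lambda>x. Y2 (f x) (g x)) \<in> borel_measurable M"
  unfolding s_def s1_def s11_def s12_def Y1_def Y2_def by measurable

end

context
  fixes f g :: "'b \<Rightarrow> real" and M :: "'b measure"
  assumes fg [measurable]: "f \<in> borel_measurable M" "g \<in> borel_measurable M"
begin

lemma measurable_T [measurable (raw)]:
  "(\<lambda>x. T (f x) (g x)) \<in> borel_measurable M"
  unfolding T_def by measurable

lemma measurable_T12 [measurable (raw)]:
  "(\<lambda>x. T1 (f x) (g x)) \<in> borel_measurable M"
  "(\<lambda>x. T2 (f x) (g x)) \<in> borel_measurable M"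
  unfolding T1_def T2_def by measurable

lemma measurable_derivatives:
  "(\<lambda>x. w1 (f x) (g x)) \<in> borel_measurable M"
  "(\<lambda>x. w2 (f x) (g x)) \<in> borel_measurable M"
  "(\<lambda>x. w11 (f x) (g x)) \<in> borel_measurable M"
  "(\<lambda>x. w12 (f x) (g x)) \<in> borel_measurable M"
  "(\<lambda>x. w21 (f x) (g x)) \<in> borel_measurable M"
  "(\<lambda>x. w22 (f x) (g x)) \<in> borel_measurable M"
  "(\<lambda>x. Y1 (f x) (g x) + R1 (f x) (g x)) \<in> borel_measurable M"
  "(\<lambda>x. Y2 (f x) (g x) + R2 (f x) (g x)) \<in> borel_measurable M"
  "(\<lambda>x. Y2 (g x) (f x) + Q1 (f x) (g x)) \<in> borel_measurable M"
  "(\<lambda>x. Y1 (g x) (f x) + Q2 (f x) (g x)) \<in> borel_measurable M"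
  unfolding w1_def w2_def w11_def w12_def w21_def w22_def R1_def R2_def Q1_def Q2_def
  by measurable

end

end

section \<open>Pointwise bounds\<close>

lemma abs_mult_le:
  fixes x y :: real
  assumes "\<bar>x\<bar> \<le> p" "\<bar>y\<bar> \<le> q"
  shows "\<bar>x * y\<bar> \<le> p * q"
  unfolding abs_mult using assms by (intro mult_mono) auto

lemma abs_add_le:
  fixes x y :: real
  assumes "\<bar>x\<bar> \<le> p" "\<bar>y\<bar> \<le> q"
  shows "\<bar>x + y\<bar> \<le> p + q" "\<bar>x - y\<bar> \<le> p + q"
  using assms by auto

lemma half_bound:
  fixes x k :: real
  assumes "x \<le> k" "1 \<le> k" "0 \<le> x"
  shows "\<bar>(1 - x) / 2\<bar> \<le> k"
  using assms by (auto simp: abs_le_iff field_simps)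

lemma frac_bounds:
  fixes a b :: real
  shows "\<bar>b\<^sup>2 / (a\<^sup>2 + b\<^sup>2)\<bar> \<le> 1" "\<bar>a\<^sup>2 / (a\<^sup>2 + b\<^sup>2)\<bar> \<le> 1" "\<bar>a * b / (a\<^sup>2 + b\<^sup>2)\<bar> \<le> 1"
proof -
  have g: "\<bar>x / (a\<^sup>2 + b\<^sup>2)\<bar> \<le> 1" if "\<bar>x\<bar> \<le> a\<^sup>2 + b\<^sup>2" for x
  proof -
    have "\<bar>x\<bar> / (a\<^sup>2 + b\<^sup>2) \<le> (a\<^sup>2 + b\<^sup>2) / (a\<^sup>2 + b\<^sup>2)" using that by (rule divide_right_mono) simp
    also have "\<dots> \<le> 1" by simp
    finally show ?thesis by simp
  qed
  show "\<bar>b\<^sup>2 / (a\<^sup>2 + b\<^sup>2)\<bar> \<le> 1" "\<bar>a\<^sup>2 / (a\<^sup>2 + b\<^sup>2)\<bar> \<le> 1" by (intro g; simp)+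
  have "2 * \<bar>a * b\<bar> \<le> a\<^sup>2 + b\<^sup>2"
    using sum_squares_bound[of "\<bar>a\<bar>" "\<bar>b\<bar>"] by (simp add: abs_mult)
  then show "\<bar>a * b / (a\<^sup>2 + b\<^sup>2)\<bar> \<le> 1" by (intro g) simp
qed

lemma abs_half: "\<bar>x\<bar> \<le> p \<Longrightarrow> \<bar>x / 2\<bar> \<le> p / 2" for x p :: real
  by simp

context folded_cone
begin

lemma K_powers: "K \<le> K\<^sup>2" "K\<^sup>2 \<le> K^3" "K^3 \<le> K^4" "0 < K"
  using K_ge_1 power_increasing[of 1 2 K] power_increasing[of 2 3 K] power_increasing[of 3 4 K] by auto

lemma \<beta>_sq: "\<beta>\<^sup>2 = pi / 4"
  by (simp add: \<beta>_def power_divide)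

lemma \<beta>_bounds: "1/2 \<le> \<beta>" "\<beta> \<le> 1"
proof -
  have "1 \<le> sqrt pi" using pi_gt3 by (intro real_le_rsqrt) auto
  then show "1/2 \<le> \<beta>" by (simp add: \<beta>_def)
  have "sqrt pi \<le> 2" using pi_less_4 by (intro real_le_lsqrt) auto
  then show "\<beta> \<le> 1" by (simp add: \<beta>_def)
qed

lemma far': "1 \<le> \<bar>t\<bar> \<Longrightarrow> \<zeta> t = 0" "1 \<le> \<bar>t\<bar> \<Longrightarrow> \<psi>' t = 0" "1 \<le> \<bar>t\<bar> \<Longrightarrow> \<xi>' t = 0"
proof -
  assume t: "1 \<le> \<bar>t\<bar>"
  then show 1: "\<zeta> t = 0" by (simp add: \<zeta>_def far abs_sgn)
  show 2: "\<psi>' t = 0" using t by (auto simp: \<psi>'_def far sgn_if)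
  show "\<xi>' t = 0" using t by (simp add: \<xi>'_def 1 2 far)
qed

lemma compact_bound:
  fixes f :: "real \<Rightarrow> real"
  assumes "1 \<le> \<bar>t\<bar> \<Longrightarrow> f t = 0" "\<bar>f t\<bar> \<le> M"
  shows "\<bar>t * f t\<bar> \<le> M"
proof (cases "1 \<le> \<bar>t\<bar>")
  case False
  then have "\<bar>t * f t\<bar> \<le> 1 * M" using assms(2) by (intro abs_mult_le) auto
  then show ?thesis by simp
qed (use assms in force)

lemma bounds':
  "\<bar>\<zeta> t\<bar> \<le> 3 * K" "\<bar>\<psi>' t\<bar> \<le> K\<^sup>2" "\<bar>t * \<psi>' t\<bar> \<le> K\<^sup>2" "\<bar>t * v' t\<bar> \<le> K" "\<bar>t\<^sup>2 * v' t\<bar> \<le> K"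
  "\<bar>\<xi>' t\<bar> \<le> 5 * K\<^sup>2" "\<bar>t * \<xi>' t\<bar> \<le> 5 * K\<^sup>2"
proof -
  show 1: "\<bar>\<zeta> t\<bar> \<le> 3 * K"
  proof (cases "1 \<le> \<bar>t\<bar>")
    case False
    then have "\<bar>t * v t\<bar> \<le> 1 * K" by (intro abs_mult_le bounds) auto
    then show ?thesis using bounds(1)[of t] False K_ge_1 unfolding \<zeta>_def by linarith
  qed (use far' K_ge_1 in simp)
  have "(v t)\<^sup>2 \<le> K\<^sup>2" using power_mono[OF bounds(2)[of t], of 2] by simp
  moreover have "1 \<le> K\<^sup>2" using K_ge_1 by simp
  ultimately show 2: "\<bar>\<psi>' t\<bar> \<le> K\<^sup>2" using zero_le_power2[of "v t"] by (rule half_bound[of "(v t)\<^sup>2" "K\<^sup>2", folded \<psi>'_def])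
  then show 3: "\<bar>t * \<psi>' t\<bar> \<le> K\<^sup>2" by (intro compact_bound far')
  show 4: "\<bar>t * v' t\<bar> \<le> K" by (intro compact_bound far bounds)
  then have "\<bar>t * (t * v' t)\<bar> \<le> K" by (intro compact_bound[where f = "\<lambda>t. t * v' t"]) (simp_all add: far)
  then show "\<bar>t\<^sup>2 * v' t\<bar> \<le> K" by (simp add: power2_eq_square mult.assoc)
  have "\<bar>\<zeta> t * v t\<bar> \<le> 3 * K * K" by (intro abs_mult_le 1 bounds)
  then show 5: "\<bar>\<xi>' t\<bar> \<le> 5 * K\<^sup>2"
    using bounds(4)[of t] 3 K_powers(1) unfolding \<xi>'_def by (simp add: power2_eq_square)
  then show "\<bar>t * \<xi>' t\<bar> \<le> 5 * K\<^sup>2" by (intro compact_bound far')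
qed

lemma \<sigma>_ge: "\<eta> \<le> \<sigma> t" by (rule width_ge[OF \<eta>_pos])

lemma \<sigma>_bounds:
  assumes "\<bar>t\<bar> \<le> 1"
  shows "(\<sigma>' t)\<^sup>2 \<le> 4 * (\<eta> / \<sigma> t)" "\<bar>\<sigma> t * \<sigma>'' t\<bar> \<le> 20 * (\<eta> / \<sigma> t)"
    "\<bar>\<sigma>' t\<bar> \<le> 2" "(\<sigma>' t)\<^sup>2 \<le> 4" "\<bar>\<sigma> t * \<sigma>'' t\<bar> \<le> 20" "\<bar>\<sigma>'' t\<bar> \<le> 20 / \<sigma> t"
proof -
  show 1: "(\<sigma>' t)\<^sup>2 \<le> 4 * (\<eta> / \<sigma> t)" using width'_sq[OF \<eta>_pos assms] by simp
  show 2: "\<bar>\<sigma> t * \<sigma>'' t\<bar> \<le> 20 * (\<eta> / \<sigma> t)" using width_width''[OF \<eta>_pos assms] by simp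
  have "\<eta> / \<sigma> t \<le> 1" using \<sigma>_ge[of t] by simp
  then show 3: "(\<sigma>' t)\<^sup>2 \<le> 4" and 4: "\<bar>\<sigma> t * \<sigma>'' t\<bar> \<le> 20" using 1 2 by linarith+
  show "\<bar>\<sigma>' t\<bar> \<le> 2" using 3 abs_le_square_iff[of "\<sigma>' t" 2] by simp
  show "\<bar>\<sigma>'' t\<bar> \<le> 20 / \<sigma> t"
    using 4 by (simp add: abs_mult pos_le_divide_eq mult.commute less_imp_le[OF \<sigma>_pos])
qed

text \<open>Second derivatives at a fold are of the order of the reciprocal width and vanish off the
  fold. This function records both facts, so that bounds for several folds can be added.\<close>

definition "strip a b = (if \<bar>a\<bar> < \<sigma> b then 1 / \<sigma> b else 0)"

lemma strip_nonneg: "0 \<le> strip a b"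
  by (simp add: strip_def less_imp_le[OF \<sigma>_pos])

lemma outside: "\<not> \<bar>a\<bar> < \<sigma> b \<Longrightarrow> 1 \<le> \<bar>a / \<sigma> b\<bar>"
  using \<sigma>_pos[of b] by (simp add: abs_divide abs_of_pos)

lemma E_bounds:
  assumes "\<bar>b\<bar> \<le> 1"
  shows "\<bar>E1 a b\<bar> \<le> K" "\<bar>E2 a b\<bar> \<le> 6 * K"
    "\<bar>E11 a b\<bar> \<le> 64 * K * strip a b" "\<bar>E12 a b\<bar> \<le> 64 * K * strip a b" "\<bar>E22 a b\<bar> \<le> 64 * K * strip a b"
proof -
  note S = \<sigma>_bounds[OF assms]
  let ?t = "a / \<sigma> b"
  show "\<bar>E1 a b\<bar> \<le> K" by (simp add: E1_def bounds)
  show "\<bar>E2 a b\<bar> \<le> 6 * K" unfolding E2_def using abs_mult_le[OF S(3) bounds'(1)] by simp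
  show "\<bar>E11 a b\<bar> \<le> 64 * K * strip a b" "\<bar>E12 a b\<bar> \<le> 64 * K * strip a b" "\<bar>E22 a b\<bar> \<le> 64 * K * strip a b"
  proof -
    consider (far) "\<not> \<bar>a\<bar> < \<sigma> b" | (near) "strip a b = 1 / \<sigma> b" 
      unfolding strip_def by (cases "\<bar>a\<bar> < \<sigma> b") auto
    then have "\<bar>E11 a b\<bar> \<le> 64 * K * strip a b \<and> \<bar>E12 a b\<bar> \<le> 64 * K * strip a b \<and> \<bar>E22 a b\<bar> \<le> 64 * K * strip a b"
    proof cases
      case far
      note o = outside[OF far]
      show ?thesis using far
        by (simp add: E11_def E12_def E22_def fold_profile_axioms far'[OF o] fold_profile.far(3)[OF fold_profile_axioms o] strip_def)
    next
      case near
      have d: "\<bar>x / \<sigma> b\<bar> \<le> 64 * K * strip a b" if "\<bar>x\<bar> \<le> 64 * K" for x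
        unfolding near abs_divide using that divide_right_mono[OF that, of "\<sigma> b"] by (simp add: less_imp_le[OF \<sigma>_pos])
      have 1: "\<bar>v' ?t\<bar> \<le> 64 * K" using bounds(3)[of ?t] K_ge_1 by simp
      have 2: "\<bar>- \<sigma>' b * (?t * v' ?t)\<bar> \<le> 64 * K"
        using abs_mult_le[OF S(3) bounds'(4)[of ?t]] K_ge_1 by (simp add: abs_mult)
      have 3: "\<bar>\<sigma>'' b * \<zeta> ?t\<bar> \<le> 60 * K * strip a b"
        unfolding near using abs_mult_le[OF S(6) bounds'(1)[of ?t]] by simp
      have "\<bar>(\<sigma>' b)\<^sup>2 * (?t\<^sup>2 * v' ?t)\<bar> \<le> 4 * K"
        using S(4) by (intro abs_mult_le bounds'(5)) simp
      then have 4: "\<bar>(\<sigma>' b)\<^sup>2 * (?t\<^sup>2 * v' ?t) / \<sigma> b\<bar> \<le> 4 * K * strip a b"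
        unfolding near abs_divide using divide_right_mono[of _ "4 * K" "\<sigma> b"] by (simp add: less_imp_le[OF \<sigma>_pos])
      \<comment> \<open>The contributions 60 of \<open>\<sigma>''\<close> and 4 of
        \<open>\<sigma>'\<close> squared fix the common constant 64.\<close>
      have "\<bar>E22 a b\<bar> \<le> 64 * K * strip a b"
        unfolding E22_def by (rule order_trans[OF abs_triangle_ineq]) (use 3 4 in linarith)
      then show ?thesis unfolding E11_def E12_def using d[OF 1] d[OF 2] by blast
    qed
    then show "\<bar>E11 a b\<bar> \<le> 64 * K * strip a b" "\<bar>E12 a b\<bar> \<le> 64 * K * strip a b" "\<bar>E22 a b\<bar> \<le> 64 * K * strip a b"
      by auto
  qed
qed

definition "rim a b = (if \<bar>T a b\<bar> < 1 then 1 / \<sigma> a else 0)"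

lemma rim_nonneg: "0 \<le> rim a b"
  by (simp add: rim_def less_imp_le[OF \<sigma>_pos])

context
  fixes a b :: real
  assumes a: "\<bar>a\<bar> \<le> 1" and b: "\<bar>b\<bar> \<le> 1"
begin

lemma s1_bounds: "\<bar>s1 a b\<bar> \<le> 7 * K" "\<bar>\<beta> * s1 a b\<bar> \<le> 7 * K" "\<bar>\<beta> * s1 b a\<bar> \<le> 7 * K"
proof -
  show 1: "\<bar>s1 a b\<bar> \<le> 7 * K" unfolding s1_def using E_bounds(1)[OF b, of a] E_bounds(2)[OF a, of b] by linarith
  have 2: "\<bar>s1 b a\<bar> \<le> 7 * K" unfolding s1_def using E_bounds(1)[OF a, of b] E_bounds(2)[OF b, of a] by linarith
  have \<beta>: "\<bar>\<beta>\<bar> \<le> 1" using \<beta>_bounds by simp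
  show "\<bar>\<beta> * s1 a b\<bar> \<le> 7 * K" "\<bar>\<beta> * s1 b a\<bar> \<le> 7 * K"
    using abs_mult_le[OF \<beta> 1] abs_mult_le[OF \<beta> 2] by simp_all
qed

lemma s2_bounds:
  "\<bar>s11 a b\<bar> \<le> 64 * K * (strip a b + strip b a)" "\<bar>s11 b a\<bar> \<le> 64 * K * (strip a b + strip b a)"
  "\<bar>s12 a b\<bar> \<le> 64 * K * (strip a b + strip b a)" "\<bar>s12 b a\<bar> \<le> 64 * K * (strip a b + strip b a)"
  unfolding s11_def s12_def distrib_left
  using E_bounds(3-5)[OF b, of a] E_bounds(3-5)[OF a, of b] by linarith+

lemma T_bounds:
  assumes "\<bar>T a b\<bar> < 1"
  shows "\<bar>\<sigma> a * T1 a b\<bar> \<le> 9 * K" "\<bar>\<sigma> a * T2 a b\<bar> \<le> 7 * K"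
    "\<bar>T1 a b\<bar> \<le> 9 * K * rim a b" "\<bar>T2 a b\<bar> \<le> 7 * K * rim a b"
proof -
  have "\<bar>T a b * \<sigma>' a\<bar> \<le> 1 * 2" using assms \<sigma>_bounds(3)[OF a] by (intro abs_mult_le) auto
  then show 1: "\<bar>\<sigma> a * T1 a b\<bar> \<le> 9 * K" unfolding T1_def using s1_bounds(2) K_ge_1 by simp
  show 2: "\<bar>\<sigma> a * T2 a b\<bar> \<le> 7 * K" unfolding T2_def using s1_bounds(3) by simp
  show "\<bar>T1 a b\<bar> \<le> 9 * K * rim a b" "\<bar>T2 a b\<bar> \<le> 7 * K * rim a b"
    using 1 2 assms \<sigma>_pos[of a] by (simp_all add: rim_def abs_mult pos_le_divide_eq mult.commute abs_of_pos)
qed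

text \<open>The terms with a derivative of \<open>T\<close> and those with
  \<open>\<sigma>'' a\<close> carry a profile that vanishes for |T| \<ge> 1 and are of order
  \<open>rim\<close>. The remaining terms contain second derivatives of \<open>s\<close> and are
  controlled by the two axis strips.\<close>

lemma w_second_bounds:
  defines "m \<equiv> 300 * K^3 * (rim a b + strip a b + strip b a)"
  shows "\<bar>w11 a b\<bar> \<le> m" "\<bar>w12 a b\<bar> \<le> m" "\<bar>w21 a b\<bar> \<le> m" "\<bar>w22 a b\<bar> \<le> m"
proof -
  let ?c = "strip a b + strip b a" and ?i = "rim a b" and ?T = "T a b"
  have c: "0 \<le> ?c" "0 \<le> ?i" using strip_nonneg rim_nonneg by (auto intro: add_nonneg_nonneg)
  have \<beta>: "\<bar>\<beta>\<bar> \<le> 1" using \<beta>_bounds by simp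
  have far_T: "v' ?T = 0" "\<zeta> ?T = 0" if "\<not> \<bar>?T\<bar> < 1" using that far far' by auto
  have I: "\<bar>f ?T * X * Y\<bar> \<le> 63 * K^3 * ?i"
    if "\<bar>T a b\<bar> < 1 \<Longrightarrow> \<bar>X\<bar> \<le> 9 * K * ?i" "\<bar>Y\<bar> \<le> 7 * K" "\<bar>f ?T\<bar> \<le> K" "\<not> \<bar>?T\<bar> < 1 \<Longrightarrow> f ?T = 0" for f :: "real \<Rightarrow> real" and X Y
  proof (cases "\<bar>T a b\<bar> < 1")
    case True
    show ?thesis using abs_mult_le[OF abs_mult_le[OF that(3) that(1)[OF True]] that(2)]
      by (simp add: eval_nat_numeral mult_ac)
  next
    case False
    then show ?thesis using that(4) c K_powers(4) by simp
  qed
  have X: "\<bar>T1 a b\<bar> \<le> 9 * K * ?i" "\<bar>T2 a b\<bar> \<le> 9 * K * ?i" if "\<bar>T a b\<bar> < 1"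
  proof -
    have "7 * K * ?i \<le> 9 * K * ?i" using K_powers(4) c by (intro mult_right_mono) auto
    then show "\<bar>T1 a b\<bar> \<le> 9 * K * ?i" "\<bar>T2 a b\<bar> \<le> 9 * K * ?i" using T_bounds[OF that] by auto
  qed
  have A: "\<bar>v' ?T * T1 a b * (\<beta> * s1 a b)\<bar> \<le> 63 * K^3 * ?i" "\<bar>v' ?T * T2 a b * (\<beta> * s1 a b)\<bar> \<le> 63 * K^3 * ?i"
     "\<bar>v' ?T * T1 a b * (\<beta> * s1 b a)\<bar> \<le> 63 * K^3 * ?i" "\<bar>v' ?T * T2 a b * (\<beta> * s1 b a)\<bar> \<le> 63 * K^3 * ?i"
    by (intro I X s1_bounds bounds far_T; assumption)+
  have s': "\<bar>\<sigma>' a\<bar> \<le> 7 * K" using \<sigma>_bounds(3)[OF a] K_ge_1 by simp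
  have B: "\<bar>(?T * v' ?T) * T1 a b * \<sigma>' a\<bar> \<le> 63 * K^3 * ?i" "\<bar>(?T * v' ?T) * T2 a b * \<sigma>' a\<bar> \<le> 63 * K^3 * ?i"
    by (rule I[where f = "\<lambda>t. t * v' t"], (intro X; assumption), rule s', rule bounds', simp add: far_T)+
  have C: "\<bar>v ?T * (\<beta> * x)\<bar> \<le> 64 * K^3 * ?c" if "\<bar>x\<bar> \<le> 64 * K * ?c" for x
  proof -
    have "\<bar>v ?T * (\<beta> * x)\<bar> \<le> K * (1 * (64 * K * ?c))" by (intro abs_mult_le bounds \<beta> that)
    also have "\<dots> = 64 * K\<^sup>2 * ?c" by (simp add: power2_eq_square)
    also have "\<dots> \<le> 64 * K^3 * ?c" using K_powers(2) c by (intro mult_right_mono) auto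
    finally show ?thesis .
  qed
  have D: "\<bar>\<sigma>'' a * \<zeta> ?T\<bar> \<le> 60 * K^3 * ?i"
  proof (cases "\<bar>?T\<bar> < 1")
    case True
    have "\<bar>\<sigma>'' a * \<zeta> ?T\<bar> \<le> 20 / \<sigma> a * (3 * K)" by (intro abs_mult_le \<sigma>_bounds(6)[OF a] bounds')
    also have "\<dots> = 60 * K * ?i" using True by (simp add: rim_def)
    also have "\<dots> \<le> 60 * K^3 * ?i" using K_powers c by (intro mult_right_mono) auto
    finally show ?thesis .
  qed (use far_T c K_powers(4) in simp)
  have 0: "63 * K^3 * ?i + 64 * K^3 * ?c + 60 * K^3 * ?i + 63 * K^3 * ?i \<le> m"
  proof -
    have "0 \<le> K^3 * ?i" "0 \<le> K^3 * ?c" using K_powers(4) c by auto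
    then show ?thesis unfolding m_def by (simp add: algebra_simps)
  qed
  have 1: "0 \<le> 60 * K^3 * ?i" "0 \<le> 63 * K^3 * ?i" using K_powers(4) c by auto
  show "\<bar>w11 a b\<bar> \<le> m"
    using A(1) C[OF s2_bounds(1)] D B(1) 0 unfolding w11_def mult.assoc mult.commute[of "\<sigma>' a"] by linarith
  show "\<bar>w12 a b\<bar> \<le> m"
    using A(2) C[OF s2_bounds(3)] B(2) 0 1 unfolding w12_def mult.assoc mult.commute[of "\<sigma>' a"] by linarith
  show "\<bar>w21 a b\<bar> \<le> m"
    using A(3) C[OF s2_bounds(4)] 0 1 unfolding w21_def mult.assoc by linarith
  show "\<bar>w22 a b\<bar> \<le> m"
    using A(4) C[OF s2_bounds(2)] 0 1 unfolding w22_def mult.assoc by linarith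
qed

lemma w_first_bounds: "\<bar>w1 a b\<bar> \<le> 13 * K\<^sup>2" "\<bar>w2 a b\<bar> \<le> 13 * K\<^sup>2"
proof -
  have 1: "\<bar>v (T a b) * (\<beta> * s1 a b)\<bar> \<le> K * (7 * K)" "\<bar>v (T a b) * (\<beta> * s1 b a)\<bar> \<le> K * (7 * K)"
    by (intro abs_mult_le bounds s1_bounds)+
  have 2: "\<bar>\<sigma>' a * \<zeta> (T a b)\<bar> \<le> 2 * (3 * K)" by (intro abs_mult_le bounds' \<sigma>_bounds(3) a)
  show "\<bar>w1 a b\<bar> \<le> 13 * K\<^sup>2" "\<bar>w2 a b\<bar> \<le> 13 * K\<^sup>2"
    unfolding w1_def w2_def mult.assoc using 1 2 K_powers(1) by (simp_all add: power2_eq_square)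
qed

lemma V_bounds: "\<bar>V1 a b\<bar> \<le> 1" "\<bar>V2 a b\<bar> \<le> 2"
proof -
  have "\<bar>- (pi / 8)\<bar> \<le> 1/2" using pi_less_4 by simp
  from abs_add_le(2)[OF this abs_half[OF frac_bounds(1)[of b a]]]
  show "\<bar>V1 a b\<bar> \<le> 1" unfolding V1_def by simp
  have "\<bar>- arctan (a / b)\<bar> \<le> 2" using arctan_bounded[of "a / b"] pi_less_4 by (simp add: abs_le_iff)
  from abs_add_le(1)[OF abs_half[OF this] abs_half[OF frac_bounds(3)[of a b]]]
  show "\<bar>V2 a b\<bar> \<le> 2" unfolding V2_def by linarith
qed

text \<open>\<open>\<kappa>' a\<close> is of order 1/\<eta> but lives on |a| < \<eta>, where the
  width is at most 2 \<eta>. Hence its product with any term of the order of the width stays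
  bounded.\<close>

lemma \<kappa>'_bound: "\<bar>\<kappa>' a\<bar> * \<sigma> a \<le> 2 * K"
proof (cases "\<bar>a\<bar> < \<eta>")
  case True
  then have "a\<^sup>2 \<le> \<eta>\<^sup>2" using \<eta>_pos by (simp add: abs_le_square_iff[symmetric])
  then have "(\<sigma> a)^3 \<le> \<eta> * (\<eta>\<^sup>2 + \<eta>\<^sup>2)"
    using width_cubed_le(1)[OF \<eta>_pos a] \<eta>_pos by (auto elim!: order_trans intro!: mult_left_mono)
  also have "\<dots> \<le> (2 * \<eta>)^3" using \<eta>_pos by (simp add: eval_nat_numeral)
  finally have "\<sigma> a \<le> 2 * \<eta>" using \<eta>_pos by (intro power_le_imp_le_base[of "\<sigma> a" 2 "2 * \<eta>"]) auto
  then have "\<bar>v' (a / \<eta>)\<bar> * \<sigma> a \<le> K * (2 * \<eta>)"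
    by (intro mult_mono bounds) (auto simp: less_imp_le[OF \<sigma>_pos] K_powers less_imp_le)
  then show ?thesis using \<eta>_pos by (simp add: \<kappa>'_def abs_divide field_simps)
next
  case False
  then have "1 \<le> \<bar>a / \<eta>\<bar>" using \<eta>_pos by (simp add: abs_divide)
  then show ?thesis using K_powers(4) by (simp add: \<kappa>'_def far)
qed

lemma E_diff: "\<bar>E b a - \<bar>b\<bar>\<bar> \<le> K * \<sigma> a"
proof -
  have "E b a - \<bar>b\<bar> = \<sigma> a * (\<phi> (b / \<sigma> a) - \<bar>b / \<sigma> a\<bar>)"
    by (simp add: E_def right_diff_distrib abs_divide less_imp_le[OF \<sigma>_pos])
  then have "\<bar>E b a - \<bar>b\<bar>\<bar> = \<sigma> a * \<bar>\<phi> (b / \<sigma> a) - \<bar>b / \<sigma> a\<bar>\<bar>"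
    by (simp add: abs_mult less_imp_le[OF \<sigma>_pos])
  also have "\<dots> \<le> \<sigma> a * K" by (intro mult_left_mono bounds less_imp_le[OF \<sigma>_pos])
  finally show ?thesis by (simp add: mult.commute)
qed

lemma HP_bounds: "\<bar>H1 a b\<bar> \<le> 44 * K\<^sup>2" "\<bar>H2 a b\<bar> \<le> 10 * K\<^sup>2" "\<bar>P1 a b\<bar> \<le> 4 * K\<^sup>2" "\<bar>P2 a b\<bar> \<le> K\<^sup>2"
proof -
  let ?t = "b / \<sigma> a"
  note S = \<sigma>_bounds[OF a]
  have "\<bar>(\<sigma>' a)\<^sup>2 + \<sigma> a * \<sigma>'' a\<bar> \<le> 24" using S(4,5) zero_le_power2[of "\<sigma>' a"] by linarith
  then have 1: "\<bar>((\<sigma>' a)\<^sup>2 + \<sigma> a * \<sigma>'' a) * \<xi> ?t\<bar> \<le> 24 * K" by (intro abs_mult_le bounds)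
  have 2: "\<bar>(\<sigma>' a)\<^sup>2 * (?t * \<xi>' ?t)\<bar> \<le> 4 * (5 * K\<^sup>2)" using S(4) by (intro abs_mult_le bounds') auto
  show "\<bar>H1 a b\<bar> \<le> 44 * K\<^sup>2" unfolding H1_def by (rule order_trans[OF abs_add_le(2)[OF 1 2]]) (use K_powers(1) in linarith)
  show "\<bar>H2 a b\<bar> \<le> 10 * K\<^sup>2" unfolding H2_def using abs_mult_le[OF S(3) bounds'(6)[of ?t]] by simp
  have "\<bar>\<psi> ?t - ?t * \<psi>' ?t\<bar> \<le> 2 * K\<^sup>2" using bounds(4)[of ?t] bounds'(3)[of ?t] K_powers(1) by linarith
  from abs_mult_le[OF S(3) this] show "\<bar>P1 a b\<bar> \<le> 4 * K\<^sup>2" unfolding P1_def by simp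
  show "\<bar>P2 a b\<bar> \<le> K\<^sup>2" unfolding P2_def by (rule bounds')
qed

end

text \<open>The Cartesian components of the whole membrane strain; the fractions are the entries of
  \<open>xperp x i * xperp x j\<close>.\<close>

definition "S11 a b = 2 * (Y1 a b + R1 a b) + (w1 a b)\<^sup>2 + b\<^sup>2 / (a\<^sup>2 + b\<^sup>2)"
definition "S12 a b = (Y2 a b + R2 a b) + (Y2 b a + Q1 a b) + w1 a b * w2 a b - a * b / (a\<^sup>2 + b\<^sup>2)"
definition "S22 a b = 2 * (Y1 b a + Q2 a b) + (w2 a b)\<^sup>2 + a\<^sup>2 / (a\<^sup>2 + b\<^sup>2)"

context
  fixes a b :: real
  assumes a: "\<bar>a\<bar> \<le> 1" and b: "\<bar>b\<bar> \<le> 1"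
begin

lemma Y_bounds: "\<bar>Y1 a b\<bar> \<le> 60 * K\<^sup>2" "\<bar>Y2 a b\<bar> \<le> 60 * K\<^sup>2"
proof -
  have \<beta>2: "\<bar>\<beta>\<^sup>2\<bar> \<le> 1" using pi_less_4 by (simp add: \<beta>_sq)
  note HP = HP_bounds[OF a b] HP_bounds[OF b a]
  have "\<bar>\<kappa>' a\<bar> * \<bar>E b a - \<bar>b\<bar>\<bar> \<le> \<bar>\<kappa>' a\<bar> * (K * \<sigma> a)"
    by (intro mult_left_mono E_diff[OF a b]) simp
  also have "\<dots> = K * (\<bar>\<kappa>' a\<bar> * \<sigma> a)" by (simp add: mult_ac)
  also have "\<dots> \<le> K * (2 * K)" using K_powers(4) by (intro mult_left_mono \<kappa>'_bound[OF a b]) auto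
  finally have 1: "\<bar>\<kappa>' a * (E b a - \<bar>b\<bar>)\<bar> \<le> 2 * K\<^sup>2" by (simp add: abs_mult power2_eq_square mult_ac)
  have "\<bar>\<kappa> a * E2 b a\<bar> \<le> K * (6 * K)" unfolding \<kappa>_def by (intro abs_mult_le bounds E_bounds(2)[OF a])
  then have 2: "\<bar>\<kappa> a * E2 b a\<bar> \<le> 6 * K\<^sup>2" by (simp add: power2_eq_square mult_ac)
  have k: "1 \<le> K\<^sup>2" using K_ge_1 by simp
  have "\<bar>Y1 a b\<bar> \<le> 1 + 1 * (2 * K\<^sup>2 + 6 * K\<^sup>2) + 1 * (44 * K\<^sup>2 + K\<^sup>2)"
    unfolding Y1_def by (intro abs_add_le abs_mult_le[OF \<beta>2] 1 2 HP V_bounds[OF a b])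
  then show "\<bar>Y1 a b\<bar> \<le> 60 * K\<^sup>2" using k by argo
  have 3: "\<bar>\<kappa> a * (E1 b a - sgn b)\<bar> \<le> K * (K + 1)"
    unfolding \<kappa>_def by (intro abs_mult_le bounds abs_add_le E_bounds(1)[OF a]) (simp add: sgn_if)
  have "\<bar>Y2 a b\<bar> \<le> 2 + 1 * (K * (K + 1)) + 1 * (10 * K\<^sup>2 + 4 * K\<^sup>2)"
    unfolding Y2_def by (intro abs_add_le abs_mult_le[OF \<beta>2] 3 HP V_bounds[OF a b])
  moreover have "K * (K + 1) \<le> 2 * K\<^sup>2" using K_powers(1) by (simp add: power2_eq_square algebra_simps)
  ultimately show "\<bar>Y2 a b\<bar> \<le> 60 * K\<^sup>2" using k by argo
qed

text \<open>Each derivative of \<open>T\<close>, of order 1/\<sigma> on the fold, comes with a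
  factor \<open>\<sigma> a\<close>, and off the fold the profile in front of it vanishes.\<close>

lemma RQ_bounds:
  "\<bar>R1 a b\<bar> \<le> 200 * K^4" "\<bar>R2 a b\<bar> \<le> 200 * K^4" "\<bar>Q1 a b\<bar> \<le> 200 * K^4" "\<bar>Q2 a b\<bar> \<le> 200 * K^4"
proof -
  have \<beta>: "\<bar>\<beta>\<bar> \<le> 1" using \<beta>_bounds by simp
  note S = \<sigma>_bounds[OF a]
  let ?T = "T a b"
  have G: "\<bar>\<sigma> a * (\<psi>' ?T * T1 a b)\<bar> \<le> 9 * K^3" "\<bar>\<sigma> a * (\<psi>' ?T * T2 a b)\<bar> \<le> 9 * K^3"
       "\<bar>\<sigma> a * \<sigma>' a * (\<xi>' ?T * T1 a b)\<bar> \<le> 90 * K^3" "\<bar>\<sigma> a * \<sigma>' a * (\<xi>' ?T * T2 a b)\<bar> \<le> 90 * K^3"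
  proof -
    have "\<bar>\<sigma> a * (\<psi>' ?T * T1 a b)\<bar> \<le> 9 * K^3 \<and> \<bar>\<sigma> a * (\<psi>' ?T * T2 a b)\<bar> \<le> 9 * K^3
       \<and> \<bar>\<sigma> a * \<sigma>' a * (\<xi>' ?T * T1 a b)\<bar> \<le> 90 * K^3 \<and> \<bar>\<sigma> a * \<sigma>' a * (\<xi>' ?T * T2 a b)\<bar> \<le> 90 * K^3"
    proof (cases "\<bar>?T\<bar> < 1")
      case True
      note TB = T_bounds(1,2)[OF a b True]
      have 2: "\<bar>\<sigma> a * T2 a b\<bar> \<le> 9 * K" using TB(2) K_ge_1 by simp
      have g: "\<bar>\<psi>' ?T * (\<sigma> a * X)\<bar> \<le> 9 * K^3" "\<bar>\<sigma>' a * (\<xi>' ?T * (\<sigma> a * X))\<bar> \<le> 90 * K^3"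
        if "\<bar>\<sigma> a * X\<bar> \<le> 9 * K" for X
        using abs_mult_le[OF bounds'(2)[of ?T] that] abs_mult_le[OF S(3) abs_mult_le[OF bounds'(6)[of ?T] that]]
        by (simp_all add: eval_nat_numeral mult_ac)
      show ?thesis using g[OF TB(1)] g[OF 2] by (simp add: mult_ac)
    next
      case False
      then have "\<psi>' ?T = 0" "\<xi>' ?T = 0" using far'[of ?T] by auto
      then show ?thesis using K_powers(4) by simp
    qed
    then show "\<bar>\<sigma> a * (\<psi>' ?T * T1 a b)\<bar> \<le> 9 * K^3" "\<bar>\<sigma> a * (\<psi>' ?T * T2 a b)\<bar> \<le> 9 * K^3"
       "\<bar>\<sigma> a * \<sigma>' a * (\<xi>' ?T * T1 a b)\<bar> \<le> 90 * K^3" "\<bar>\<sigma> a * \<sigma>' a * (\<xi>' ?T * T2 a b)\<bar> \<le> 90 * K^3" by auto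
  qed
  have k: "\<bar>\<kappa> a\<bar> \<le> K" "\<bar>v (b / \<sigma> a)\<bar> \<le> K" by (simp_all add: \<kappa>_def bounds)
  have "\<bar>\<sigma> a * \<kappa>' a\<bar> \<le> 2 * K"
    using \<kappa>'_bound[OF a b] \<sigma>_pos[of a] by (simp add: abs_mult abs_of_pos mult.commute)
  from abs_mult_le[OF this bounds(4)[of ?T]]
  have 1: "\<bar>\<sigma> a * \<psi> ?T * \<kappa>' a\<bar> \<le> 2 * K * K" by (simp add: mult_ac)
  have "\<bar>(\<sigma>' a)\<^sup>2 + \<sigma> a * \<sigma>'' a\<bar> \<le> 24" using S(4,5) zero_le_power2[of "\<sigma>' a"] by linarith
  then have 2: "\<bar>((\<sigma>' a)\<^sup>2 + \<sigma> a * \<sigma>'' a) * \<xi> ?T\<bar> \<le> 24 * K" by (intro abs_mult_le bounds)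
  have p: "K \<le> K^4" "K * K \<le> K^4" "K^3 \<le> K^4" "K^3 * K = K^4" "0 \<le> K^4"
  proof -
    show "K \<le> K^4" "K^3 \<le> K^4" "0 \<le> K^4" using K_powers by auto
    show "K * K \<le> K^4" using K_powers by (simp add: power2_eq_square)
    show "K^3 * K = K^4" by (simp add: eval_nat_numeral)
  qed
  have "\<bar>R1 a b\<bar> \<le> 1 * (2 * K * K + 9 * K^3 * K + 2 * K * K) + 24 * K + 90 * K^3"
    unfolding R1_def by (intro abs_add_le abs_mult_le[OF \<beta>] abs_mult_le[OF _ k(1)] abs_mult_le[OF S(3)] bounds G 1 2)
  then show "\<bar>R1 a b\<bar> \<le> 200 * K^4" using p by (simp add: mult.assoc)
  have "\<bar>R2 a b\<bar> \<le> 1 * (9 * K^3 * K) + 90 * K^3"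
    unfolding R2_def by (intro abs_add_le abs_mult_le[OF \<beta>] abs_mult_le[OF _ k(1)] G)
  then show "\<bar>R2 a b\<bar> \<le> 200 * K^4" using p by (simp add: mult.assoc)
  have "\<bar>Q1 a b\<bar> \<le> 1 * (2 * K * K + 9 * K^3 * K + K * 2 * K)"
    unfolding Q1_def by (intro abs_add_le abs_mult_le[OF \<beta>] abs_mult_le[OF _ k(2)]
        abs_mult_le[OF _ bounds'(4)] abs_mult_le[OF S(3)] abs_mult_le[OF bounds(4) S(3)] bounds G)
  then show "\<bar>Q1 a b\<bar> \<le> 200 * K^4" using p by (simp add: mult.assoc)
  have "\<bar>Q2 a b\<bar> \<le> 1 * (9 * K^3 * K + K * K)"
    unfolding Q2_def by (intro abs_add_le abs_mult_le[OF \<beta>] abs_mult_le[OF _ k(2)] abs_mult_le bounds G)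
  then show "\<bar>Q2 a b\<bar> \<le> 200 * K^4" using p by (simp add: mult.assoc)
qed

end

text \<open>Of order one and not small: this bound is meant for the places where two folds overlap
  and no cancellation is available.\<close>

lemma strain_bounds:
  assumes a: "\<bar>a\<bar> \<le> 1" and b: "\<bar>b\<bar> \<le> 1"
  shows "\<bar>S11 a b\<bar> \<le> 1000 * K^4" "\<bar>S12 a b\<bar> \<le> 1000 * K^4" "\<bar>S22 a b\<bar> \<le> 1000 * K^4"
proof -
  note Y = Y_bounds[OF a b] Y_bounds[OF b a] and R = RQ_bounds[OF a b] and w = w_first_bounds[OF a b]
  have k: "K\<^sup>2 \<le> K^4" "1 \<le> K^4" using K_powers K_ge_1 by (auto simp: power_increasing)
  have 2: "\<bar>2::real\<bar> \<le> 2" by simp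
  have kk: "13 * K\<^sup>2 * (13 * K\<^sup>2) = 169 * K^4" by (simp add: eval_nat_numeral)
  have "\<bar>S11 a b\<bar> \<le> 2 * (60 * K\<^sup>2 + 200 * K^4) + 13 * K\<^sup>2 * (13 * K\<^sup>2) + 1"
    unfolding S11_def power2_eq_square[of "w1 a b"]
    by (intro abs_add_le abs_mult_le[OF 2] abs_mult_le[OF w(1) w(1)] Y R frac_bounds)
  then show "\<bar>S11 a b\<bar> \<le> 1000 * K^4" using k unfolding kk by argo
  have "\<bar>S12 a b\<bar> \<le> (60 * K\<^sup>2 + 200 * K^4) + (60 * K\<^sup>2 + 200 * K^4) + 13 * K\<^sup>2 * (13 * K\<^sup>2) + 1"
    unfolding S12_def
    by (intro abs_add_le abs_mult_le[OF 2] abs_mult_le[OF w(1) w(2)] Y R frac_bounds)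
  then show "\<bar>S12 a b\<bar> \<le> 1000 * K^4" using k unfolding kk by argo
  have "\<bar>S22 a b\<bar> \<le> 2 * (60 * K\<^sup>2 + 200 * K^4) + 13 * K\<^sup>2 * (13 * K\<^sup>2) + 1"
    unfolding S22_def power2_eq_square[of "w2 a b"]
    by (intro abs_add_le abs_mult_le[OF 2] abs_mult_le[OF w(2) w(2)] Y R frac_bounds)
  then show "\<bar>S22 a b\<bar> \<le> 1000 * K^4" using k unfolding kk by argo
qed

end

section \<open>Strain near the folds\<close>

text \<open>Applied to a smoothed absolute value inside its own strip, where both |y| and the
  smoothing error are at most of the order of the width.\<close>

lemma near_bound:
  fixes x y k s :: real
  assumes "\<bar>x - \<bar>y\<bar>\<bar> \<le> k * s" "\<bar>y\<bar> < s" "1 \<le> k"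
  shows "\<bar>x\<bar> \<le> 2 * k * s"
proof -
  define p where "p = k * s"
  have "1 * s \<le> k * s" using assms by (intro mult_right_mono) auto
  then have "s \<le> p" "\<bar>x - \<bar>y\<bar>\<bar> \<le> p" using assms(1) by (auto simp: p_def)
  then have "\<bar>x\<bar> \<le> 2 * p" using assms(2) by linarith
  then show ?thesis by (simp add: p_def)
qed

context folded_cone
begin

lemma \<sigma>_nonneg [simp]: "0 \<le> \<sigma> t"
  by (rule less_imp_le[OF \<sigma>_pos])

lemma far_E:
  assumes "\<not> \<bar>a\<bar> < \<sigma> b"
  shows "E a b = \<bar>a\<bar>" "E1 a b = sgn a" "E2 a b = 0"
proof -
  note o = outside[OF assms]
  show "E a b = \<bar>a\<bar>" using \<sigma>_pos[of b] by (simp add: E_def far(1)[OF o] abs_divide abs_of_pos)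
  show "E1 a b = sgn a" using \<sigma>_pos[of b] by (simp add: E1_def far(2)[OF o] sgn_divide)
  show "E2 a b = 0" by (simp add: E2_def far'[OF o])
qed

text \<open>The transition of \<open>\<kappa>\<close> takes place at scale \<eta>, the smallest
  width, hence always inside the strip around \<open>a = 0\<close>.\<close>

lemma far_\<kappa>:
  assumes "\<not> \<bar>a\<bar> < \<sigma> b"
  shows "\<kappa> a = sgn a" "\<kappa>' a = 0"
proof -
  have "\<eta> \<le> \<bar>a\<bar>" using assms \<sigma>_ge[of b] by simp
  then have o: "1 \<le> \<bar>a / \<eta>\<bar>" using \<eta>_pos by (simp add: abs_divide)
  show "\<kappa> a = sgn a" using \<eta>_pos by (simp add: \<kappa>_def far(2)[OF o] sgn_divide)
  show "\<kappa>' a = 0" by (simp add: \<kappa>'_def far(3)[OF o])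
qed

lemma far_HP:
  assumes "\<not> \<bar>a\<bar> < \<sigma> b"
  shows "H1 b a = 0" "H2 b a = 0" "P1 b a = 0" "P2 b a = 0"
  using far'[OF outside[OF assms]] far[OF outside[OF assms]]
  by (simp_all add: H1_def H2_def P1_def P2_def)

text \<open>The sum of arctan(a/b) and arctan(b/a) is \<pi>/2 up to sign. This is where \<beta>^2 =
  \<pi>/4 enters: the strain of \<open>V\<close> together with the given rank-one term equals minus
  the square of the pyramid's gradient.\<close>

lemma V_strain:
  assumes "a \<noteq> 0" "b \<noteq> 0"
  shows "2 * V1 a b + b\<^sup>2 / (a\<^sup>2 + b\<^sup>2) = - \<beta>\<^sup>2"
    "V2 a b + V2 b a - a * b / (a\<^sup>2 + b\<^sup>2) = - \<beta>\<^sup>2 * (sgn a * sgn b)"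
proof -
  show "2 * V1 a b + b\<^sup>2 / (a\<^sup>2 + b\<^sup>2) = - \<beta>\<^sup>2" 
  proof -
    have "2 * (- (pi / 8) - x / 2) + x = - (pi / 4)" for x by simp
    then show ?thesis unfolding V1_def \<beta>_sq .
  qed
  have "arctan (1 / (a / b)) = sgn (a / b) * pi / 2 - arctan (a / b)"
    using assms by (intro Transcendental.arctan_inverse) auto
  then have "arctan (b / a) = sgn (a / b) * pi / 2 - arctan (a / b)" by (simp only: divide_divide_eq_right mult_1_left)
  moreover have "sgn (a / b) = sgn a * sgn b" unfolding sgn_divide by (simp add: sgn_if)
  ultimately have 1: "arctan (a / b) + arctan (b / a) = sgn a * sgn b * pi / 2" by simp
  define q where "q = a * b / (a\<^sup>2 + b\<^sup>2)"
  have "V2 a b = - arctan (a / b) / 2 + q / 2" "V2 b a = - arctan (b / a) / 2 + q / 2"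
    by (simp_all add: V2_def q_def mult.commute add.commute)
  then have "V2 a b + V2 b a - q = - (arctan (a / b) + arctan (b / a)) / 2" by (simp add: field_simps)
  then show "V2 a b + V2 b a - a * b / (a\<^sup>2 + b\<^sup>2) = - \<beta>\<^sup>2 * (sgn a * sgn b)"
    unfolding 1 \<beta>_sq q_def by simp
qed

text \<open>\<open>rim\<close> refers to the smoothed square, \<open>crease\<close> to the exact one; they agree off the axis strips.\<close>

definition "crease x y = (if \<beta> * \<bar>\<bar>x\<bar> + \<bar>y\<bar> - 1/2\<bar> < \<sigma> x then 1 / \<sigma> x else 0)"

definition "inv_scale x y = strip x y + strip y x + crease x y"

text \<open>Strain of the smoothed pyramid \<open>\<beta> * s\<close> before the reflection, with
  the displacement \<open>(Y a b, Y b a)\<close>. The remaining diagonal component is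
  \<open>Z11 b a\<close> by symmetry.\<close>

definition "Z11 a b = 2 * Y1 a b + \<beta>\<^sup>2 * (s1 a b)\<^sup>2 + b\<^sup>2 / (a\<^sup>2 + b\<^sup>2)"
definition "Z12 a b = Y2 a b + Y2 b a + \<beta>\<^sup>2 * (s1 a b * s1 b a) - a * b / (a\<^sup>2 + b\<^sup>2)"

lemma sgn_sq: "x \<noteq> 0 \<Longrightarrow> sgn x * sgn x = 1" for x :: real
  by (simp add: sgn_if)

text \<open>Under these hypotheses only the fold \<open>b = 0\<close> can be active, with
  \<open>a\<close> along and \<open>b\<close> across. As \<open>\<kappa> a = sgn a\<close>, the
  correction in \<open>Y\<close> trades the kink of \<open>V\<close>, a multiple of sgn a |b|, for
  its smoothing. Then 2 \<psi>' + v^2 = 1 removes the transverse component and the equation for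
  \<open>\<xi>\<close> the mixed one. Exchanging \<open>a\<close> and \<open>b\<close> treats the
  other axis.\<close>

lemma ridge_strain:
  assumes nz: "a \<noteq> 0" "b \<noteq> 0" and far: "\<not> \<bar>a\<bar> < \<sigma> b"
  shows "Z11 a b = \<beta>\<^sup>2 * ((\<sigma>' a * \<zeta> (b / \<sigma> a))\<^sup>2 + 2 * H1 a b)" "Z12 a b = 0" "Z11 b a = 0"
proof -
  note F = far_E[OF far] far_\<kappa>[OF far] far_HP[OF far]
  let ?t = "b / \<sigma> a"
  have e: "E2 b a = \<sigma>' a * \<zeta> ?t" "E1 b a = v ?t" by (simp_all add: E2_def E1_def)
  have q: "(2::real) * A + b\<^sup>2 / (a\<^sup>2 + b\<^sup>2) = - \<beta>\<^sup>2 \<Longrightarrow>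
     2 * (A - \<beta>\<^sup>2 * (0 * x + sg * y) + \<beta>\<^sup>2 * (h + 0)) + \<beta>\<^sup>2 * (sg + y)\<^sup>2 + b\<^sup>2 / (a\<^sup>2 + b\<^sup>2)
      = \<beta>\<^sup>2 * (y\<^sup>2 + 2 * h) + \<beta>\<^sup>2 * (sg * sg - 1)" for A x y h sg
    by (simp add: algebra_simps power2_eq_square)
  show "Z11 a b = \<beta>\<^sup>2 * ((\<sigma>' a * \<zeta> ?t)\<^sup>2 + 2 * H1 a b)"
    unfolding Z11_def Y1_def s1_def F e
    by (subst q[OF V_strain(1)[OF nz]]) (simp add: sgn_sq nz)
  \<comment> \<open>The three summands come from \<open>H\<close>, from \<open>P\<close> and from
    the product of the slopes; \<open>\<xi>\<close> was defined to make them cancel.\<close>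
  have x: "\<xi>' ?t + (\<psi> ?t - ?t * \<psi>' ?t) + \<zeta> ?t * v ?t = 0" by (simp add: \<xi>'_def)
  have "Z12 a b = (V2 a b + V2 b a - a * b / (a\<^sup>2 + b\<^sup>2)) + \<beta>\<^sup>2 * (sgn a * sgn b)
      + \<beta>\<^sup>2 * \<sigma>' a * (\<xi>' ?t + (\<psi> ?t - ?t * \<psi>' ?t) + \<zeta> ?t * v ?t)"
    unfolding Z12_def Y2_def s1_def F e unfolding H2_def P1_def by (simp add: algebra_simps)
  then show "Z12 a b = 0" unfolding x V_strain(2)[OF nz] by simp
  have "Z11 b a = (2 * V1 b a + a\<^sup>2 / (b\<^sup>2 + a\<^sup>2)) + \<beta>\<^sup>2 * (2 * \<psi>' ?t + (v ?t)\<^sup>2)"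
    unfolding Z11_def Y1_def s1_def F e unfolding P2_def by (simp add: algebra_simps)
  also have "2 * \<psi>' ?t + (v ?t)\<^sup>2 = 1" by (simp add: \<psi>'_def field_simps)
  finally show "Z11 b a = 0" using V_strain(1)[OF nz(2,1)] by simp
qed

text \<open>The longitudinal strain left over at either kind of fold. Every summand contains
  \<sigma>'^2 or \<sigma> \<sigma>'', both of order \<eta>/\<sigma>; the constant is 36 + 2 (24 +
  20).\<close>

lemma crease_strain_bound:
  assumes a: "\<bar>a\<bar> \<le> 1"
  shows "\<bar>(\<sigma>' a * \<zeta> t)\<^sup>2 + 2 * (((\<sigma>' a)\<^sup>2 + \<sigma> a * \<sigma>'' a) * \<xi> t - (\<sigma>' a)\<^sup>2 * (t * \<xi>' t))\<bar> \<le> 124 * K\<^sup>2 * (\<eta> / \<sigma> a)"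
proof -
  define z where z_eq: "z = \<eta> / \<sigma> a"
  note S = \<sigma>_bounds[OF a]
  have z: "0 \<le> z" unfolding z_eq using \<eta>_pos \<sigma>_pos[of a] by (intro divide_nonneg_pos) auto
  have s2: "\<bar>(\<sigma>' a)\<^sup>2\<bar> \<le> 4 * z" using S(1) by (simp add: z_eq)
  have S2: "\<bar>\<sigma> a * \<sigma>'' a\<bar> \<le> 20 * z" using S(2) by (simp add: z_eq)
  have "\<bar>\<zeta> t * \<zeta> t\<bar> \<le> 3 * K * (3 * K)" by (intro abs_mult_le bounds')
  from abs_mult_le[OF s2 this]
  have 1: "\<bar>(\<sigma>' a * \<zeta> t)\<^sup>2\<bar> \<le> 4 * z * (3 * K * (3 * K))" by (simp add: power_mult_distrib power2_eq_square[of "\<zeta> t"])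
  have 2: "\<bar>((\<sigma>' a)\<^sup>2 + \<sigma> a * \<sigma>'' a) * \<xi> t\<bar> \<le> (4 * z + 20 * z) * K"
    by (intro abs_mult_le abs_add_le s2 S2 bounds)
  have 3: "\<bar>(\<sigma>' a)\<^sup>2 * (t * \<xi>' t)\<bar> \<le> 4 * z * (5 * K\<^sup>2)" by (intro abs_mult_le s2 bounds')
  have two: "\<bar>2::real\<bar> \<le> 2" by simp
  have kz: "z * K \<le> z * K\<^sup>2" using K_powers(1) z by (rule mult_left_mono)
  show ?thesis unfolding z_eq[symmetric]
    by (rule order_trans[OF abs_add_le(1)[OF 1 abs_mult_le[OF two abs_add_le(2)[OF 2 3]]]])
      (use kz in \<open>simp add: algebra_simps power2_eq_square\<close>)
qed

text \<open>Put q = \<beta> (|a| + |b| - 1/2). Off the axes da and dq are constant covectors, so it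
  does not matter that these coordinates are neither orthogonal nor of unit length. The gradient of
  \<open>w\<close> is -(v dq + \<sigma>' \<zeta> da) and the added displacement is \<sigma> \<psi>
  dq + \<sigma> \<sigma>' \<xi> da. The cancellations are those at an axis fold, and the residue, a
  multiple of the square of da, appears in \<open>S11\<close> alone.\<close>

lemma rim_strain:
  assumes nz: "a \<noteq> 0" "b \<noteq> 0" and far: "\<not> \<bar>a\<bar> < \<sigma> b" "\<not> \<bar>b\<bar> < \<sigma> a"
  defines "t \<equiv> T a b"
  shows "S11 a b = (\<sigma>' a * \<zeta> t)\<^sup>2 + 2 * (((\<sigma>' a)\<^sup>2 + \<sigma> a * \<sigma>'' a) * \<xi> t - (\<sigma>' a)\<^sup>2 * (t * \<xi>' t))"
    "S12 a b = 0" "S22 a b = 0"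
proof -
  note F = far_E[OF far(1)] far_E[OF far(2)] far_\<kappa>[OF far(1)] far_\<kappa>[OF far(2)]
    far_HP[OF far(1)] far_HP[OF far(2)]
  have v: "v (b / \<sigma> a) = sgn b" "v' (b / \<sigma> a) = 0"
    using fold_profile.far(2,3)[OF fold_profile_axioms outside[OF far(2)]] \<sigma>_pos[of a] by (simp_all add: sgn_divide)
  have s: "s1 a b = sgn a" "s1 b a = sgn b" by (simp_all add: s1_def F)
  have Y: "Y1 a b = V1 a b" "Y1 b a = V1 b a" "Y2 a b = V2 a b" "Y2 b a = V2 b a"
    by (simp_all add: Y1_def Y2_def F)
  have T: "\<sigma> a * T1 a b = \<beta> * sgn a - t * \<sigma>' a" "\<sigma> a * T2 a b = \<beta> * sgn b"
    by (simp_all add: T1_def T2_def s t_def)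
  have x: "\<xi>' t + (\<psi> t - t * \<psi>' t) + \<zeta> t * v t = 0" by (simp add: \<xi>'_def)
  have g: "2 * \<psi>' t + (v t)\<^sup>2 = 1" by (simp add: \<psi>'_def field_simps)
  have R1: "R1 a b = \<beta> * (\<sigma>' a * \<psi> t * sgn a + \<psi>' t * (\<beta> * sgn a - t * \<sigma>' a) * sgn a)
     + ((\<sigma>' a)\<^sup>2 + \<sigma> a * \<sigma>'' a) * \<xi> t + \<sigma>' a * \<xi>' t * (\<beta> * sgn a - t * \<sigma>' a)"
    unfolding R1_def F T(1)[symmetric] by (simp add: t_def mult_ac)
  have R2: "R2 a b = \<beta> * (\<psi>' t * (\<beta> * sgn b) * sgn a) + \<sigma>' a * \<xi>' t * (\<beta> * sgn b)"
    unfolding R2_def F T(2)[symmetric] by (simp add: t_def mult_ac)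
  have Q1: "Q1 a b = \<beta> * (\<sigma>' a * \<psi> t * sgn b + \<psi>' t * (\<beta> * sgn a - t * \<sigma>' a) * sgn b)"
    unfolding Q1_def v T(1)[symmetric] by (simp add: t_def mult_ac)
  have Q2: "Q2 a b = \<beta> * (\<psi>' t * (\<beta> * sgn b) * sgn b)"
    unfolding Q2_def v T(2)[symmetric] by (simp add: t_def mult_ac)
  have sq: "sgn a * (sgn a * z) = z" "sgn b * (sgn b * z) = z" for z
    using sgn_sq[OF nz(1)] sgn_sq[OF nz(2)] by (simp_all add: mult.assoc[symmetric])
  have "S11 a b = (2 * V1 a b + b\<^sup>2 / (a\<^sup>2 + b\<^sup>2)) + \<beta>\<^sup>2 * (2 * \<psi>' t + (v t)\<^sup>2) * (sgn a * sgn a)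
     + 2 * \<beta> * \<sigma>' a * sgn a * (\<xi>' t + (\<psi> t - t * \<psi>' t * (sgn a * sgn a)) + \<zeta> t * v t)
     + ((\<sigma>' a * \<zeta> t)\<^sup>2 + 2 * (((\<sigma>' a)\<^sup>2 + \<sigma> a * \<sigma>'' a) * \<xi> t - (\<sigma>' a)\<^sup>2 * (t * \<xi>' t)))"
    unfolding S11_def Y R1 w1_def s t_def[symmetric] by (simp add: algebra_simps power2_eq_square sq nz)
  then show "S11 a b = (\<sigma>' a * \<zeta> t)\<^sup>2 + 2 * (((\<sigma>' a)\<^sup>2 + \<sigma> a * \<sigma>'' a) * \<xi> t - (\<sigma>' a)\<^sup>2 * (t * \<xi>' t))"
    unfolding sgn_sq[OF nz(1)] mult_1_right x g V_strain(1)[OF nz] by simp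
  have "S12 a b = (V2 a b + V2 b a - a * b / (a\<^sup>2 + b\<^sup>2)) + \<beta>\<^sup>2 * (2 * \<psi>' t + (v t)\<^sup>2) * (sgn a * sgn b)
     + \<beta> * \<sigma>' a * sgn b * (\<xi>' t + (\<psi> t - t * \<psi>' t) + \<zeta> t * v t)"
    unfolding S12_def Y R2 Q1 w1_def w2_def s t_def[symmetric] by (simp add: algebra_simps power2_eq_square)
  then show "S12 a b = 0" unfolding x g V_strain(2)[OF nz] by simp
  have "S22 a b = (2 * V1 b a + a\<^sup>2 / (b\<^sup>2 + a\<^sup>2)) + \<beta>\<^sup>2 * (2 * \<psi>' t + (v t)\<^sup>2) * (sgn b * sgn b)"
    unfolding S22_def Y Q2 w2_def s t_def[symmetric] by (simp add: algebra_simps power2_eq_square)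
  then show "S22 a b = 0" unfolding g sgn_sq[OF nz(2)] V_strain(1)[OF nz(2,1)] by simp
qed

text \<open>For |T| \<ge> 1 the slopes of \<open>w\<close> are those of \<open>\<beta> * s\<close>
  up to a common sign, which drops out of all products of two slopes: the reflection costs
  nothing.\<close>

lemma off_rim_strain:
  assumes "\<not> \<bar>T a b\<bar> < 1"
  shows "S11 a b = Z11 a b" "S12 a b = Z12 a b" "S22 a b = Z11 b a"
proof -
  have o: "1 \<le> \<bar>T a b\<bar>" using assms by simp
  have v: "v (T a b) * v (T a b) = 1" unfolding far(2)[OF o] using o by (auto intro!: sgn_sq)
  have z: "R1 a b = 0" "R2 a b = 0" "Q1 a b = 0" "Q2 a b = 0"
    by (simp_all add: R1_def R2_def Q1_def Q2_def far[OF o] far'[OF o])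
  have w: "w1 a b = - (v (T a b) * (\<beta> * s1 a b))" "w2 a b = - (v (T a b) * (\<beta> * s1 b a))"
    by (simp_all add: w1_def w2_def far'[OF o])
  have vv: "(v (T a b) * x) * (v (T a b) * y) = x * y" for x y
  proof -
    have "(v (T a b) * x) * (v (T a b) * y) = (v (T a b) * v (T a b)) * (x * y)" by (simp only: mult_ac)
    then show ?thesis using v by simp
  qed
  have ww: "(w1 a b)\<^sup>2 = \<beta>\<^sup>2 * (s1 a b)\<^sup>2" "w1 a b * w2 a b = \<beta>\<^sup>2 * (s1 a b * s1 b a)"
     "(w2 a b)\<^sup>2 = \<beta>\<^sup>2 * (s1 b a)\<^sup>2"
    unfolding w power2_eq_square minus_mult_minus vv by simp_all
  show "S11 a b = Z11 a b" "S12 a b = Z12 a b" "S22 a b = Z11 b a"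
    unfolding S11_def S12_def S22_def Z11_def Z12_def z ww by (simp_all add: add_ac)
qed

section \<open>Overlapping folds and the pointwise energy estimate\<close>

context
  fixes a b :: real
  assumes a: "\<bar>a\<bar> \<le> 1" and b: "\<bar>b\<bar> \<le> 1"
begin

text \<open>Here both parameters are bounded by the larger width \<open>M\<close>, so both widths
  are controlled by the vertex 0. Overlap of the two axis folds is thereby confined to the
  neighbourhood of the apex.\<close>

lemma overlap_ridges:
  assumes A: "\<bar>a\<bar> < \<sigma> b" and B: "\<bar>b\<bar> < \<sigma> a"
  shows "\<sigma> a \<le> 2 * \<eta>"
proof -
  define M where "M = max (\<sigma> a) (\<sigma> b)"
  have M: "0 \<le> M" "\<sigma> a \<le> M" "\<sigma> b \<le> M" by (auto simp: M_def le_max_iff_disj)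
  have c: "(\<sigma> x)^3 \<le> \<eta> * (\<eta>\<^sup>2 + 1 * M\<^sup>2)" if "\<bar>x\<bar> \<le> 1" "\<bar>x\<bar> \<le> M" for x
  proof -
    have "x\<^sup>2 \<le> M\<^sup>2" using power_mono[OF that(2), of 2] by simp
    then show ?thesis using width_cubed_le(1)[OF \<eta>_pos that(1)] \<eta>_pos
      by (auto elim!: order_trans intro!: mult_left_mono)
  qed
  have "M^3 \<le> \<eta> * (\<eta>\<^sup>2 + 1 * M\<^sup>2)"
    using c[OF a] c[OF b] A B M by (cases "\<sigma> a \<le> \<sigma> b") (auto simp: M_def max_def)
  then have "M \<le> 2 * 1 * \<eta>" using M by (intro cubic_bootstrap[OF \<eta>_pos]) auto
  then show ?thesis using M by simp
qed

lemma E_near: "\<bar>b\<bar> < \<sigma> a \<Longrightarrow> \<bar>E b a\<bar> \<le> 2 * K * \<sigma> a"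
proof -
  assume B: "\<bar>b\<bar> < \<sigma> a"
  show ?thesis by (rule near_bound[OF E_diff[OF a b] B K_ge_1])
qed

lemma rim_near: "\<bar>T a b\<bar> < 1 \<Longrightarrow> \<bar>s a b - 1/2\<bar> \<le> 2 * \<sigma> a"
proof -
  assume "\<bar>T a b\<bar> < 1"
  then have "\<beta> * \<bar>s a b - 1/2\<bar> < \<sigma> a"
    using \<beta>_bounds \<sigma>_pos[of a] by (simp add: T_def abs_mult abs_divide abs_of_pos)
  moreover have "(1/2) * \<bar>s a b - 1/2\<bar> \<le> \<beta> * \<bar>s a b - 1/2\<bar>" using \<beta>_bounds by (intro mult_right_mono) auto
  ultimately show ?thesis by simp
qed

text \<open>Being near both the first axis and the square forces |a| to be within 4 K \<sigma> of
  1/2. Both folds have the parameter \<open>a\<close> here, so a single width is bootstrapped, with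
  constant 4 (4 K)^2 = 64 K^2.\<close>

lemma overlap_rim:
  assumes B: "\<bar>b\<bar> < \<sigma> a" and C: "\<bar>T a b\<bar> < 1" and A: "\<not> \<bar>a\<bar> < \<sigma> b"
  shows "\<sigma> a \<le> 128 * K\<^sup>2 * \<eta>"
proof -
  have "s a b - 1/2 = (\<bar>a\<bar> - 1/2) + E b a" by (simp add: s_def far_E[OF A])
  then have "\<bar>\<bar>a\<bar> - 1/2\<bar> \<le> 2 * \<sigma> a + 2 * K * \<sigma> a" using rim_near[OF C] E_near[OF B] by linarith
  also have "\<dots> \<le> 4 * K * \<sigma> a"
    using mult_right_mono[OF K_ge_1, of "2 * \<sigma> a"] by simp
  finally have "(\<bar>a\<bar> - 1/2)\<^sup>2 \<le> (4 * K * \<sigma> a)\<^sup>2"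
    using power_mono[of "\<bar>\<bar>a\<bar> - 1/2\<bar>" "4 * K * \<sigma> a" 2] by simp
  then have "(\<sigma> a)^3 \<le> \<eta> * (\<eta>\<^sup>2 + 4 * (4 * K * \<sigma> a)\<^sup>2)"
    using width_cubed_le(2)[OF \<eta>_pos a] \<eta>_pos by (auto elim!: order_trans intro!: mult_left_mono)
  also have "\<dots> = \<eta> * (\<eta>\<^sup>2 + (64 * K\<^sup>2) * (\<sigma> a)\<^sup>2)" by (simp add: power_mult_distrib)
  finally have "\<sigma> a \<le> 2 * (64 * K\<^sup>2) * \<eta>"
    using K_ge_1 \<sigma>_pos[of a] by (intro cubic_bootstrap[OF \<eta>_pos]) (auto intro: order_trans[of 1 "K\<^sup>2"])
  then show ?thesis by simp
qed

text \<open>The square is parametrized by \<open>a\<close> throughout. At its corners on the second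
  axis its parameter is near the vertex 0, while the parameter \<open>b\<close> of the axis fold is
  near 1/2 or -1/2. The two widths are different quantities, each hypothesis involves one of them,
  and so their maximum is bootstrapped.\<close>

lemma overlap_rim':
  assumes A: "\<bar>a\<bar> < \<sigma> b" and C: "\<bar>T a b\<bar> < 1" and B: "\<not> \<bar>b\<bar> < \<sigma> a"
  shows "\<sigma> b \<le> 128 * K\<^sup>2 * \<eta>"
proof -
  define M where "M = max (\<sigma> a) (\<sigma> b)"
  have M: "0 \<le> M" "\<sigma> a \<le> M" "\<sigma> b \<le> M" by (auto simp: M_def le_max_iff_disj)
  have K2: "1 \<le> 64 * K\<^sup>2" using K_ge_1 by (auto intro: order_trans[of 1 "K\<^sup>2"])
  have Eab: "\<bar>E a b\<bar> \<le> 2 * K * \<sigma> b" by (rule near_bound[OF E_diff[OF b a] A K_ge_1])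
  have "s a b - 1/2 = (\<bar>b\<bar> - 1/2) + E a b" by (simp add: s_def far_E[OF B])
  then have "\<bar>\<bar>b\<bar> - 1/2\<bar> \<le> 2 * \<sigma> a + 2 * K * \<sigma> b" using rim_near[OF C] Eab by linarith
  also have "\<dots> \<le> 2 * M + 2 * K * M" using M K_ge_1 by (intro add_mono mult_left_mono) auto
  also have "\<dots> \<le> 4 * K * M" using mult_right_mono[OF K_ge_1, of "2 * M"] M by simp
  finally have "(\<bar>b\<bar> - 1/2)\<^sup>2 \<le> (4 * K * M)\<^sup>2"
    using power_mono[of "\<bar>\<bar>b\<bar> - 1/2\<bar>" "4 * K * M" 2] by simp
  then have "(\<sigma> b)^3 \<le> \<eta> * (\<eta>\<^sup>2 + 4 * (4 * K * M)\<^sup>2)"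
    using width_cubed_le(2)[OF \<eta>_pos b] \<eta>_pos by (auto elim!: order_trans intro!: mult_left_mono)
  also have "\<dots> = \<eta> * (\<eta>\<^sup>2 + (64 * K\<^sup>2) * M\<^sup>2)" by (simp add: power_mult_distrib)
  finally have 1: "(\<sigma> b)^3 \<le> \<eta> * (\<eta>\<^sup>2 + (64 * K\<^sup>2) * M\<^sup>2)" .
  have "\<bar>a\<bar> \<le> M" using A M by simp
  then have "a\<^sup>2 \<le> 1 * M\<^sup>2" using power_mono[of "\<bar>a\<bar>" M 2] by simp
  also have "\<dots> \<le> (64 * K\<^sup>2) * M\<^sup>2" using K2 by (rule mult_right_mono) simp
  finally have 2: "(\<sigma> a)^3 \<le> \<eta> * (\<eta>\<^sup>2 + (64 * K\<^sup>2) * M\<^sup>2)"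
    using width_cubed_le(1)[OF \<eta>_pos a] \<eta>_pos by (auto elim!: order_trans intro!: mult_left_mono)
  have "M^3 \<le> \<eta> * (\<eta>\<^sup>2 + (64 * K\<^sup>2) * M\<^sup>2)"
    using 1 2 by (cases "\<sigma> a \<le> \<sigma> b") (auto simp: M_def max_def)
  then have "M \<le> 2 * (64 * K\<^sup>2) * \<eta>" using M K2 by (intro cubic_bootstrap[OF \<eta>_pos]) auto
  then show ?thesis using M by simp
qed

text \<open>Where one fold is active, the exact identities leave one strain component of order
  \<eta>/\<sigma>; where two overlap, \<eta>/\<sigma> is bounded below and the uniform bound
  suffices. The last conjunct lets the bending be charged to \<open>inv_scale\<close>, whose term
  \<open>crease\<close> refers to the exact square and is easier to integrate than
  \<open>rim\<close>.\<close>

lemma density_bounds: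
  assumes nz: "a \<noteq> 0" "b \<noteq> 0"
  defines "m \<equiv> 130000 * K^6 * (\<eta> * inv_scale a b)"
  shows "\<bar>S11 a b\<bar> \<le> m \<and> \<bar>S12 a b\<bar> \<le> m \<and> \<bar>S22 a b\<bar> \<le> m \<and> \<eta> * rim a b \<le> m"
proof -
  have Kp: "1 \<le> K\<^sup>2" "1 \<le> K^4" "1 \<le> K^6" "K\<^sup>2 \<le> K^6" "K^4 * K\<^sup>2 = K^6"
    using K_ge_1 by (auto simp: power_increasing power_add[symmetric])
  have en: "0 \<le> crease a b" by (simp add: crease_def less_imp_le[OF \<sigma>_pos])
  have sc: "strip a b \<le> inv_scale a b" "strip b a \<le> inv_scale a b" "crease a b \<le> inv_scale a b" "0 \<le> inv_scale a b"
    using strip_nonneg[of a b] strip_nonneg[of b a] en by (auto simp: inv_scale_def)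
  have m: "c * (\<eta> * x) \<le> m" if "c \<le> 130000 * K^6" "x \<le> inv_scale a b" "0 \<le> x" "0 \<le> c" for c x
    unfolding m_def using that \<eta>_pos by (intro mult_mono) auto
  have m0: "0 \<le> m" using m[of 0 0] sc Kp by simp
  \<comment> \<open>All overlaps at once: a width of at most 128 K^2 \<eta> turns the uniform bound
    1000 K^4 into 128000 K^6 \<eta>/\<sigma>.\<close>
  have over: ?thesis if "\<sigma> x \<le> 128 * K\<^sup>2 * \<eta>" "1 / \<sigma> x \<le> inv_scale a b" for x
  proof -
    have "1 \<le> 128 * K\<^sup>2 * (\<eta> * (1 / \<sigma> x))" using that(1) \<sigma>_pos[of x] by simp
    then have 1: "1000 * K^4 * 1 \<le> 1000 * K^4 * (128 * K\<^sup>2 * (\<eta> * (1 / \<sigma> x)))"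
      using Kp by (intro mult_left_mono) auto
    also have "\<dots> = 128000 * K^6 * (\<eta> * (1 / \<sigma> x))" using Kp(5) by (simp add: mult_ac)
    also have "\<dots> \<le> m" using that(2) \<sigma>_pos[of x] Kp by (intro m) auto
    finally have 2: "1000 * K^4 \<le> m" by simp
    have "\<eta> * rim a b \<le> 1" using \<sigma>_ge[of a] \<sigma>_pos[of a] by (simp add: rim_def)
    then have "\<eta> * rim a b \<le> m" using 2 Kp by linarith
    then show ?thesis using strain_bounds[OF a b] 2 by auto
  qed
  have st: "strip b a = 1 / \<sigma> a" if "\<bar>b\<bar> < \<sigma> a" using that by (simp add: strip_def)
  have st': "strip a b = 1 / \<sigma> b" if "\<bar>a\<bar> < \<sigma> b" using that by (simp add: strip_def)
  have k2: "2 * \<eta> \<le> 128 * K\<^sup>2 * \<eta>" using Kp \<eta>_pos by (intro mult_right_mono) auto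
  have \<beta>2: "\<bar>\<beta>\<^sup>2\<bar> \<le> 1" using pi_less_4 by (simp add: \<beta>_sq)
  \<comment> \<open>The first three cases are overlaps and are charged to an axis strip, because
    \<open>rim\<close> and \<open>crease\<close> may differ there. Case \<open>B\<close> also
    contains the points outside all folds.\<close>
  consider (AB) "\<bar>a\<bar> < \<sigma> b" "\<bar>b\<bar> < \<sigma> a" | (BC) "\<bar>b\<bar> < \<sigma> a" "\<bar>T a b\<bar> < 1" "\<not> \<bar>a\<bar> < \<sigma> b"
    | (AC) "\<bar>a\<bar> < \<sigma> b" "\<bar>T a b\<bar> < 1" "\<not> \<bar>b\<bar> < \<sigma> a"
    | (B) "\<not> \<bar>a\<bar> < \<sigma> b" "\<not> \<bar>T a b\<bar> < 1"
    | (A) "\<bar>a\<bar> < \<sigma> b" "\<not> \<bar>b\<bar> < \<sigma> a" "\<not> \<bar>T a b\<bar> < 1"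
    | (C) "\<not> \<bar>a\<bar> < \<sigma> b" "\<not> \<bar>b\<bar> < \<sigma> a" "\<bar>T a b\<bar> < 1" by blast
  then show ?thesis
  proof cases
    case AB
    then show ?thesis using over[OF order_trans[OF overlap_ridges[OF AB] k2]] st[OF AB(2)] sc(2) by simp
  next
    case BC
    then show ?thesis using over[OF overlap_rim[OF BC]] st[OF BC(1)] sc(2) by simp
  next
    case AC
    then show ?thesis using over[OF overlap_rim'[OF AC]] st'[OF AC(1)] sc(1) by simp
  next
    case B
    have "\<bar>Z11 a b\<bar> \<le> 1 * (124 * K\<^sup>2 * (\<eta> / \<sigma> a))"
      unfolding ridge_strain(1)[OF nz B(1)] H1_def by (intro abs_mult_le \<beta>2 crease_strain_bound a)
    moreover have "Z11 a b = 0" if "\<not> \<bar>b\<bar> < \<sigma> a"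
      unfolding ridge_strain(1)[OF nz B(1)] using far_HP[OF that] far'[OF outside[OF that]] by simp
    ultimately have "\<bar>Z11 a b\<bar> \<le> 124 * K\<^sup>2 * (\<eta> * strip b a)" by (cases "\<bar>b\<bar> < \<sigma> a") (auto simp: strip_def)
    also have "\<dots> \<le> m" using sc strip_nonneg Kp by (intro m) auto
    finally show ?thesis using off_rim_strain[OF B(2)] ridge_strain(2,3)[OF nz B(1)] B(2) m0 by (simp add: rim_def)
  next
    case A
    have "\<bar>Z11 b a\<bar> \<le> 1 * (124 * K\<^sup>2 * (\<eta> / \<sigma> b))"
      unfolding ridge_strain(1)[OF nz(2,1) A(2)] H1_def by (intro abs_mult_le \<beta>2 crease_strain_bound b)
    also have "\<dots> = 124 * K\<^sup>2 * (\<eta> * strip a b)" using A(1) by (simp add: strip_def)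
    also have "\<dots> \<le> m" using sc strip_nonneg Kp by (intro m) auto
    finally have "\<bar>Z11 b a\<bar> \<le> m" .
    moreover have "Z12 a b = Z12 b a" by (simp add: Z12_def mult_ac add_ac)
    ultimately show ?thesis
      using off_rim_strain[OF A(3)] ridge_strain(2,3)[OF nz(2,1) A(2)] A(3) m0 by (simp add: rim_def)
  next
    case C
    have "T a b = \<beta> * (\<bar>a\<bar> + \<bar>b\<bar> - 1/2) / \<sigma> a" by (simp add: T_def s_def far_E[OF C(1)] far_E[OF C(2)])
    then have e: "crease a b = 1 / \<sigma> a" using C(3) \<beta>_bounds \<sigma>_pos[of a]
      by (simp add: crease_def abs_mult abs_divide abs_of_pos)
    have "\<bar>S11 a b\<bar> \<le> 124 * K\<^sup>2 * (\<eta> / \<sigma> a)"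
      unfolding rim_strain(1)[OF nz C(1,2)] by (intro crease_strain_bound a)
    also have "\<dots> = 124 * K\<^sup>2 * (\<eta> * crease a b)" using e by simp
    also have "\<dots> \<le> m" using sc en Kp by (intro m) auto
    finally have 1: "\<bar>S11 a b\<bar> \<le> m" .
    have "\<eta> * rim a b = 1 * (\<eta> * crease a b)" using C(3) e by (simp add: rim_def)
    also have "\<dots> \<le> m" using sc en Kp by (intro m) auto
    finally show ?thesis using 1 rim_strain(2,3)[OF nz C(1,2)] m0 by simp
  qed
qed

end

end

section \<open>Admissibility and energy\<close>

lemma vec_nth_measurable [measurable]: "(\<lambda>x::real^2. x $ i) \<in> borel_measurable borel"
  by (intro borel_measurable_continuous_onI continuous_intros)

lemma W12_ballI:
  fixes f :: "real^2 \<Rightarrow> real" and g :: "2 \<Rightarrow> real^2 \<Rightarrow> real"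
  assumes cont: "continuous_on UNIV f" and meas: "\<And>i. g i \<in> borel_measurable borel"
    and bound: "\<And>i x. x \<in> ball 0 1 \<Longrightarrow> \<bar>g i x\<bar> \<le> M"
    and der: "\<And>i x. x $ i \<noteq> 0 \<Longrightarrow> ((\<lambda>t. f (x + t *\<^sub>R axis i 1)) has_real_derivative g i x) (at 0)"
  shows "W12 (ball 0 1) f g"
proof -
  have "compact (f ` cball 0 1)"
    using cont by (intro compact_continuous_image) (auto intro: continuous_on_subset)
  then obtain N where "\<forall>x\<in>cball 0 1. \<bar>f x\<bar> \<le> N" by (auto dest!: compact_imp_bounded simp: bounded_iff)
  then have "L2_on (ball 0 1) f"
    by (intro L2_on_ball_bounded[of _ N] borel_measurable_continuous_onI cont) auto
  then show ?thesis
    unfolding W12_def using assms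
    by (auto intro!: L2_on_ball_bounded[of _ M] weak_partial_ballI[of _ _ M])
qed

lemma DERIV_along_axis:
  fixes F :: "real \<Rightarrow> real \<Rightarrow> real" and x :: "real^2"
  shows "((\<lambda>a. F a (x $ 2)) has_real_derivative D) (at (x $ 1)) \<Longrightarrow>
      ((\<lambda>t. F ((x + t *\<^sub>R axis 1 1) $ 1) ((x + t *\<^sub>R axis 1 1) $ 2)) has_real_derivative D) (at 0)"
    "((\<lambda>b. F (x $ 1) b) has_real_derivative D) (at (x $ 2)) \<Longrightarrow>
      ((\<lambda>t. F ((x + t *\<^sub>R axis 2 1) $ 1) ((x + t *\<^sub>R axis 2 1) $ 2)) has_real_derivative D) (at 0)"
  using DERIV_shift[of "\<lambda>a. F a (x $ 2)" D 0 "x $ 1"] DERIV_shift[of "\<lambda>b. F (x $ 1) b" D 0 "x $ 2"]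
  by (simp_all add: axis_def add.commute)

lemma W12_planarI:
  fixes F :: "real \<Rightarrow> real \<Rightarrow> real"
  assumes "continuous_on UNIV (\<lambda>x::real^2. F (x $ 1) (x $ 2))"
    and "(\<lambda>x::real^2. Fa (x $ 1) (x $ 2)) \<in> borel_measurable borel"
      "(\<lambda>x::real^2. Fb (x $ 1) (x $ 2)) \<in> borel_measurable borel"
    and "\<And>a b. \<bar>a\<bar> \<le> 1 \<Longrightarrow> \<bar>b\<bar> \<le> 1 \<Longrightarrow> \<bar>Fa a b\<bar> \<le> M" "\<And>a b. \<bar>a\<bar> \<le> 1 \<Longrightarrow> \<bar>b\<bar> \<le> 1 \<Longrightarrow> \<bar>Fb a b\<bar> \<le> M"
    and "\<And>a b. a \<noteq> 0 \<Longrightarrow> ((\<lambda>a. F a b) has_real_derivative Fa a b) (at a)"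
      "\<And>a b. b \<noteq> 0 \<Longrightarrow> ((\<lambda>b. F a b) has_real_derivative Fb a b) (at b)"
  shows "W12 (ball 0 1) (\<lambda>x. F (x $ 1) (x $ 2)) (\<lambda>i x. if i = 1 then Fa (x $ 1) (x $ 2) else Fb (x $ 1) (x $ 2))"
proof (rule W12_ballI[where M = M])
  have c: "\<bar>x $ i\<bar> \<le> 1" if "x \<in> ball 0 1" for x :: "real^2" and i
    using that component_le_norm_cart[of x i] by simp
  show "\<bar>if i = 1 then Fa (x $ 1) (x $ 2) else Fb (x $ 1) (x $ 2)\<bar> \<le> M" if "x \<in> ball 0 1" for i :: 2 and x :: "real^2"
    using assms(4,5)[OF c[OF that] c[OF that]] by simp
  show "(\<lambda>x::real^2. if i = 1 then Fa (x $ 1) (x $ 2) else Fb (x $ 1) (x $ 2)) \<in> borel_measurable borel" for i :: 2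
    using assms(2,3) by (cases "i = 1") auto
  show "((\<lambda>t. F ((x + t *\<^sub>R axis i 1) $ 1) ((x + t *\<^sub>R axis i 1) $ 2)) has_real_derivative
      (if i = 1 then Fa (x $ 1) (x $ 2) else Fb (x $ 1) (x $ 2))) (at 0)" if "x $ i \<noteq> 0" for i :: 2 and x :: "real^2"
  proof -
    consider "i = 1" | "i = 2" using exhaust_2 by blast
    then show ?thesis
    proof cases
      case 1
      then show ?thesis using DERIV_along_axis(1)[OF assms(6)] that by simp
    next
      case 2
      then show ?thesis using DERIV_along_axis(2)[OF assms(7)] that by simp
    qed
  qed
qed (rule assms(1))

context folded_cone
begin

section \<open>The competitor and its Sobolev regularity\<close>

definition "disp x = (\<chi> k::2. if k = 1 then Y (x $ 1) (x $ 2) + R (x $ 1) (x $ 2) else Y (x $ 2) (x $ 1) + Q (x $ 1) (x $ 2))"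
  for x :: "real^2"
definition "grad_disp k i x = (if k = 1
   then (if i = 1 then Y1 (x $ 1) (x $ 2) + R1 (x $ 1) (x $ 2) else Y2 (x $ 1) (x $ 2) + R2 (x $ 1) (x $ 2))
   else (if i = 1 then Y2 (x $ 2) (x $ 1) + Q1 (x $ 1) (x $ 2) else Y1 (x $ 2) (x $ 1) + Q2 (x $ 1) (x $ 2)))"
  for k i :: 2 and x :: "real^2"
definition "height x = w (x $ 1) (x $ 2) - w 0 0" for x :: "real^2"
definition "grad_height i x = (if i = 1 then w1 (x $ 1) (x $ 2) else w2 (x $ 1) (x $ 2))" for i :: 2 and x :: "real^2"
definition "hess_height i j x = (if i = 1
   then (if j = 1 then w11 (x $ 1) (x $ 2) else w12 (x $ 1) (x $ 2))
   else (if j = 1 then w21 (x $ 1) (x $ 2) else w22 (x $ 1) (x $ 2)))"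
  for i j :: 2 and x :: "real^2"

lemma vec_cont: "continuous_on UNIV (\<lambda>x::real^2. x $ i)"
  by (intro continuous_intros)

lemma W12_disp: "W12_vec (ball 0 1) disp grad_disp"
  unfolding W12_vec_def
proof
  fix k :: 2
  have B: "\<bar>X + Z\<bar> \<le> 260 * K^4" if "\<bar>X\<bar> \<le> 60 * K\<^sup>2" "\<bar>Z\<bar> \<le> 200 * K^4" for X Z
    using abs_add_le(1)[OF that] K_powers by argo
  note meas = measurable_derivatives[of "\<lambda>x::real^2. x $ 1" borel "\<lambda>x. x $ 2", OF vec_nth_measurable vec_nth_measurable]
  consider "k = 1" | "k = 2" using exhaust_2 by blast
  then show "W12 (ball 0 1) (\<lambda>x. disp x $ k) (grad_disp k)"
  proof cases
    case 1
    have "W12 (ball 0 1) (\<lambda>x::real^2. Y (x $ 1) (x $ 2) + R (x $ 1) (x $ 2))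
      (\<lambda>i x. if i = 1 then Y1 (x $ 1) (x $ 2) + R1 (x $ 1) (x $ 2) else Y2 (x $ 1) (x $ 2) + R2 (x $ 1) (x $ 2))"
      by (rule W12_planarI[where F = "\<lambda>a b. Y a b + R a b" and Fa = "\<lambda>a b. Y1 a b + R1 a b"
            and Fb = "\<lambda>a b. Y2 a b + R2 a b" and M = "260 * K^4"])
        (intro continuous_on_u vec_cont meas B Y_bounds RQ_bounds DERIV_add Y_der R_der; assumption)+
    then show ?thesis using 1 by (simp add: disp_def grad_disp_def[abs_def])
  next
    case 2
    have "W12 (ball 0 1) (\<lambda>x::real^2. Y (x $ 2) (x $ 1) + Q (x $ 1) (x $ 2))
      (\<lambda>i x. if i = 1 then Y2 (x $ 2) (x $ 1) + Q1 (x $ 1) (x $ 2) else Y1 (x $ 2) (x $ 1) + Q2 (x $ 1) (x $ 2))"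
      by (rule W12_planarI[where F = "\<lambda>a b. Y b a + Q a b" and Fa = "\<lambda>a b. Y2 b a + Q1 a b"
            and Fb = "\<lambda>a b. Y1 b a + Q2 a b" and M = "260 * K^4"])
        (intro continuous_on_u vec_cont meas B Y_bounds RQ_bounds DERIV_add Y_der Q_der; assumption)+
    then show ?thesis using 2 by (simp add: disp_def grad_disp_def[abs_def])
  qed
qed

lemma height_cont: "continuous_on UNIV height"
  unfolding height_def[abs_def] by (intro continuous_intros continuous_on_w)

text \<open>A crude bound depending on \<eta>, used only to place the second derivatives in
  L^2.\<close>

lemma strip_le: "strip x y \<le> 1 / \<eta>" "rim x y \<le> 1 / \<eta>"
  using \<sigma>_ge[of y] \<sigma>_ge[of x] \<eta>_pos by (simp_all add: strip_def rim_def frac_le)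

lemma W22_height: "W22 (ball 0 1) height grad_height hess_height"
  unfolding W22_def
proof (intro conjI allI)
  note meas = measurable_derivatives[of "\<lambda>x::real^2. x $ 1" borel "\<lambda>x. x $ 2", OF vec_nth_measurable vec_nth_measurable]
  have "W12 (ball 0 1) (\<lambda>x::real^2. w (x $ 1) (x $ 2) - w 0 0)
      (\<lambda>i x. if i = 1 then w1 (x $ 1) (x $ 2) else w2 (x $ 1) (x $ 2))"
  proof (rule W12_planarI[where F = "\<lambda>a b. w a b - w 0 0" and M = "13 * K\<^sup>2"])
    show "continuous_on UNIV (\<lambda>x::real^2. w (x $ 1) (x $ 2) - w 0 0)"
      by (intro continuous_intros continuous_on_w)
    show "((\<lambda>a. w a b - w 0 0) has_real_derivative w1 a b) (at a)"
         "((\<lambda>b. w a b - w 0 0) has_real_derivative w2 a b) (at b)" for a b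
      using w_der[of a b] w_der[of b a] by (auto intro!: derivative_eq_intros)
  qed (intro meas w_first_bounds; assumption)+
  then show "W12 (ball 0 1) height grad_height"
    by (simp add: height_def[abs_def] grad_height_def[abs_def])
  fix i :: 2
  have M: "300 * K^3 * (rim a b + strip a b + strip b a) \<le> 300 * K^3 * (3 / \<eta>)" for a b
    using strip_le[of a b] strip_le[of b a] K_powers(4) by (intro mult_left_mono) auto
  note B = order_trans[OF w_second_bounds(1) M] order_trans[OF w_second_bounds(2) M]
    order_trans[OF w_second_bounds(3) M] order_trans[OF w_second_bounds(4) M]
  consider "i = 1" | "i = 2" using exhaust_2 by blast
  then show "W12 (ball 0 1) (grad_height i) (hess_height i)"
  proof cases
    case 1
    have "W12 (ball 0 1) (\<lambda>x::real^2. w1 (x $ 1) (x $ 2))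
       (\<lambda>j x. if j = 1 then w11 (x $ 1) (x $ 2) else w12 (x $ 1) (x $ 2))"
      by (rule W12_planarI[where F = w1 and M = "300 * K^3 * (3 / \<eta>)"])
        (intro continuous_on_wi vec_cont meas B w_der2; assumption)+
    then show ?thesis using 1 by (simp add: hess_height_def[abs_def] grad_height_def[abs_def])
  next
    case 2
    have "W12 (ball 0 1) (\<lambda>x::real^2. w2 (x $ 1) (x $ 2))
       (\<lambda>j x. if j = 1 then w21 (x $ 1) (x $ 2) else w22 (x $ 1) (x $ 2))"
      by (rule W12_planarI[where F = w2 and M = "300 * K^3 * (3 / \<eta>)"])
        (intro continuous_on_wi vec_cont meas B w_der2; assumption)+
    then show ?thesis using 2 by (simp add: hess_height_def[abs_def] grad_height_def[abs_def])
  qed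
qed

section \<open>Boundary values of the height\<close>

lemma \<sigma>_small:
  assumes "\<bar>t\<bar> \<le> 1" "\<eta> \<le> 1 / (1000000 * K^3)"
  shows "K * \<sigma> t \<le> 1 / 75"
proof -
  have "t\<^sup>2 \<le> 1" using assms(1) by (simp add: abs_square_le_1)
  moreover have "\<eta>\<^sup>2 \<le> 1" using \<eta>_pos \<eta>_le by (simp add: power_le_one)
  ultimately have "\<eta> * (\<eta>\<^sup>2 + t\<^sup>2) \<le> \<eta> * 2" using \<eta>_pos by (intro mult_left_mono) auto
  then have "(\<sigma> t)^3 \<le> 2 * \<eta>" using width_cubed_le(1)[OF \<eta>_pos assms(1)] by simp
  then have "(K * \<sigma> t)^3 \<le> K^3 * (2 * \<eta>)"
    unfolding power_mult_distrib using K_powers(4) by (intro mult_left_mono) auto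
  also have "\<dots> \<le> K^3 * (2 * (1 / (1000000 * K^3)))" using assms(2) K_powers(4) by (intro mult_left_mono) auto
  also have "\<dots> = 2 / 1000000" using K_powers(4) by simp
  \<comment> \<open>The threshold 1000000 for \<eta> is chosen for this inequality, since 75^3 =
    421875 < 500000.\<close>
  also have "\<dots> \<le> (1 / 75)^3" by (simp add: power_divide)
  finally show ?thesis by (rule power_le_imp_le_base[of _ 2, simplified]) auto
qed

text \<open>Three smoothing errors of at most 1/75 each: one from the square fold and one from each
  axis fold. The factor \<beta> \<le> 1 does not enlarge the latter two.\<close>

lemma w_close:
  assumes a: "\<bar>a\<bar> \<le> 1" and b: "\<bar>b\<bar> \<le> 1" and \<eta>: "\<eta> \<le> 1 / (1000000 * K^3)"
  shows "\<bar>w a b - (\<beta> / 2 - \<beta> * \<bar>\<bar>a\<bar> + \<bar>b\<bar> - 1/2\<bar>)\<bar> \<le> 1 / 25"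
proof -
  note sm = \<sigma>_small[OF a \<eta>] \<sigma>_small[OF b \<eta>]
  have "\<bar>T a b\<bar> = \<beta> * \<bar>s a b - 1/2\<bar> / \<sigma> a"
    using \<beta>_bounds by (simp add: T_def abs_mult abs_divide)
  then have "\<sigma> a * \<phi> (T a b) - \<beta> * \<bar>s a b - 1/2\<bar> = \<sigma> a * (\<phi> (T a b) - \<bar>T a b\<bar>)"
    unfolding right_diff_distrib by simp
  moreover have "\<bar>\<sigma> a * (\<phi> (T a b) - \<bar>T a b\<bar>)\<bar> \<le> \<sigma> a * K" by (intro abs_mult_le bounds) simp
  ultimately have 1: "\<bar>\<sigma> a * \<phi> (T a b) - \<beta> * \<bar>s a b - 1/2\<bar>\<bar> \<le> 1 / 75" using sm(1) by (simp add: mult.commute)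
  have "\<bar>\<bar>s a b - 1/2\<bar> - \<bar>\<bar>a\<bar> + \<bar>b\<bar> - 1/2\<bar>\<bar> \<le> \<bar>E a b - \<bar>a\<bar>\<bar> + \<bar>E b a - \<bar>b\<bar>\<bar>"
  proof -
    have "\<bar>\<bar>s a b - 1/2\<bar> - \<bar>\<bar>a\<bar> + \<bar>b\<bar> - 1/2\<bar>\<bar> \<le> \<bar>(s a b - 1/2) - (\<bar>a\<bar> + \<bar>b\<bar> - 1/2)\<bar>"
      by (rule abs_triangle_ineq3)
    also have "(s a b - 1/2) - (\<bar>a\<bar> + \<bar>b\<bar> - 1/2) = (E a b - \<bar>a\<bar>) + (E b a - \<bar>b\<bar>)" by (simp add: s_def)
    finally show ?thesis using abs_triangle_ineq order_trans by blast
  qed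
  also have "\<dots> \<le> 1 / 75 + 1 / 75"
    by (intro add_mono order_trans[OF E_diff[OF b a] sm(2)] order_trans[OF E_diff[OF a b] sm(1)])
  finally have 2: "\<bar>\<bar>s a b - 1/2\<bar> - \<bar>\<bar>a\<bar> + \<bar>b\<bar> - 1/2\<bar>\<bar> \<le> 2 / 75" by simp
  have "\<bar>\<beta>\<bar> \<le> 1" using \<beta>_bounds by simp
  from abs_mult_le[OF this 2] have 2: "\<bar>\<beta> * \<bar>s a b - 1/2\<bar> - \<beta> * \<bar>\<bar>a\<bar> + \<bar>b\<bar> - 1/2\<bar>\<bar> \<le> 2 / 75"
    by (simp only: right_diff_distrib)
  have "w a b - (\<beta> / 2 - \<beta> * \<bar>\<bar>a\<bar> + \<bar>b\<bar> - 1/2\<bar>) = - ((\<sigma> a * \<phi> (T a b) - \<beta> * \<bar>s a b - 1/2\<bar>)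
      + (\<beta> * \<bar>s a b - 1/2\<bar> - \<beta> * \<bar>\<bar>a\<bar> + \<bar>b\<bar> - 1/2\<bar>))" by (simp add: w_def)
  then show ?thesis using abs_add_le(1)[OF 1 2] by (simp only: abs_minus_cancel)
qed

lemma height_boundary:
  assumes \<eta>: "\<eta> \<le> 1 / (1000000 * K^3)" and x: "norm (x::real^2) = 1"
  shows "\<bar>height x\<bar> \<le> 1/2"
proof -
  define a b where "a = \<bar>x $ 1\<bar>" and "b = \<bar>x $ 2\<bar>"
  have ab: "a\<^sup>2 + b\<^sup>2 = 1" "0 \<le> a" "0 \<le> b" "a \<le> 1" "b \<le> 1"
    using x component_le_norm_cart[of x 1] component_le_norm_cart[of x 2]
    by (auto simp: a_def b_def norm_real2 real_sqrt_eq_1_iff)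
  have "1\<^sup>2 \<le> (a + b)\<^sup>2" using ab by (simp add: power2_sum)
  then have lo: "1 \<le> a + b" by (rule power2_le_imp_le) (use ab in simp)
  have "(a + b)\<^sup>2 \<le> 2" using ab sum_squares_bound[of a b] by (simp add: power2_sum)
  then have "(a + b)\<^sup>2 \<le> (142/100)\<^sup>2" by (rule order_trans) (simp add: power2_eq_square)
  then have hi: "a + b \<le> 142/100" by (rule power2_le_imp_le) simp
  \<comment> \<open>On the circle |x_1| + |x_2| lies between 1 and sqrt 2 < 1.42. The smoothing
    error and the normalization by \<open>w 0 0\<close> add 1/25 each, and 42/100 + 2/25 =
    1/2.\<close>
  have "\<bar>\<beta> * (1 - (a + b))\<bar> \<le> 1 * (42/100)" using lo hi \<beta>_bounds by (intro abs_mult_le) auto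
  moreover have "\<beta> / 2 - \<beta> * \<bar>a + b - 1/2\<bar> = \<beta> * (1 - (a + b))" using lo by (simp add: algebra_simps)
  moreover have "\<bar>w (x $ 1) (x $ 2) - (\<beta> / 2 - \<beta> * \<bar>a + b - 1/2\<bar>)\<bar> \<le> 1 / 25"
    unfolding a_def b_def using ab by (intro w_close \<eta>) (auto simp: a_def b_def)
  moreover have "\<bar>w 0 0\<bar> \<le> 1 / 25" using w_close[of 0 0, OF _ _ \<eta>] by simp
  ultimately show ?thesis unfolding height_def by linarith
qed

lemma admissible_folded:
  assumes "\<eta> \<le> 1 / (1000000 * K^3)" "\<delta> \<le> 1/2"
  shows "admissible \<delta> disp height grad_disp grad_height hess_height"
  unfolding admissible_def
proof (intro conjI allI impI)
  show "continuous_on (cball 0 1) height" using height_cont by (rule continuous_on_subset) simp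
  show "\<bar>height x\<bar> \<le> 1 - \<delta>" if "norm x = 1" for x
    using height_boundary[OF assms(1) that] assms(2) by linarith
qed (simp_all add: W12_disp W22_height height_def)

section \<open>The energy density and its integral\<close>

definition "edensity h x = (\<Sum>i\<in>UNIV. \<Sum>j\<in>UNIV. (grad_disp i j x + grad_disp j i x + grad_height i x * grad_height j x
      + xperp x i * xperp x j)\<^sup>2) + h\<^sup>2 * (\<Sum>i\<in>UNIV. \<Sum>j\<in>UNIV. (hess_height i j x)\<^sup>2)"

lemma edensity_eq:
  "edensity h x = (S11 (x $ 1) (x $ 2))\<^sup>2 + 2 * (S12 (x $ 1) (x $ 2))\<^sup>2 + (S22 (x $ 1) (x $ 2))\<^sup>2
    + ((h * w11 (x $ 1) (x $ 2))\<^sup>2 + (h * w12 (x $ 1) (x $ 2))\<^sup>2 + (h * w21 (x $ 1) (x $ 2))\<^sup>2 + (h * w22 (x $ 1) (x $ 2))\<^sup>2)"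
proof -
  define a b where "a = x $ 1" and "b = x $ 2"
  have n: "(norm x)\<^sup>2 = a\<^sup>2 + b\<^sup>2" by (simp add: norm_real2 a_def b_def)
  have p: "xperp x 1 = - b / norm x" "xperp x 2 = a / norm x" by (simp_all add: xperp_def a_def b_def)
  have q: "xperp x 1 * xperp x 1 = b\<^sup>2 / (a\<^sup>2 + b\<^sup>2)" "xperp x 2 * xperp x 2 = a\<^sup>2 / (a\<^sup>2 + b\<^sup>2)"
    "xperp x 1 * xperp x 2 = - (a * b / (a\<^sup>2 + b\<^sup>2))" "xperp x 2 * xperp x 1 = - (a * b / (a\<^sup>2 + b\<^sup>2))"
    unfolding p n[symmetric] by (simp_all add: power2_eq_square)
  have "grad_disp 1 1 x + grad_disp 1 1 x + grad_height 1 x * grad_height 1 x + xperp x 1 * xperp x 1 = S11 a b"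
    "grad_disp 1 2 x + grad_disp 2 1 x + grad_height 1 x * grad_height 2 x + xperp x 1 * xperp x 2 = S12 a b"
    "grad_disp 2 1 x + grad_disp 1 2 x + grad_height 2 x * grad_height 1 x + xperp x 2 * xperp x 1 = S12 a b"
    "grad_disp 2 2 x + grad_disp 2 2 x + grad_height 2 x * grad_height 2 x + xperp x 2 * xperp x 2 = S22 a b"
    unfolding q by (simp_all add: grad_disp_def grad_height_def S11_def S12_def S22_def a_def b_def power2_eq_square)
  then show ?thesis
    unfolding edensity_def UNIV_2 a_def[symmetric] b_def[symmetric]
    by (simp add: hess_height_def a_def b_def power_mult_distrib algebra_simps)
qed

lemma edensity_le:
  assumes x: "x \<in> ball 0 1" "x $ 1 \<noteq> 0" "x $ 2 \<noteq> 0" and c: "1 \<le> c" and h: "h = c * \<eta>"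
  shows "edensity h x \<le> 4500000 * c\<^sup>2 * K^6 * (130000 * K^6 * \<eta>)\<^sup>2 *
     ((strip (x $ 1) (x $ 2))\<^sup>2 + (strip (x $ 2) (x $ 1))\<^sup>2 + (crease (x $ 1) (x $ 2))\<^sup>2)"
proof -
  define a b where ab_def: "a = x $ 1" "b = x $ 2"
  have ab: "\<bar>a\<bar> \<le> 1" "\<bar>b\<bar> \<le> 1" "a \<noteq> 0" "b \<noteq> 0"
    using x component_le_norm_cart[of x 1] component_le_norm_cart[of x 2] by (auto simp: ab_def)
  define m where "m = 130000 * K^6 * (\<eta> * inv_scale a b)"
  note D = density_bounds[OF ab, folded m_def]
  have cr: "0 \<le> crease a b" by (simp add: crease_def)
  have K6: "1 \<le> K^6" "1 \<le> K^3" using K_ge_1 by simp_all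
  have sn: "0 \<le> \<eta> * inv_scale a b"
    using \<eta>_pos strip_nonneg[of a b] strip_nonneg[of b a] cr by (simp add: inv_scale_def)
  have "1 * (\<eta> * inv_scale a b) \<le> 130000 * K^6 * (\<eta> * inv_scale a b)"
    using K6 sn by (intro mult_right_mono) auto
  then have "\<eta> * inv_scale a b \<le> m" by (simp add: m_def)
  moreover have "\<eta> * (strip a b + strip b a) \<le> \<eta> * inv_scale a b"
    using \<eta>_pos cr by (intro mult_left_mono) (auto simp: inv_scale_def)
  ultimately have "\<eta> * (rim a b + strip a b + strip b a) \<le> 2 * m"
    using D by (simp add: distrib_left)
  then have e: "c * (300 * K^3) * (\<eta> * (rim a b + strip a b + strip b a)) \<le> c * (300 * K^3) * (2 * m)"
    using K_powers(4) c by (intro mult_left_mono mult_nonneg_nonneg) auto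
  have H: "(h * y)\<^sup>2 \<le> 360000 * (c\<^sup>2 * K^6 * m\<^sup>2)" if "\<bar>y\<bar> \<le> 300 * K^3 * (rim a b + strip a b + strip b a)" for y
  proof -
    have "\<bar>h * y\<bar> \<le> c * \<eta> * (300 * K^3 * (rim a b + strip a b + strip b a))"
      using that c \<eta>_pos unfolding h by (intro abs_mult_le) auto
    also have "\<dots> \<le> c * (300 * K^3) * (2 * m)" using e by (simp add: mult_ac)
    finally have "\<bar>h * y\<bar>\<^sup>2 \<le> (c * (300 * K^3) * (2 * m))\<^sup>2" by (intro power_mono) auto
    then show ?thesis by (simp add: power_mult_distrib power_mult[symmetric] mult_ac)
  qed
  have sq: "X\<^sup>2 \<le> m\<^sup>2" if "\<bar>X\<bar> \<le> m" for X using power_mono[OF that, of 2] by simp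
  have "1 * 1 \<le> c\<^sup>2 * K^6" using c K6 by (intro mult_mono) auto
  then have "1 * m\<^sup>2 \<le> (c\<^sup>2 * K^6) * m\<^sup>2" by (intro mult_right_mono) auto
  \<comment> \<open>Four squares of strain entries, each at most m^2, and four of bending entries
    with factor 360000 = 600^2. The later factor 3 comes from the square of the three-term sum
    \<open>inv_scale\<close>.\<close>
  then have "edensity h x \<le> 1500000 * (c\<^sup>2 * K^6 * m\<^sup>2)"
    unfolding edensity_eq ab_def[symmetric] mult_1_left
  proof -
    define q where "q = c\<^sup>2 * K^6 * m\<^sup>2"
    assume mq: "m\<^sup>2 \<le> c\<^sup>2 * K^6 * m\<^sup>2"
    then have q: "0 \<le> q" "m\<^sup>2 \<le> q" by (auto simp: q_def intro: order_trans[OF zero_le_power2])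
    have S: "X\<^sup>2 \<le> q" if "\<bar>X\<bar> \<le> m" for X using sq[OF that] q by linarith
    show "(S11 a b)\<^sup>2 + 2 * (S12 a b)\<^sup>2 + (S22 a b)\<^sup>2
      + ((h * w11 a b)\<^sup>2 + (h * w12 a b)\<^sup>2 + (h * w21 a b)\<^sup>2 + (h * w22 a b)\<^sup>2) \<le> 1500000 * (c\<^sup>2 * K^6 * m\<^sup>2)"
      using S[OF D[THEN conjunct1]] S[OF D[THEN conjunct2, THEN conjunct1]]
        S[OF D[THEN conjunct2, THEN conjunct2, THEN conjunct1]] q(1)
        H[OF w_second_bounds(1)[OF ab(1,2)]] H[OF w_second_bounds(2)[OF ab(1,2)]]
        H[OF w_second_bounds(3)[OF ab(1,2)]] H[OF w_second_bounds(4)[OF ab(1,2)]]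
      unfolding q_def[symmetric] by linarith
  qed
  moreover have "m\<^sup>2 = (130000 * K^6 * \<eta>)\<^sup>2 * (inv_scale a b)\<^sup>2"
    by (simp add: m_def power_mult_distrib)
  moreover have "(inv_scale a b)\<^sup>2 \<le> 3 * ((strip a b)\<^sup>2 + (strip b a)\<^sup>2 + (crease a b)\<^sup>2)"
  proof -
    have "(p + q + r)\<^sup>2 \<le> 3 * (p\<^sup>2 + q\<^sup>2 + r\<^sup>2)" for p q r :: real
      using zero_le_power2[of "p - q"] zero_le_power2[of "p - r"] zero_le_power2[of "q - r"]
      by (simp add: power2_eq_square algebra_simps)
    then show ?thesis by (simp add: inv_scale_def)
  qed
  ultimately have "edensity h x \<le> 1500000 * (c\<^sup>2 * K^6 * ((130000 * K^6 * \<eta>)\<^sup>2 *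
      (3 * ((strip a b)\<^sup>2 + (strip b a)\<^sup>2 + (crease a b)\<^sup>2))))"
    using K6 by (auto elim!: order_trans intro!: mult_left_mono)
  also have "p * (q * y * (d * (3 * X))) = 3 * p * q * y * d * X" for p q y d X :: real by simp
  finally show ?thesis by (simp only: ab_def)
qed

lemma measurable_strip [measurable (raw)]:
  assumes [measurable]: "f \<in> borel_measurable M" "g \<in> borel_measurable M"
  shows "(\<lambda>x. strip (f x) (g x)) \<in> borel_measurable M" "(\<lambda>x. crease (f x) (g x)) \<in> borel_measurable M"
  unfolding strip_def crease_def by measurable

lemma nn_integral_inv_\<sigma>:
  "(\<integral>\<^sup>+a. ennreal (8 / \<sigma> a) * indicator {-1..1} a \<partial>lborel) \<le> ennreal (2304 * 2 powr (1/3) * \<eta> powr (-1/3))"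
proof -
  have "(\<integral>\<^sup>+a. ennreal (8 / \<sigma> a) * indicator {-1..1} a \<partial>lborel)
    = (\<integral>\<^sup>+a. ennreal 8 * (ennreal (1 / \<sigma> a) * indicator {-1..1} a) \<partial>lborel)"
  proof (rule nn_integral_cong)
    fix a
    have "ennreal (8 / \<sigma> a) = ennreal 8 * ennreal (1 / \<sigma> a)" by (subst ennreal_mult[symmetric]) auto
    then show "ennreal (8 / \<sigma> a) * indicator {-1..1} a = ennreal 8 * (ennreal (1 / \<sigma> a) * indicator {-1..1} a)"
      by (simp only: mult.assoc)
  qed
  also have "\<dots> = ennreal 8 * (\<integral>\<^sup>+a. ennreal (1 / \<sigma> a) * indicator {-1..1} a \<partial>lborel)"
    by (rule nn_integral_cmult) measurable
  also have "\<dots> \<le> ennreal 8 * ennreal (288 * 2 powr (1/3) * \<eta> powr (-1/3))"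
    by (intro mult_left_mono nn_integral_inv_width \<eta>_pos) simp
  also have "\<dots> = ennreal (2304 * 2 powr (1/3) * \<eta> powr (-1/3))"
    by (subst ennreal_mult[symmetric]) auto
  finally show ?thesis .
qed

text \<open>\<open>k a b\<close> has \<open>a\<close> along and \<open>b\<close> across a fold. The
  inner integral over the cross-section turns 1/\<sigma>^2 into 1/\<sigma>; the outer one is the
  integral of the reciprocal width. The two versions integrate first across folds along the first
  and the second axis.\<close>

lemma nn_integral_slices:
  fixes k :: "real \<Rightarrow> real \<Rightarrow> real"
  assumes [measurable]: "(\<lambda>x::real^2. k (x $ 1) (x $ 2)) \<in> borel_measurable borel"
      "(\<lambda>x::real^2. k (x $ 2) (x $ 1)) \<in> borel_measurable borel"
    and slice: "\<And>a. (\<integral>\<^sup>+b. ennreal (k a b) \<partial>lborel) \<le> ennreal (8 / \<sigma> a)"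
  shows "(\<integral>\<^sup>+x. ennreal (k (x $ 1) (x $ 2)) * indicator (ball 0 1) x \<partial>(lborel :: (real^2) measure))
      \<le> ennreal (2304 * 2 powr (1/3) * \<eta> powr (-1/3))"
    and "(\<integral>\<^sup>+x. ennreal (k (x $ 2) (x $ 1)) * indicator (ball 0 1) x \<partial>(lborel :: (real^2) measure))
      \<le> ennreal (2304 * 2 powr (1/3) * \<eta> powr (-1/3))"
proof -
  have c: "\<bar>x $ i\<bar> \<le> 1" if "x \<in> ball 0 1" for x :: "real^2" and i
    using that component_le_norm_cart[of x i] by simp
  have ind: "indicator (ball 0 1) x \<le> (indicator {-1..1} (x $ i) :: ennreal)" for x :: "real^2" and i
    using c[of x i] by (auto simp: indicator_def abs_le_iff)
  have k [measurable]: "(\<lambda>b. k a b) \<in> borel_measurable borel" for a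
    using measurable_compose[OF _ assms(1), of "\<lambda>b. pt a b" borel] by simp
  have s: "(\<integral>\<^sup>+b. ennreal (k a b) * indicator {-1..1} a \<partial>lborel) \<le> ennreal (8 / \<sigma> a) * indicator {-1..1} a" for a
    using slice[of a] by (subst nn_integral_multc) (auto intro!: mult_right_mono)
  have "(\<integral>\<^sup>+x. ennreal (k (x $ 1) (x $ 2)) * indicator (ball 0 1) x \<partial>(lborel :: (real^2) measure))
      \<le> (\<integral>\<^sup>+x. ennreal (k (x $ 1) (x $ 2)) * indicator {-1..1} (x $ 1) \<partial>(lborel :: (real^2) measure))"
    by (intro nn_integral_mono mult_left_mono ind) simp
  also have "\<dots> = (\<integral>\<^sup>+a. \<integral>\<^sup>+b. ennreal (k a b) * indicator {-1..1} a \<partial>lborel \<partial>lborel)"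
    by (subst nn_integral_real2(1)) simp_all
  also have "\<dots> \<le> (\<integral>\<^sup>+a. ennreal (8 / \<sigma> a) * indicator {-1..1} a \<partial>lborel)"
    by (intro nn_integral_mono s)
  also note nn_integral_inv_\<sigma>
  finally show "(\<integral>\<^sup>+x. ennreal (k (x $ 1) (x $ 2)) * indicator (ball 0 1) x \<partial>(lborel :: (real^2) measure))
      \<le> ennreal (2304 * 2 powr (1/3) * \<eta> powr (-1/3))" .
  have "(\<integral>\<^sup>+x. ennreal (k (x $ 2) (x $ 1)) * indicator (ball 0 1) x \<partial>(lborel :: (real^2) measure))
      \<le> (\<integral>\<^sup>+x. ennreal (k (x $ 2) (x $ 1)) * indicator {-1..1} (x $ 2) \<partial>(lborel :: (real^2) measure))"
    by (intro nn_integral_mono mult_left_mono ind) simp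
  also have "\<dots> = (\<integral>\<^sup>+a. \<integral>\<^sup>+b. ennreal (k a b) * indicator {-1..1} a \<partial>lborel \<partial>lborel)"
    by (subst nn_integral_real2(2)) simp_all
  also have "\<dots> \<le> (\<integral>\<^sup>+a. ennreal (8 / \<sigma> a) * indicator {-1..1} a \<partial>lborel)"
    by (intro nn_integral_mono s)
  also note nn_integral_inv_\<sigma>
  finally show "(\<integral>\<^sup>+x. ennreal (k (x $ 2) (x $ 1)) * indicator (ball 0 1) x \<partial>(lborel :: (real^2) measure))
      \<le> ennreal (2304 * 2 powr (1/3) * \<eta> powr (-1/3))" .
qed

lemma slice_strip: "(\<integral>\<^sup>+b. ennreal ((strip b a)\<^sup>2) \<partial>lborel) \<le> ennreal (8 / \<sigma> a)"
proof -
  have "(\<integral>\<^sup>+b. ennreal ((strip b a)\<^sup>2) \<partial>lborel) = (\<integral>\<^sup>+b. ennreal ((1 / \<sigma> a)\<^sup>2) * indicator {- \<sigma> a<..<\<sigma> a} b \<partial>lborel)"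
    by (intro nn_integral_cong) (auto simp: strip_def indicator_def abs_less_iff)
  also have "\<dots> = ennreal ((1 / \<sigma> a)\<^sup>2 * (2 * \<sigma> a))"
    by (subst nn_integral_cmult_indicator) (simp_all add: ennreal_mult'[symmetric])
  also have "(1 / \<sigma> a)\<^sup>2 * (2 * \<sigma> a) = 2 / \<sigma> a" by (simp add: power2_eq_square)
  also have "ennreal (2 / \<sigma> a) \<le> ennreal (8 / \<sigma> a)" by (intro ennreal_leI divide_right_mono) auto
  finally show ?thesis .
qed

text \<open>A line of fixed \<open>a\<close> crosses the square at up to two opposite values of
  \<open>b\<close>, giving one interval for each sign. As \<beta> \<ge> 1/2, each crossing fits into
  an interval of length 4 \<sigma>.\<close>

lemma slice_crease: "(\<integral>\<^sup>+b. ennreal ((crease a b)\<^sup>2) \<partial>lborel) \<le> ennreal (8 / \<sigma> a)"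
proof -
  let ?c = "1/2 - \<bar>a\<bar>" and ?r = "2 * \<sigma> a"
  let ?I = "{?c - ?r..?c + ?r}" and ?J = "{- ?c - ?r..- ?c + ?r}"
  have "(\<integral>\<^sup>+b. ennreal ((crease a b)\<^sup>2) \<partial>lborel) \<le> (\<integral>\<^sup>+b. ennreal ((1 / \<sigma> a)\<^sup>2) * indicator ?I b
       + ennreal ((1 / \<sigma> a)\<^sup>2) * indicator ?J b \<partial>lborel)"
  proof (rule nn_integral_mono)
    fix b
    show "ennreal ((crease a b)\<^sup>2) \<le> ennreal ((1 / \<sigma> a)\<^sup>2) * indicator ?I b + ennreal ((1 / \<sigma> a)\<^sup>2) * indicator ?J b"
    proof (cases "\<beta> * \<bar>\<bar>a\<bar> + \<bar>b\<bar> - 1/2\<bar> < \<sigma> a")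
      case True
      have "(1/2) * \<bar>\<bar>a\<bar> + \<bar>b\<bar> - 1/2\<bar> \<le> \<beta> * \<bar>\<bar>a\<bar> + \<bar>b\<bar> - 1/2\<bar>" using \<beta>_bounds by (intro mult_right_mono) auto
      then have "\<bar>\<bar>a\<bar> + \<bar>b\<bar> - 1/2\<bar> < ?r" using True by linarith
      then have "b \<in> ?I \<or> b \<in> ?J" by (cases "b \<ge> 0") auto
      then show ?thesis using True by (auto simp: crease_def indicator_def)
    next
      case False
      then show ?thesis by (simp add: crease_def)
    qed
  qed
  also have "\<dots> = ennreal ((1 / \<sigma> a)\<^sup>2 * (4 * \<sigma> a)) + ennreal ((1 / \<sigma> a)\<^sup>2 * (4 * \<sigma> a))"
    by (subst nn_integral_add) (simp_all add: nn_integral_cmult_indicator ennreal_mult'[symmetric])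
  also have "(1 / \<sigma> a)\<^sup>2 * (4 * \<sigma> a) = 4 / \<sigma> a" by (simp add: power2_eq_square)
  also have "ennreal (4 / \<sigma> a) + ennreal (4 / \<sigma> a) = ennreal (8 / \<sigma> a)"
    by (subst ennreal_plus[symmetric]) auto
  finally show ?thesis .
qed

lemma energy_le:
  assumes c: "1 \<le> c" and h: "h = c * \<eta>"
  shows "energy h grad_disp grad_height hess_height \<le>
    ennreal (4500000 * c\<^sup>2 * K^6 * (130000 * K^6 * \<eta>)\<^sup>2 * (6912 * 2 powr (1/3) * \<eta> powr (-1/3)))"
proof -
  let ?A = "4500000 * c\<^sup>2 * K^6 * (130000 * K^6 * \<eta>)\<^sup>2"
  let ?N = "2304 * 2 powr (1/3) * \<eta> powr (-1/3)"
  let ?f = "\<lambda>x::real^2. ennreal ((strip (x $ 2) (x $ 1))\<^sup>2) * indicator (ball 0 1) x"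
  let ?g = "\<lambda>x::real^2. ennreal ((strip (x $ 1) (x $ 2))\<^sup>2) * indicator (ball 0 1) x"
  let ?k = "\<lambda>x::real^2. ennreal ((crease (x $ 1) (x $ 2))\<^sup>2) * indicator (ball 0 1) x"
  have A: "0 \<le> ?A" using K_powers(4) by simp
  \<comment> \<open>The strain identities were proved off the coordinate axes, which form a null
    set.\<close>
  have ae: "AE x in lebesgue. (x::real^2) $ i \<noteq> 0" for i
  proof -
    have "negligible {x::real^2. x \<bullet> axis i 1 = 0}"
      by (rule negligible_standard_hyperplane) (auto simp: Basis_vec_def)
    then have "{x::real^2. x $ i = 0} \<in> null_sets lebesgue"
      by (simp add: inner_axis negligible_iff_null_sets)
    from AE_not_in[OF this] show ?thesis by simp
  qed
  have "energy h grad_disp grad_height hess_height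
      = (\<integral>\<^sup>+x. ennreal (edensity h x) * indicator (ball 0 1) x \<partial>lebesgue)"
    unfolding energy_def edensity_def by (subst nn_integral_restrict_space) auto
  also have "\<dots> \<le> (\<integral>\<^sup>+x. ennreal ?A * (?g x + ?f x + ?k x) \<partial>lebesgue)"
  proof (rule nn_integral_mono_AE)
    show "AE x in lebesgue. ennreal (edensity h x) * indicator (ball 0 1) x \<le> ennreal ?A * (?g x + ?f x + ?k x)"
      using ae[of 1] ae[of 2]
    proof eventually_elim
      case (elim x)
      show ?case
      proof (cases "x \<in> ball 0 1")
        case True
        have "?g x + ?f x + ?k x = ennreal ((strip (x $ 1) (x $ 2))\<^sup>2 + (strip (x $ 2) (x $ 1))\<^sup>2 + (crease (x $ 1) (x $ 2))\<^sup>2)"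
          using True by simp
        then have "ennreal ?A * (?g x + ?f x + ?k x) =
            ennreal (?A * ((strip (x $ 1) (x $ 2))\<^sup>2 + (strip (x $ 2) (x $ 1))\<^sup>2 + (crease (x $ 1) (x $ 2))\<^sup>2))"
          using A by (simp only: ennreal_mult'[symmetric])
        then show ?thesis using True edensity_le[OF True elim c h] by (simp only: ennreal_leI) (simp add: ennreal_leI)
      qed simp
    qed
  qed
  also have "\<dots> = (\<integral>\<^sup>+x. ennreal ?A * (?g x + ?f x + ?k x) \<partial>lborel)"
    by (rule nn_integral_completion)
  also have "\<dots> = ennreal ?A * ((\<integral>\<^sup>+x. ?g x \<partial>lborel) + (\<integral>\<^sup>+x. ?f x \<partial>lborel) + (\<integral>\<^sup>+x. ?k x \<partial>lborel))"
  proof -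
    have [measurable]: "ball 0 1 \<in> sets (borel :: (real^2) measure)" by simp
    have m: "?f \<in> borel_measurable lborel" "?g \<in> borel_measurable lborel" "?k \<in> borel_measurable lborel"
      by measurable
    note m' = borel_measurable_add[OF m(2,1)]
    show ?thesis
      unfolding nn_integral_cmult[OF borel_measurable_add[OF m' m(3)]] nn_integral_add[OF m' m(3)]
        nn_integral_add[OF m(2,1)] ..
  qed
  also have "\<dots> \<le> ennreal ?A * (ennreal ?N + ennreal ?N + ennreal ?N)"
    using nn_integral_slices[of "\<lambda>a b. (strip b a)\<^sup>2", OF _ _ slice_strip]
      nn_integral_slices(1)[of "\<lambda>a b. (crease a b)\<^sup>2", OF _ _ slice_crease]
    by (intro mult_left_mono add_mono) auto
  also have "\<dots> = ennreal (?A * (6912 * 2 powr (1/3) * \<eta> powr (-1/3)))"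
    using A by (simp add: ennreal_plus[symmetric] ennreal_mult'[symmetric] del: ennreal_plus)
  finally show ?thesis .
qed

end

theorem theorem1p2:
  shows "\<exists>C>0. \<forall>h \<delta>::real. 0 < h \<and> h \<le> 1/2 \<and> 0 \<le> \<delta> \<and> \<delta> \<le> 1/2 \<longrightarrow>
           (\<exists>U W DU DW D2W. admissible \<delta> U W DU DW D2W \<and>
              energy h DU DW D2W \<le> ennreal (C * h powr (5/3)))"
proof -
  obtain \<phi> v v' \<psi> \<xi> K where fp: "fold_profile \<phi> v v' \<psi> \<xi> K" using fold_profile_exists by blast
  interpret fp: fold_profile \<phi> v v' \<psi> \<xi> K by (rule fp)
  \<comment> \<open>With \<eta> = h/c the folds are narrow enough for the boundary condition for
    every \<open>h\<close> up to 1/2. The price is the factor c^2 in \<open>C\<close>, since the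
    bending term carries h = c \<eta> instead of \<eta>.\<close>
  define c where "c = 1000000 * K^3"
  have "1 \<le> K^3" using fp.K_ge_1 by simp
  then have c: "1 \<le> c" by (simp add: c_def)
  define C where "C = 4500000 * c\<^sup>2 * K^6 * (130000 * K^6)\<^sup>2 * (6912 * 2 powr (1/3))"
  have K0: "0 < K" using fp.K_ge_1 by simp
  have C: "0 < C" using c K0 by (simp add: C_def)
  show ?thesis
  proof (rule exI[of _ C], intro conjI C allI impI)
    fix h \<delta> :: real
    assume hd: "0 < h \<and> h \<le> 1/2 \<and> 0 \<le> \<delta> \<and> \<delta> \<le> 1/2"
    define \<eta> where "\<eta> = h / c"
    have \<eta>: "0 < \<eta>" "\<eta> \<le> h" "h = c * \<eta>" using hd c by (auto simp: \<eta>_def divide_le_eq)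
    have "\<eta> \<le> 1 / c" unfolding \<eta>_def using hd c by (intro divide_right_mono) auto
    then have small: "\<eta> \<le> 1 / (1000000 * K^3)" by (simp add: c_def)
    interpret folded_cone \<phi> v v' \<psi> \<xi> K \<eta>
      by unfold_locales (use \<eta>(1,2) hd in auto)
    have "\<eta>\<^sup>2 * \<eta> powr (-1/3) = \<eta> powr (5/3)"
      using \<eta>(1) by (simp add: powr_add[symmetric] flip: powr_numeral)
    then have "4500000 * c\<^sup>2 * K^6 * (130000 * K^6 * \<eta>)\<^sup>2 * (6912 * 2 powr (1/3) * \<eta> powr (-1/3)) = C * \<eta> powr (5/3)"
      unfolding C_def power_mult_distrib by (simp add: mult_ac)
    also have "\<dots> \<le> C * h powr (5/3)" using C \<eta> by (intro mult_left_mono powr_mono2) auto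
    finally have "energy h grad_disp grad_height hess_height \<le> ennreal (C * h powr (5/3))"
      using energy_le[OF c \<eta>(3)] by (meson ennreal_leI order_trans)
    then show "\<exists>U W DU DW D2W. admissible \<delta> U W DU DW D2W \<and> energy h DU DW D2W \<le> ennreal (C * h powr (5/3))"
      using admissible_folded[OF small] hd by blast
  qed
qed

end
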